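(* Let $q\le p-1$ and for $\lambda\in\Lambda_q$ let $u_\lambda$ be the unique weak solution of $(\mathcal E_\lambda)$. Then: (i) As $\lambda\to\sup\Lambda_q$, $(u_\lambda)$ blows up uniformly on compact subsets of $\Omega_0$, i.e. $\min_K u_\lambda\to+\infty$ for every compact $K\subset\Omega_0$. Moreover, if $q=p-1$, or if $q<p-1$ and $p\ge2$, then $(u_\lambda)$ blows up uniformly on compact subsets of $\Omega$: $\min_K u_\lambda\to+\infty$ for every compact $K\subset\Omega$. (ii) As $\lambda\to\inf\Lambda_q$, $u_\lambda\to0$ uniformly in $\Omega$.
   Context: Standing setting: $\Omega\subset\mathbb R^d$, $d\ge 2$, bounded domain with regular boundary; $s\in(0,1)$, $p\in(1,\infty)$; $(-\Delta)^s_p u(x)=2\,\mathrm{P.V.}\int_{\mathbb R^d}\frac{|u(x)-u(y)|^{p-2}(u(x)-u(y))}{|x-y|^{d+sp}}\,dy$. For an open $\omega\subset\mathbb R^d$, $W^{s,p}_0(\omega)=\{u\in L^p(\mathbb R^d): u=0\text{ a.e. off }\omega,\ \|u\|_{W^{s,p}_0(\omega)}<\infty\}$, $\|u\|^p_{W^{s,p}_0(\omega)}=\int_{\mathbb R^{2d}}\frac{|u(x)-u(y)|^p}{|x-y|^{d+sp}}dxdy$, with the pairing $\langle(-\Delta)^s_pu,v\rangle=\int_{\mathbb R^{2d}}\frac{|u(x)-u(y)|^{p-2}(u(x)-u(y))(v(x)-v(y))}{|x-y|^{d+sp}}dxdy$, and $\lambda_1(\omega)=\inf_{v\in W^{s,p}_0(\omega)\setminus\{0\}}\|v\|^p_{W^{s,p}_0(\omega)}/\|v\|^p_{L^p(\omega)}$.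 Parameters $q>0$, $r>p-1$, $\lambda>0$; $b\in L^\infty(\Omega)$, $b\ge0$, $b\not\equiv0$, $b^{-1}(\{0\})=\overline{\Omega_0}$ with $\Omega_0\subset\Omega$ a $C^{1,1}$ open set, $|\Omega_0|>0$. Problem $(\mathcal E_\lambda)$: $(-\Delta)^s_pu=\lambda u^q-b u^r$ in $\Omega$, $u=0$ in $\mathbb R^d\setminus\Omega$, $u>0$ in $\Omega$; a weak solution is a positive $u\in W^{s,p}_0(\Omega)$ with $\langle(-\Delta)^s_pu,\phi\rangle=\int_\Omega(\lambda u^q-bu^r)\phi$ for all $\phi\in W^{s,p}_0(\Omega)$. For $q\le p-1$, $\Lambda_q=(0,+\infty)$ if $q<p-1$ and $\Lambda_q=(\lambda_1(\Omega),\lambda_1(\Omega_0))$ if $q=p-1$. Known fact used here: for $q\le p-1$, $(\mathcal E_\lambda)$ has a (unique) weak solution $u_\lambda$ if and only if $\lambda\in\Lambda_q$, and $u_\lambda\in C^s(\mathbb R^d)$. *)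

theory Defs
  imports "HOL-Analysis.Analysis"
begin

text \<open>An open set U is of class C^{1,1} if near every boundary point it is, after
choosing a unit direction e, the strict supergraph (in direction e) of a C^1 function
with Lipschitz gradient defined on the hyperplane orthogonal to e (the function is
given on the whole space and evaluated on the orthogonal projection onto that hyperplane).\<close>

definition C11_open_set :: "'a::euclidean_space set \<Rightarrow> bool" where
  "C11_open_set U \<longleftrightarrow> open U \<and>
     (\<forall>x\<in>frontier U. \<exists>r>0. \<exists>e::'a. norm e = 1 \<and>
        (\<exists>(g::'a \<Rightarrow> real) (Dg::'a \<Rightarrow> 'a \<Rightarrow> real) L.
           (\<forall>z. (g has_derivative Dg z) (at z)) \<and>
           (\<forall>z w. onorm (\<lambda>h. Dg z h - Dg w h) \<le> L * norm (z - w)) \<and>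
           U \<inter> ball x r = {y \<in> ball x r. y \<bullet> e > g (y - (y \<bullet> e) *\<^sub>R e)}))"

definition gagliardo :: "real \<Rightarrow> real \<Rightarrow> ('a::euclidean_space \<Rightarrow> real) \<Rightarrow> ennreal" where
  "gagliardo s p u =
     (\<integral>\<^sup>+ z. ennreal (\<bar>u (fst z) - u (snd z)\<bar> powr p /
                 norm (fst z - snd z) powr (real DIM('a) + s * p)) \<partial>(lborel \<Otimes>\<^sub>M lborel))"

definition Lp_norm_pow :: "real \<Rightarrow> ('a::euclidean_space \<Rightarrow> real) \<Rightarrow> ennreal" where
  "Lp_norm_pow p u = (\<integral>\<^sup>+ x. ennreal (\<bar>u x\<bar> powr p) \<partial>lborel)"

definition W0 :: "real \<Rightarrow> real \<Rightarrow> 'a::euclidean_space set \<Rightarrow> ('a \<Rightarrow> real) set" where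
  "W0 s p \<omega> = {u. u \<in> borel_measurable lborel \<and> Lp_norm_pow p u < \<infinity> \<and>
                  (AE x in lborel. x \<notin> \<omega> \<longrightarrow> u x = 0) \<and> gagliardo s p u < \<infinity>}"

definition frac_pLap_integrand ::
  "real \<Rightarrow> real \<Rightarrow> ('a::euclidean_space \<Rightarrow> real) \<Rightarrow> ('a \<Rightarrow> real) \<Rightarrow> 'a \<times> 'a \<Rightarrow> real" where
  "frac_pLap_integrand s p u v z =
     \<bar>u (fst z) - u (snd z)\<bar> powr (p - 2) * (u (fst z) - u (snd z)) * (v (fst z) - v (snd z)) /
       norm (fst z - snd z) powr (real DIM('a) + s * p)"

definition frac_pLap_pair ::
  "real \<Rightarrow> real \<Rightarrow> ('a::euclidean_space \<Rightarrow> real) \<Rightarrow> ('a \<Rightarrow> real) \<Rightarrow> real" where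
  "frac_pLap_pair s p u v = (\<integral> z. frac_pLap_integrand s p u v z \<partial>(lborel \<Otimes>\<^sub>M lborel))"

definition lambda1 :: "real \<Rightarrow> real \<Rightarrow> 'a::euclidean_space set \<Rightarrow> real" where
  "lambda1 s p \<omega> = Inf {enn2real (gagliardo s p v) / enn2real (Lp_norm_pow p v) | v.
                         v \<in> W0 s p \<omega> \<and> Lp_norm_pow p v \<noteq> 0}"

definition weak_solution ::
  "real \<Rightarrow> real \<Rightarrow> real \<Rightarrow> real \<Rightarrow> ('a::euclidean_space \<Rightarrow> real) \<Rightarrow> 'a set \<Rightarrow> real
     \<Rightarrow> ('a \<Rightarrow> real) \<Rightarrow> bool" where
  "weak_solution s p q r b \<Omega> lam u \<longleftrightarrow>
     u \<in> W0 s p \<Omega> \<and> (AE x in lborel. x \<in> \<Omega> \<longrightarrow> u x > 0) \<and>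
     (\<forall>\<phi> \<in> W0 s p \<Omega>.
        integrable (lborel \<Otimes>\<^sub>M lborel) (frac_pLap_integrand s p u \<phi>) \<and>
        set_integrable lborel \<Omega> (\<lambda>x. (lam * u x powr q - b x * u x powr r) * \<phi> x) \<and>
        frac_pLap_pair s p u \<phi> =
          (LINT x:\<Omega>|lborel. (lam * u x powr q - b x * u x powr r) * \<phi> x))"

text \<open>The existence range \<Lambda>_q (for q \<le> p - 1).\<close>
definition Lambda_q :: "real \<Rightarrow> real \<Rightarrow> real \<Rightarrow> 'a::euclidean_space set \<Rightarrow> 'a set \<Rightarrow> real set" where
  "Lambda_q s p q \<Omega> \<Omega>0 =
     (if q < p - 1 then {0<..} else {lambda1 s p \<Omega> <..< lambda1 s p \<Omega>0})"

definition to_sup_Lambda :: "real \<Rightarrow> real \<Rightarrow> real \<Rightarrow> 'a::euclidean_space set \<Rightarrow> 'a set \<Rightarrow> real filter" where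
  "to_sup_Lambda s p q \<Omega> \<Omega>0 =
     (if q < p - 1 then at_top else at (lambda1 s p \<Omega>0) within Lambda_q s p q \<Omega> \<Omega>0)"

definition to_inf_Lambda :: "real \<Rightarrow> real \<Rightarrow> real \<Rightarrow> 'a::euclidean_space set \<Rightarrow> 'a set \<Rightarrow> real filter" where
  "to_inf_Lambda s p q \<Omega> \<Omega>0 =
     (if q < p - 1 then at 0 within Lambda_q s p q \<Omega> \<Omega>0
      else at (lambda1 s p \<Omega>) within Lambda_q s p q \<Omega> \<Omega>0)"

end

theory Submission
  imports Defs
begin

text \<open>Three tools, all obtained from the weak formulation by choosing test functions, suffice.

  (1) Sup estimate: testing with \<open>(u - 3M/4)\<^sup>+\<close>, where \<open>M = max u\<close>, and using the strong nonlocal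
  interaction of \<open>{u > 3M/4}\<close> with \<open>{u \<le> M/2}\<close>, the set \<open>{u > M/2}\<close> has measure bounded below when
  \<open>q = p - 1\<close>, and \<open>M\<^bsup>p-1-q\<^esup> \<le> C \<lambda>\<close> always.

  (2) Expansion of positivity: if \<open>{u > L}\<close> has measure at least \<open>\<delta>\<close>, then \<open>u \<ge> \<kappa>\<close> on a compact
  \<open>K\<close>, with \<open>\<kappa>\<close> depending only on \<open>L\<close>, \<open>\<delta>\<close>, \<open>K\<close> and tending to infinity with \<open>L\<close>. One compares
  \<open>u\<close> with small multiples of rescaled copies of one fixed solution.

  (3) The discrete Picone inequality, testing with \<open>w\<^sup>p / (u + \<epsilon>)\<^bsup>p-1\<^esup>\<close>.

  For \<open>q < p - 1\<close>, (1) gives the vanishing as \<open>\<lambda> \<rightarrow> 0\<close>; (3) with \<open>w\<close> supported where \<open>b = 0\<close> makes \<open>u\<close>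
  large on a set of fixed measure as \<open>\<lambda> \<rightarrow> \<infinity>\<close>, and (2) spreads this over \<open>\<Omega>\<close>.
  For \<open>q = p - 1\<close>, if \<open>M\<close> stayed bounded as \<open>\<lambda> \<rightarrow> \<lambda>\<^sub>1(\<Omega>\<^sub>0)\<close>, then \<open>u / M\<close> would be bounded
  below on a ball outside \<open>\<Omega>\<^sub>0\<close>, and the resulting gain in (3) would give
  \<open>\<lambda>\<^sub>1(\<Omega>\<^sub>0) \<ge> \<lambda> + c\<close>; so \<open>M \<rightarrow> \<infinity>\<close>, and (1), (2) conclude. As \<open>\<lambda> \<rightarrow> \<lambda>\<^sub>1(\<Omega>)\<close>, testing with \<open>u\<close> shows that
  \<open>\<integral> b u\<^bsup>r+1\<^esup> \<rightarrow> 0\<close>, which by (1) and (2) is impossible unless \<open>M \<rightarrow> 0\<close>.\<close>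

section \<open>Elementary inequalities\<close>

text \<open>The odd, increasing nonlinearity inside the fractional p-Laplacian. The convention
  \<open>0 powr a = 0\<close> gives the value 0 at \<open>t = 0\<close> for every
  \<open>p\<close>.\<close>

definition jp :: "real \<Rightarrow> real \<Rightarrow> real" where
  "jp p t = \<bar>t\<bar> powr (p - 2) * t"

lemma jp_nonneg_eq: "0 \<le> t \<Longrightarrow> jp p t = t powr (p - 1)"
  by (cases "t = 0") (simp_all add: jp_def powr_diff power2_eq_square)

lemma jp_minus [simp]: "jp p (- t) = - jp p t"
  by (simp add: jp_def)

lemma jp_nonpos_eq: "t \<le> 0 \<Longrightarrow> jp p t = - ((- t) powr (p - 1))"
  using jp_nonneg_eq[of "- t" p] by simp

lemma jp_mult_self: "jp p t * t = \<bar>t\<bar> powr p"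
  by (cases "t = 0") (auto simp: jp_def powr_diff power2_eq_square)

lemma jp_scale: "0 \<le> c \<Longrightarrow> jp p (c * t) = c powr (p - 1) * jp p t"
  by (cases "c = 0") (simp_all add: jp_def abs_mult powr_mult powr_diff power2_eq_square)

lemma jp_mono:
  assumes "1 < p" "a \<le> b" shows "jp p a \<le> jp p b"
proof -
  consider "0 \<le> a" | "a \<le> 0" "0 \<le> b" | "b \<le> 0" using assms by linarith
  then show ?thesis
  proof cases
    case 1 then show ?thesis using assms by (simp add: jp_nonneg_eq powr_mono2)
  next
    case 2
    have "0 \<le> (- a) powr (p - 1)" "0 \<le> b powr (p - 1)" by (rule powr_ge_zero)+
    with 2 show ?thesis unfolding jp_nonneg_eq[OF 2(2)] jp_nonpos_eq[OF 2(1)] by linarith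
  next
    case 3 then show ?thesis using assms by (simp add: jp_nonpos_eq powr_mono2)
  qed
qed

text \<open>Pointwise form of the weak comparison principle. The increment of the test function
  \<open>max 0 (a - u)\<close> never has the sign opposite to \<open>(ax - ay) - (ux - uy)\<close>,
  and \<open>jp p\<close> is monotone, so exchanging \<open>u\<close> for the barrier
  \<open>a\<close> can only increase the product.\<close>

lemma jp_diff_pos_part_nonneg:
  fixes ax ay ux uy :: real
  assumes "1 < p"
  shows "jp p (ux - uy) * (max 0 (ax - ux) - max 0 (ay - uy)) \<le>
         jp p (ax - ay) * (max 0 (ax - ux) - max 0 (ay - uy))"
proof (cases "ux - uy \<le> ax - ay")
  case True
  then have "max 0 (ax - ux) - max 0 (ay - uy) \<ge> 0" by auto
  then show ?thesis using jp_mono[OF assms True] by (rule mult_right_mono[rotated])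
next
  case False
  then have "max 0 (ax - ux) - max 0 (ay - uy) \<le> 0" by auto
  then show ?thesis using jp_mono[OF assms, of "ax - ay" "ux - uy"] False
    by (intro mult_right_mono_neg) auto
qed

text \<open>Quantifies the comparison when \<open>u\<close> is below the barrier at \<open>x\<close>
  but far above it at \<open>y\<close>. The test function vanishes at \<open>y\<close>, while
  \<open>ux - uy\<close> is at most \<open>- (T - k)\<close> and \<open>ax - ay\<close> is at least
  \<open>- k\<close>; the gap between the two values of \<open>jp p\<close> is the gain.\<close>

lemma jp_diff_pos_part_gain:
  fixes ax ay ux uy :: real
  assumes "1 < p" "0 \<le> ux" "ux < ax" "0 \<le> ay" "ax \<le> k" "ay \<le> k" "k < T" "T < uy"
  shows "jp p (ux - uy) * (max 0 (ax - ux) - max 0 (ay - uy)) +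
           ((T - k) powr (p - 1) - k powr (p - 1)) * max 0 (ax - ux)
         \<le> jp p (ax - ay) * (max 0 (ax - ux) - max 0 (ay - uy))"
proof -
  have "jp p (ux - uy) \<le> jp p (k - T)" using assms by (intro jp_mono) auto
  also have "\<dots> = - ((T - k) powr (p - 1))" using assms by (subst jp_nonpos_eq) auto
  finally have 1: "jp p (ux - uy) \<le> - ((T - k) powr (p - 1))" .
  have "jp p (- k) \<le> jp p (ax - ay)" using assms by (intro jp_mono) auto
  moreover have "jp p (- k) = - (k powr (p - 1))" using assms by (subst jp_nonpos_eq) auto
  ultimately have 2: "- (k powr (p - 1)) \<le> jp p (ax - ay)" by simp
  have "(jp p (ux - uy) + ((T - k) powr (p - 1) - k powr (p - 1))) * (ax - ux) \<le> jp p (ax - ay) * (ax - ux)"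
    using 1 2 assms by (intro mult_right_mono) auto
  then show ?thesis using assms by (auto simp: algebra_simps max_def)
qed

section \<open>Convexity of powers and the discrete Picone inequality\<close>

text \<open>Convexity of the p-th power at two rescaled points. In the degenerate cases
  \<open>d = 0\<close> and \<open>c = d\<close> one of these points is 0, and it is enough that the
  weights raised to \<open>1 - p\<close> are at least 1.\<close>

lemma powr_convex_split:
  fixes a c t p :: real
  assumes "1 \<le> p" "0 < t" "t < 1" "0 \<le> d" "d \<le> c"
  shows "c powr p \<le> (1 - t) powr (1 - p) * (c - d) powr p + t powr (1 - p) * d powr p"
proof -
  consider "d = 0" "c = 0" | "d = 0" "c > 0" | "d > 0" "c = d" | "d > 0" "c > d" using assms by linarith
  then show ?thesis
  proof cases
    case 1 then show ?thesis by simp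
  next
    case 2
    have "1 \<le> (1 - t) powr (1 - p)" using assms by (intro powr_mono2'[of "1 - p" "1 - t" 1, simplified]) auto
    then have "1 * c powr p \<le> (1 - t) powr (1 - p) * c powr p" by (intro mult_right_mono) auto
    then show ?thesis using 2 by simp
  next
    case 3
    have "1 \<le> t powr (1 - p)" using assms by (intro powr_mono2'[of "1 - p" t 1, simplified]) auto
    then have "1 * c powr p \<le> t powr (1 - p) * c powr p" by (intro mult_right_mono) auto
    then show ?thesis using 3 by simp
  next
    case 4
    have "((1 - t) *\<^sub>R ((c - d) / (1 - t)) + t *\<^sub>R (d / t)) powr p
        \<le> (1 - t) * ((c - d) / (1 - t)) powr p + t * (d / t) powr p"
      using assms 4 by (intro convex_onD[OF powr_convex]) auto
    moreover have "(1 - t) *\<^sub>R ((c - d) / (1 - t)) + t *\<^sub>R (d / t) = c" using assms by simp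
    moreover have "(1 - t) * ((c - d) / (1 - t)) powr p = (1 - t) powr (1 - p) * (c - d) powr p"
      using assms 4 by (simp add: powr_divide powr_diff)
    moreover have "t * (d / t) powr p = t powr (1 - p) * d powr p"
      using assms 4 by (simp add: powr_divide powr_diff)
    ultimately show ?thesis by simp
  qed
qed

text \<open>With \<open>t = b / a\<close> this says that \<open>c\<^sup>p\<close> is at most the convex combination of
  \<open>((c - d) / (1 - t))\<^sup>p\<close> and \<open>(d / t)\<^sup>p\<close> with weights \<open>1 - t\<close> and \<open>t\<close>.\<close>

lemma picone_le:
  fixes a b c d p :: real
  assumes "1 < p" "0 < b" "b \<le> a" "0 \<le> c" "0 \<le> d"
  shows "jp p (a - b) * (c powr p / a powr (p - 1) - d powr p / b powr (p - 1)) \<le> \<bar>c - d\<bar> powr p"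
proof -
  define t where "t = b / a"
  have a: "a > 0" using assms by linarith
  have t: "0 < t" "t \<le> 1" "b = t * a" using assms by (auto simp: t_def)
  \<comment> \<open>By homogeneity in \<open>(a, b)\<close> the left side depends on
    \<open>t\<close> alone, since \<open>b = t * a\<close>.\<close>
  have L: "jp p (a - b) * (c powr p / a powr (p - 1) - d powr p / b powr (p - 1))
      = (1 - t) powr (p - 1) * (c powr p - t powr (1 - p) * d powr p)"
  proof -
    have "jp p (a - b) = jp p (a * (1 - t))" using t by (simp add: algebra_simps)
    also have "\<dots> = a powr (p - 1) * (1 - t) powr (p - 1)" using t a by (simp add: jp_scale jp_nonneg_eq powr_mult)
    finally have 1: "jp p (a - b) = a powr (p - 1) * (1 - t) powr (p - 1)" .
    have 2: "b powr (p - 1) = t powr (p - 1) * a powr (p - 1)" using t a by (simp add: powr_mult)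
    have 3: "t powr (1 - p) = 1 / t powr (p - 1)" using t by (simp add: powr_diff)
    have "a powr (p - 1) > 0" "t powr (p - 1) > 0" using a t by auto
    then show ?thesis unfolding 1 2 3 by (simp add: field_simps)
  qed
  consider "t = 1" | "t < 1" "c \<le> d" | "t < 1" "d \<le> c" using t by linarith
  then show ?thesis
  proof cases
    case 1 then show ?thesis unfolding L by simp
  next
    case 2
    have "1 \<le> t powr (1 - p)" using assms t by (intro powr_mono2'[of "1 - p" t 1, simplified]) auto
    moreover have "c powr p \<le> d powr p" using 2 assms by (intro powr_mono2) auto
    ultimately have "1 * c powr p \<le> t powr (1 - p) * d powr p" by (intro mult_mono) auto
    then have "(1 - t) powr (p - 1) * (c powr p - t powr (1 - p) * d powr p) \<le> 0"
      by (intro mult_nonneg_nonpos) auto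
    then show ?thesis unfolding L by (rule order_trans) (rule powr_ge_zero)
  next
    case 3
    have "(1 - t) powr (p - 1) * (c powr p - t powr (1 - p) * d powr p)
        \<le> (1 - t) powr (p - 1) * ((1 - t) powr (1 - p) * (c - d) powr p)"
      using powr_convex_split[of p t d c] 3 t assms by (intro mult_left_mono) auto
    also have "\<dots> = (c - d) powr p" using 3 by (simp add: mult.assoc[symmetric] powr_add[symmetric])
    finally show ?thesis unfolding L using 3 by simp
  qed
qed

lemma picone:
  fixes a b c d p :: real
  assumes "1 < p" "0 < b" "0 < a" "0 \<le> c" "0 \<le> d"
  shows "jp p (a - b) * (c powr p / a powr (p - 1) - d powr p / b powr (p - 1)) \<le> \<bar>c - d\<bar> powr p"
proof (cases "b \<le> a")
  case True then show ?thesis using picone_le assms by blast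
next
  case False
  have "jp p (b - a) * (d powr p / b powr (p - 1) - c powr p / a powr (p - 1)) \<le> \<bar>d - c\<bar> powr p"
    using False assms by (intro picone_le) auto
  moreover have "jp p (b - a) = - jp p (a - b)" using jp_minus[of p "a - b"] by simp
  ultimately show ?thesis by (simp add: abs_minus_commute algebra_simps)
qed

text \<open>The surplus in Picone's inequality when \<open>d = 0\<close>. If \<open>b\<close> is at
  least the fraction \<open>\<tau>\<close> of \<open>a\<close>, then \<open>a - b\<close> is at most
  \<open>(1 - \<tau>) * a\<close>, and a fixed share of \<open>c powr p\<close> is left over. This
  share later becomes an additive gain in the eigenvalue parameter.\<close>

lemma picone_gap:
  fixes a b c p :: real
  assumes "1 < p" "0 < a" "0 \<le> \<tau>" "\<tau> \<le> 1" "\<tau> * a \<le> b"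
  shows "jp p (a - b) * (c powr p / a powr (p - 1)) + (1 - (1 - \<tau>) powr (p - 1)) * c powr p \<le> c powr p"
proof -
  have "jp p (a - b) \<le> jp p (a * (1 - \<tau>))" using assms by (intro jp_mono) (auto simp: algebra_simps)
  also have "\<dots> = a powr (p - 1) * (1 - \<tau>) powr (p - 1)" using assms by (simp add: jp_nonneg_eq powr_mult)
  finally have "jp p (a - b) * (c powr p / a powr (p - 1))
      \<le> a powr (p - 1) * (1 - \<tau>) powr (p - 1) * (c powr p / a powr (p - 1))"
    by (intro mult_right_mono) auto
  then show ?thesis using assms by (simp add: algebra_simps)
qed

section \<open>Lipschitz bounds for powers, needed for the Picone quotient\<close>

lemma powr_lipschitz:
  fixes p N x y :: real
  assumes "1 < p" "0 \<le> x" "x \<le> N" "0 \<le> y" "y \<le> N"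
  shows "\<bar>x powr p - y powr p\<bar> \<le> p * N powr (p - 1) * \<bar>x - y\<bar>"
proof -
  have *: "y powr p - x powr p \<le> p * N powr (p - 1) * (y - x)" if "0 \<le> x" "x < y" "y \<le> N" for x y :: real
  proof -
    have "continuous_on {x..y} (\<lambda>z. z powr p)"
      using that assms by (intro continuous_intros continuous_on_powr') auto
    moreover have "(\<lambda>z. z powr p) differentiable (at z)" if "x < z" for z
      using that \<open>0 \<le> x\<close> by (intro differentiableI derivative_eq_intros | simp)+
    ultimately obtain l z where z: "x < z" "z < y" "((\<lambda>z. z powr p) has_real_derivative l) (at z)"
        "y powr p - x powr p = (y - x) * l"
      using MVT[OF \<open>x < y\<close>, of "\<lambda>z. z powr p"] by blast
    have "((\<lambda>z. z powr p) has_real_derivative p * z powr (p - 1)) (at z)"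
      using z \<open>0 \<le> x\<close> by (auto intro!: derivative_eq_intros simp: powr_diff)
    then have l: "l = p * z powr (p - 1)" using z(3) DERIV_unique by blast
    have "z powr (p - 1) \<le> N powr (p - 1)" using z that assms by (intro powr_mono2) auto
    then have "(p * (y - x)) * z powr (p - 1) \<le> (p * (y - x)) * N powr (p - 1)"
      using that assms by (intro mult_left_mono) auto
    then show ?thesis unfolding z(4) l by (simp only: mult_ac)
  qed
  show ?thesis
  proof (cases x y rule: linorder_cases)
    case less
    then have "x powr p \<le> y powr p" using assms by (intro powr_mono2) auto
    then show ?thesis using *[of x y] less assms by simp
  next
    case greater
    then have "y powr p \<le> x powr p" using assms by (intro powr_mono2) auto
    then show ?thesis using *[of y x] greater assms by simp
  qed simp
qed

lemma powr_minus_lipschitz: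
  fixes \<alpha> \<epsilon> x y :: real
  assumes "0 < \<alpha>" "0 < \<epsilon>" "\<epsilon> \<le> x" "\<epsilon> \<le> y"
  shows "\<bar>x powr - \<alpha> - y powr - \<alpha>\<bar> \<le> \<alpha> * \<epsilon> powr (- \<alpha> - 1) * \<bar>x - y\<bar>"
proof -
  have *: "\<bar>x powr - \<alpha> - y powr - \<alpha>\<bar> \<le> \<alpha> * \<epsilon> powr (- \<alpha> - 1) * \<bar>x - y\<bar>" if "\<epsilon> \<le> x" "x < y" for x y :: real
  proof -
    have "\<exists>z>x. z < y \<and> y powr - \<alpha> - x powr - \<alpha> = (y - x) * (- \<alpha> * z powr (- \<alpha> - 1))"
      using that assms by (intro MVT2) (auto intro!: derivative_eq_intros simp: powr_diff)
    then obtain z where z: "x < z" "z < y"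
        "y powr - \<alpha> - x powr - \<alpha> = (y - x) * (- \<alpha> * z powr (- \<alpha> - 1))" by auto
    have "z powr (- \<alpha> - 1) \<le> \<epsilon> powr (- \<alpha> - 1)" using z that assms by (intro powr_mono2') auto
    then have "(y - x) * \<alpha> * z powr (- \<alpha> - 1) \<le> (y - x) * \<alpha> * \<epsilon> powr (- \<alpha> - 1)"
      using that assms by (intro mult_left_mono) auto
    moreover have "\<bar>x powr - \<alpha> - y powr - \<alpha>\<bar> = (y - x) * \<alpha> * z powr (- \<alpha> - 1)"
      using that assms z by (subst abs_minus_commute) (simp add: abs_mult)
    ultimately show ?thesis using that by (simp add: algebra_simps)
  qed
  show ?thesis using *[of x y] *[of y x] assms
    by (cases x y rule: linorder_cases) (auto simp: abs_minus_commute)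
qed

section \<open>Function spaces and rescaling\<close>

text \<open>On the diagonal the value is 0, by the conventions for \<open>powr\<close> and division;
  this is why \<open>gk_lower\<close> asks for \<open>x \<noteq> y\<close>.\<close>

definition gk :: "real \<Rightarrow> real \<Rightarrow> 'a::euclidean_space \<times> 'a \<Rightarrow> real" where
  "gk s p z = 1 / norm (fst z - snd z) powr (real DIM('a) + s * p)"

lemma gk_nonneg [simp]: "0 \<le> gk s p z"
  by (simp add: gk_def)

lemma measurable_gk [measurable]: "gk s p \<in> borel_measurable (lborel \<Otimes>\<^sub>M lborel)"
  unfolding gk_def by measurable

lemma gk_lower:
  fixes x y :: "'a::euclidean_space"
  assumes "norm (x - y) \<le> D" "0 \<le> s * p" "x \<noteq> y"
  shows "1 / D powr (real DIM('a) + s * p) \<le> gk s p (x, y)"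
proof -
  have "norm (x - y) powr (real DIM('a) + s * p) \<le> D powr (real DIM('a) + s * p)"
    using assms by (intro powr_mono2) auto
  moreover have "0 < norm (x - y) powr (real DIM('a) + s * p)" using assms by simp
  ultimately show ?thesis unfolding gk_def fst_conv snd_conv by (auto intro!: divide_left_mono mult_pos_pos)
qed

lemma frac_pLap_integrand_eq:
  "frac_pLap_integrand s p u v z = jp p (u (fst z) - u (snd z)) * (v (fst z) - v (snd z)) * gk s p z"
  by (simp add: frac_pLap_integrand_def gk_def jp_def)

lemma gagliardo_eq:
  "gagliardo s p u = (\<integral>\<^sup>+ z. ennreal (\<bar>u (fst z) - u (snd z)\<bar> powr p * gk s p z) \<partial>(lborel \<Otimes>\<^sub>M lborel))"
  by (simp add: gagliardo_def gk_def)

text \<open>The way a nonlocal interaction yields a quantitative gain: \<open>H\<close> dominates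
  \<open>f\<close> of the first variable on \<open>A\<close>, and every slice of \<open>A\<close>
  over a point with \<open>f x > 0\<close> has measure at least \<open>m\<close>, so Tonelli gives
  the bound. The sup estimate, the expansion of positivity and the Picone gain all pass through
  it.\<close>

lemma integral_ge_sectional:
  fixes H :: "'a::euclidean_space \<times> 'a \<Rightarrow> real" and f :: "'a \<Rightarrow> real"
  assumes H: "integrable (lborel \<Otimes>\<^sub>M lborel) H"
    and f: "integrable lborel f" "\<And>x. 0 \<le> f x"
    and A: "A \<in> sets (lborel \<Otimes>\<^sub>M lborel)"
    and le: "\<And>z. f (fst z) * indicator A z \<le> H z"
    and m: "0 \<le> m" "\<And>x. 0 < f x \<Longrightarrow> ennreal m \<le> emeasure lborel {y. (x, y) \<in> A}"
  shows "m * (\<integral>x. f x \<partial>lborel) \<le> (\<integral>z. H z \<partial>(lborel \<Otimes>\<^sub>M lborel))"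
proof -
  have [measurable]: "f \<in> borel_measurable lborel" "A \<in> sets (lborel \<Otimes>\<^sub>M lborel)" using f A by auto
  have H0: "0 \<le> H z" for z by (rule order_trans[OF _ le]) (simp add: f(2))
  have "ennreal (m * (\<integral>x. f x \<partial>lborel)) = ennreal m * (\<integral>\<^sup>+x. ennreal (f x) \<partial>lborel)"
    using m f by (simp add: ennreal_mult nn_integral_eq_integral integral_nonneg_AE)
  also have "\<dots> = (\<integral>\<^sup>+x. ennreal (f x) * ennreal m \<partial>lborel)"
    by (subst nn_integral_multc) (auto simp: mult.commute)
  also have "\<dots> \<le> (\<integral>\<^sup>+x. \<integral>\<^sup>+y. ennreal (f (fst (x, y)) * indicator A (x, y)) \<partial>lborel \<partial>lborel)"
  proof (rule nn_integral_mono)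
    fix x
    have "ennreal (f x) * ennreal m \<le> ennreal (f x) * emeasure lborel {y. (x, y) \<in> A}"
    proof (cases "0 < f x")
      case True then show ?thesis using m(2) by (intro mult_left_mono) auto
    next
      case False then show ?thesis using f(2)[of x] by (simp add: ennreal_neg)
    qed
    also have "\<dots> = (\<integral>\<^sup>+y. ennreal (f x) * indicator {y. (x, y) \<in> A} y \<partial>lborel)"
    proof -
      have "Pair x -` A \<in> sets lborel" by (rule sets_Pair1) (rule A)
      then have "{y. (x, y) \<in> A} \<in> sets lborel" by (simp add: vimage_def)
      then show ?thesis by (simp add: nn_integral_cmult_indicator)
    qed
    also have "\<dots> = (\<integral>\<^sup>+y. ennreal (f (fst (x, y)) * indicator A (x, y)) \<partial>lborel)"
      by (intro nn_integral_cong) (auto simp: indicator_def)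
    finally show "ennreal (f x) * ennreal m \<le> (\<integral>\<^sup>+y. ennreal (f (fst (x, y)) * indicator A (x, y)) \<partial>lborel)" .
  qed
  also have "\<dots> = (\<integral>\<^sup>+z. ennreal (f (fst z) * indicator A z) \<partial>(lborel \<Otimes>\<^sub>M lborel))"
    by (rule lborel.nn_integral_fst) measurable
  also have "\<dots> \<le> (\<integral>\<^sup>+z. ennreal (H z) \<partial>(lborel \<Otimes>\<^sub>M lborel))"
    using le by (intro nn_integral_mono ennreal_leI) auto
  also have "\<dots> = ennreal (\<integral>z. H z \<partial>(lborel \<Otimes>\<^sub>M lborel))"
    using H H0 by (intro nn_integral_eq_integral) auto
  finally show ?thesis by (subst (asm) ennreal_le_iff) (auto intro!: integral_nonneg_AE simp: H0)
qed

section \<open>Membership in the fractional Sobolev space\<close>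

lemma W0_D:
  assumes "u \<in> W0 s p \<omega>"
  shows "u \<in> borel_measurable lborel" "Lp_norm_pow p u < \<infinity>" "gagliardo s p u < \<infinity>"
    "AE x in lborel. x \<notin> \<omega> \<longrightarrow> u x = 0"
  using assms by (auto simp: W0_def)

lemma add_powr_le:
  fixes a b p :: real assumes "0 \<le> a" "0 \<le> b" "0 \<le> p"
  shows "(a + b) powr p \<le> 2 powr p * a powr p + 2 powr p * b powr p"
proof -
  have "(a + b) powr p \<le> (2 * max a b) powr p" using assms by (intro powr_mono2) auto
  also have "\<dots> = 2 powr p * max a b powr p" using assms by (simp add: powr_mult)
  also have "\<dots> \<le> 2 powr p * a powr p + 2 powr p * b powr p" by (auto simp: max_def)
  finally show ?thesis .
qed

text \<open>Transfers membership through a bound on values and on increments. Two reference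
  functions allow truncations, differences and the Picone quotient to be treated alike.\<close>

lemma W0_dominated:
  fixes \<phi> u v :: "'a::euclidean_space \<Rightarrow> real"
  assumes u: "u \<in> W0 s p \<omega>1" and v: "v \<in> W0 s p \<omega>2" and p: "1 < p" and C: "0 \<le> C"
    and [measurable]: "\<phi> \<in> borel_measurable lborel"
    and a: "\<And>x. \<bar>\<phi> x\<bar> \<le> C * (\<bar>u x\<bar> + \<bar>v x\<bar>)"
    and d: "\<And>x y. \<bar>\<phi> x - \<phi> y\<bar> \<le> C * (\<bar>u x - u y\<bar> + \<bar>v x - v y\<bar>)"
    and z: "AE x in lborel. x \<notin> \<omega> \<longrightarrow> \<phi> x = 0"
  shows "\<phi> \<in> W0 s p \<omega>"
proof -
  note [measurable] = W0_D(1)[OF u] W0_D(1)[OF v]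
  let ?c = "C powr p * 2 powr p"
  have *: "\<bar>e\<bar> powr p \<le> ?c * \<bar>a\<bar> powr p + ?c * \<bar>b\<bar> powr p" if "\<bar>e\<bar> \<le> C * (\<bar>a\<bar> + \<bar>b\<bar>)" for e a b :: real
  proof -
    have "\<bar>e\<bar> powr p \<le> (C * (\<bar>a\<bar> + \<bar>b\<bar>)) powr p" using that p by (intro powr_mono2) auto
    also have "\<dots> = C powr p * (\<bar>a\<bar> + \<bar>b\<bar>) powr p" using C by (simp add: powr_mult)
    also have "\<dots> \<le> C powr p * (2 powr p * \<bar>a\<bar> powr p + 2 powr p * \<bar>b\<bar> powr p)"
      using p by (intro mult_left_mono add_powr_le) auto
    finally show ?thesis by (simp add: algebra_simps)
  qed
  have "Lp_norm_pow p \<phi> \<le> (\<integral>\<^sup>+x. ennreal ?c * ennreal (\<bar>u x\<bar> powr p) + ennreal ?c * ennreal (\<bar>v x\<bar> powr p) \<partial>lborel)"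
    unfolding Lp_norm_pow_def using *[OF a]
    by (intro nn_integral_mono) (simp flip: ennreal_mult ennreal_plus)
  also have "\<dots> = ennreal ?c * Lp_norm_pow p u + ennreal ?c * Lp_norm_pow p v"
    unfolding Lp_norm_pow_def by (simp add: nn_integral_add nn_integral_cmult)
  also have "\<dots> < \<infinity>" using W0_D[OF u] W0_D[OF v] by (simp add: ennreal_mult_less_top)
  finally have 1: "Lp_norm_pow p \<phi> < \<infinity>" .
  have "gagliardo s p \<phi> \<le> (\<integral>\<^sup>+z. ennreal ?c * ennreal (\<bar>u (fst z) - u (snd z)\<bar> powr p * gk s p z)
      + ennreal ?c * ennreal (\<bar>v (fst z) - v (snd z)\<bar> powr p * gk s p z) \<partial>(lborel \<Otimes>\<^sub>M lborel))"
    unfolding gagliardo_eq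
  proof (intro nn_integral_mono)
    fix z :: "'a \<times> 'a"
    have "\<bar>\<phi> (fst z) - \<phi> (snd z)\<bar> powr p * gk s p z \<le> (?c * \<bar>u (fst z) - u (snd z)\<bar> powr p + ?c * \<bar>v (fst z) - v (snd z)\<bar> powr p) * gk s p z"
      by (intro mult_right_mono *[OF d]) auto
    then show "ennreal (\<bar>\<phi> (fst z) - \<phi> (snd z)\<bar> powr p * gk s p z) \<le> ennreal ?c * ennreal (\<bar>u (fst z) - u (snd z)\<bar> powr p * gk s p z)
      + ennreal ?c * ennreal (\<bar>v (fst z) - v (snd z)\<bar> powr p * gk s p z)"
      by (simp add: algebra_simps flip: ennreal_mult ennreal_plus)
  qed
  also have "\<dots> = ennreal ?c * gagliardo s p u + ennreal ?c * gagliardo s p v"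
    unfolding gagliardo_eq by (subst nn_integral_add) (simp_all add: nn_integral_cmult)
  also have "\<dots> < \<infinity>" using W0_D[OF u] W0_D[OF v] by (simp add: ennreal_mult_less_top)
  finally have 2: "gagliardo s p \<phi> < \<infinity>" .
  show ?thesis using 1 2 z unfolding W0_def by auto
qed

section \<open>Affine changes of variables\<close>

lemma nn_integral_affine:
  fixes t :: "'a::euclidean_space" and g :: "'a \<Rightarrow> ennreal"
  assumes "c > 0" "g \<in> borel_measurable borel"
  shows "(\<integral>\<^sup>+x. g x \<partial>lborel) = ennreal (c ^ DIM('a)) * (\<integral>\<^sup>+x. g (t + c *\<^sub>R x) \<partial>lborel)"
proof -
  note [measurable] = assms(2)
  have "(\<integral>\<^sup>+x. g x \<partial>lborel) = (\<integral>\<^sup>+x. g x \<partial>(density (distr lborel borel (\<lambda>x. t + c *\<^sub>R x)) (\<lambda>_. ennreal (\<bar>c\<bar> ^ DIM('a)))))"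
    using lborel_affine[of c t] assms by simp
  also have "\<dots> = ennreal (c ^ DIM('a)) * (\<integral>\<^sup>+x. g (t + c *\<^sub>R x) \<partial>lborel)"
    using assms by (simp add: nn_integral_density nn_integral_distr nn_integral_cmult)
  finally show ?thesis .
qed

lemma integral_affine:
  fixes t :: "'a::euclidean_space" and g :: "'a \<Rightarrow> real"
  assumes "c > 0" "integrable lborel g"
  shows "integrable lborel (\<lambda>x. g (t + c *\<^sub>R x))"
    and "(\<integral>x. g x \<partial>lborel) = c ^ DIM('a) * (\<integral>x. g (t + c *\<^sub>R x) \<partial>lborel)"
proof -
  have [measurable]: "g \<in> borel_measurable borel" using assms by auto
  let ?M = "density (distr lborel borel (\<lambda>x. t + c *\<^sub>R x)) (\<lambda>_. ennreal (\<bar>c\<bar> ^ DIM('a)))"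
  have L: "lborel = ?M" using lborel_affine[of c t] assms by simp
  have "integrable ?M g" using assms L by metis
  then have "integrable lborel (\<lambda>x. c ^ DIM('a) * g (t + c *\<^sub>R x))"
    using assms by (simp add: integrable_density integrable_distr_eq)
  then show "integrable lborel (\<lambda>x. g (t + c *\<^sub>R x))" using assms by simp
  have "(\<integral>x. g x \<partial>lborel) = (\<integral>x. g x \<partial>?M)" using L by metis
  also have "\<dots> = (\<integral>x. c ^ DIM('a) * g (t + c *\<^sub>R x) \<partial>lborel)"
    using assms by (simp add: integral_density integral_distr)
  finally show "(\<integral>x. g x \<partial>lborel) = c ^ DIM('a) * (\<integral>x. g (t + c *\<^sub>R x) \<partial>lborel)" by simp
qed

lemma gk_affine:
  fixes t x y :: "'a::euclidean_space"
  assumes "c > 0"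
  shows "gk s p (t + c *\<^sub>R x, t + c *\<^sub>R y) = c powr - (real DIM('a) + s * p) * gk s p (x, y)"
proof -
  have 1: "norm (t + c *\<^sub>R x - (t + c *\<^sub>R y)) = c * norm (x - y)"
    using assms by (simp add: scaleR_diff_right[symmetric] del: scaleR_diff_right)
  show ?thesis unfolding gk_def fst_conv snd_conv 1 using assms by (simp only: powr_mult powr_minus) (simp add: field_simps)
qed

lemma W0_affine:
  fixes f :: "'a::euclidean_space \<Rightarrow> real"
  assumes f: "f \<in> W0 s p \<omega>" and c: "c > 0" and z: "AE x in lborel. x \<notin> \<omega>' \<longrightarrow> f (t + c *\<^sub>R x) = 0"
  shows "(\<lambda>x. f (t + c *\<^sub>R x)) \<in> W0 s p \<omega>'"
proof -
  have [measurable]: "f \<in> borel_measurable borel" using W0_D[OF f] by simp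
  have "ennreal (c ^ DIM('a)) * Lp_norm_pow p (\<lambda>x. f (t + c *\<^sub>R x)) = Lp_norm_pow p f"
    unfolding Lp_norm_pow_def by (rule nn_integral_affine[OF c, symmetric]) measurable
  then have 1: "Lp_norm_pow p (\<lambda>x. f (t + c *\<^sub>R x)) < \<infinity>"
    using W0_D(2)[OF f] c by (auto simp: ennreal_mult_less_top less_top[symmetric] ennreal_mult_eq_top_iff)
  let ?h = "\<lambda>z. ennreal (\<bar>f (fst z) - f (snd z)\<bar> powr p * gk s p z)"
  let ?k = "c powr - (real DIM('a) + s * p)"
  have "gagliardo s p f = (\<integral>\<^sup>+z. ?h z \<partial>lborel)" by (simp add: gagliardo_eq lborel_prod)
  \<comment> \<open>The same map acts on both variables, so on the product space it is an affine map
    of factor \<open>c\<close> in twice the dimension.\<close>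
  also have "\<dots> = ennreal (c ^ DIM('a \<times> 'a)) * (\<integral>\<^sup>+z. ?h ((t, t) + c *\<^sub>R z) \<partial>lborel)"
  proof (rule nn_integral_affine[OF c])
    have "?h \<in> borel_measurable (lborel \<Otimes>\<^sub>M lborel)" by measurable
    then show "?h \<in> borel_measurable borel" by (simp add: lborel_prod)
  qed
  also have "(\<integral>\<^sup>+z. ?h ((t, t) + c *\<^sub>R z) \<partial>lborel)
      = (\<integral>\<^sup>+z. ennreal ?k * ennreal (\<bar>f (t + c *\<^sub>R fst z) - f (t + c *\<^sub>R snd z)\<bar> powr p * gk s p z) \<partial>(lborel \<Otimes>\<^sub>M lborel))"
    unfolding lborel_prod
  proof (intro nn_integral_cong)
    fix z :: "'a \<times> 'a"
    have "gk s p ((t, t) + c *\<^sub>R z) = ?k * gk s p z"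
      using gk_affine[OF c, of s p t "fst z" "snd z"] by (cases z) simp
    then show "?h ((t, t) + c *\<^sub>R z) = ennreal ?k * ennreal (\<bar>f (t + c *\<^sub>R fst z) - f (t + c *\<^sub>R snd z)\<bar> powr p * gk s p z)"
      by (simp add: mult_ac flip: ennreal_mult)
  qed
  also have "\<dots> = ennreal ?k * gagliardo s p (\<lambda>x. f (t + c *\<^sub>R x))"
    unfolding gagliardo_eq by (rule nn_integral_cmult) measurable
  finally have "gagliardo s p f = ennreal (c ^ DIM('a \<times> 'a)) * (ennreal ?k * gagliardo s p (\<lambda>x. f (t + c *\<^sub>R x)))" .
  then have 2: "gagliardo s p (\<lambda>x. f (t + c *\<^sub>R x)) < \<infinity>"
    using W0_D(3)[OF f] c by (auto simp: less_top[symmetric] ennreal_mult_eq_top_iff)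
  show ?thesis using 1 2 z unfolding W0_def by simp
qed

text \<open>The Jacobian on the product space contributes \<open>c\<close> to the power
  \<open>2 * DIM('a)\<close>, the kernel the power \<open>- (DIM('a) + s * p)\<close>; solving for
  the rescaled pairing leaves \<open>s * p - DIM('a)\<close>.\<close>

lemma frac_pLap_pair_affine:
  fixes f g :: "'a::euclidean_space \<Rightarrow> real"
  assumes "integrable (lborel \<Otimes>\<^sub>M lborel) (frac_pLap_integrand s p f g)" and c: "c > 0"
  shows "integrable (lborel \<Otimes>\<^sub>M lborel) (frac_pLap_integrand s p (\<lambda>x. f (t + c *\<^sub>R x)) (\<lambda>x. g (t + c *\<^sub>R x)))"
    and "frac_pLap_pair s p (\<lambda>x. f (t + c *\<^sub>R x)) (\<lambda>x. g (t + c *\<^sub>R x))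
      = c powr (s * p - real DIM('a)) * frac_pLap_pair s p f g"
proof -
  let ?k = "c powr - (real DIM('a) + s * p)"
  let ?F = "frac_pLap_integrand s p f g"
  let ?G = "frac_pLap_integrand s p (\<lambda>x. f (t + c *\<^sub>R x)) (\<lambda>x. g (t + c *\<^sub>R x))"
  have I: "integrable lborel ?F" using assms by (simp add: lborel_prod)
  have eq: "?F ((t, t) + c *\<^sub>R z) = ?k * ?G z" for z
    using gk_affine[OF c, of s p t "fst z" "snd z"] by (cases z) (simp add: frac_pLap_integrand_eq)
  show "integrable (lborel \<Otimes>\<^sub>M lborel) ?G"
    using integral_affine(1)[OF c I, of "(t, t)"] c unfolding eq by (simp add: lborel_prod)
  have "frac_pLap_pair s p f g = c ^ DIM('a \<times> 'a) * (?k * (\<integral>z. ?G z \<partial>lborel))"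
    using integral_affine(2)[OF c I, of "(t, t)"] unfolding eq by (simp add: lborel_prod frac_pLap_pair_def)
  also have "\<dots> = c powr (real DIM('a) - s * p) * frac_pLap_pair s p (\<lambda>x. f (t + c *\<^sub>R x)) (\<lambda>x. g (t + c *\<^sub>R x))"
    using c by (simp add: frac_pLap_pair_def lborel_prod powr_realpow[symmetric] powr_add[symmetric])
  finally show "frac_pLap_pair s p (\<lambda>x. f (t + c *\<^sub>R x)) (\<lambda>x. g (t + c *\<^sub>R x))
      = c powr (s * p - real DIM('a)) * frac_pLap_pair s p f g"
    using c by (simp add: mult.assoc[symmetric] powr_add[symmetric])
qed

section \<open>Integrability, positivity, and passage from almost everywhere to everywhere\<close>

lemma integrable_bounded_support:
  fixes f :: "'a::euclidean_space \<Rightarrow> real"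
  assumes [measurable]: "f \<in> borel_measurable lborel" and "\<And>x. \<bar>f x\<bar> \<le> C" "\<And>x. x \<notin> S \<Longrightarrow> f x = 0" "bounded S"
  shows "integrable lborel f"
proof -
  obtain R where "\<forall>x\<in>S. norm x \<le> R" using \<open>bounded S\<close> bounded_iff by metis
  then have R: "S \<subseteq> cball 0 R" by auto
  have "integrable lborel (\<lambda>x. C * indicator (cball 0 R) x :: real)"
    by (intro integrable_mult_right integrable_real_indicator emeasure_lborel_cball_finite) auto
  then show ?thesis
  proof (rule Bochner_Integration.integrable_bound)
    have "\<bar>f x\<bar> \<le> \<bar>C * indicator (cball 0 R) x\<bar>" for x
      using assms(2)[of x] assms(3)[of x] R by (cases "x \<in> S") (auto simp: indicator_def)
    then show "AE x in lborel. norm (f x) \<le> norm (C * indicator (cball 0 R) x :: real)" by simp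
  qed measurable
qed

lemma integral_pos_continuous:
  fixes f :: "'a::euclidean_space \<Rightarrow> real"
  assumes "continuous_on UNIV f" "\<And>x. 0 \<le> f x" "integrable lborel f" "0 < f x0"
  shows "0 < (\<integral>x. f x \<partial>lborel)"
proof -
  have [measurable]: "f \<in> borel_measurable lborel" using assms(3) by auto
  have "open {x. f x > 0}" using assms(1) by (simp add: open_Collect_less continuous_on_const)
  then have "\<not> negligible {x. f x > 0}" using assms(4) by (intro open_not_negligible) auto
  then have "{x. f x > 0} \<notin> null_sets lborel"
    using null_sets_completionI[of _ lborel] by (auto simp: negligible_iff_null_sets)
  then have "\<not> (AE x in lborel. f x = 0)"
    using assms(2) by (subst (asm) AE_iff_null_sets) (auto simp: less_le)
  moreover have "0 \<le> (\<integral>x. f x \<partial>lborel)" using assms(2) by (intro integral_nonneg_AE) auto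
  ultimately show ?thesis using integral_nonneg_eq_0_iff_AE[OF assms(3)] assms(2) by (simp add: less_le)
qed

text \<open>The exceptional points form an open null set, which must be empty. Almost everywhere
  statements about a continuous solution thus become pointwise ones.\<close>

lemma AE_open_imp_closed:
  fixes U :: "'a::euclidean_space set"
  assumes "open U" "closed {x. P x}" "AE x in lborel. x \<in> U \<longrightarrow> P x"
  shows "\<forall>x\<in>U. P x"
proof (rule ccontr)
  assume "\<not> (\<forall>x\<in>U. P x)"
  moreover have *: "open (U - {x. P x})" using assms by (intro open_Diff)
  ultimately have "\<not> negligible (U - {x. P x})" by (intro open_not_negligible) auto
  moreover have "U - {x. P x} \<in> sets lborel" using * by simp
  then have "U - {x. P x} \<in> null_sets lborel"
    using assms(3) by (subst AE_iff_null_sets) (auto elim!: eventually_mono)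
  ultimately show False
    using null_sets_completionI[of _ lborel] by (auto simp: negligible_iff_null_sets)
qed

section \<open>The Rayleigh quotient and \<open>lambda1\<close>\<close>

lemma lambda1_mult_le:
  assumes "v \<in> W0 s p \<omega>" "0 < enn2real (Lp_norm_pow p v)"
  shows "lambda1 s p \<omega> * enn2real (Lp_norm_pow p v) \<le> enn2real (gagliardo s p v)"
proof -
  have "bdd_below {enn2real (gagliardo s p v) / enn2real (Lp_norm_pow p v) | v. v \<in> W0 s p \<omega> \<and> Lp_norm_pow p v \<noteq> 0}"
    by (rule bdd_belowI[of _ 0]) auto
  moreover have "Lp_norm_pow p v \<noteq> 0" using assms(2) by auto
  ultimately have "lambda1 s p \<omega> \<le> enn2real (gagliardo s p v) / enn2real (Lp_norm_pow p v)"
    unfolding lambda1_def using assms(1) by (intro cInf_lower) auto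
  then show ?thesis using assms(2) by (simp add: field_simps)
qed

lemma lambda1_nonneg:
  assumes "v \<in> W0 s p \<omega>" "Lp_norm_pow p v \<noteq> 0"
  shows "0 \<le> lambda1 s p \<omega>"
  unfolding lambda1_def using assms by (intro cInf_greatest) auto

text \<open>Positivity of \<open>a\<close> rules out that the right side is a negative number
  truncated to 0.\<close>

lemma le_of_ennreal_le: "ennreal a \<le> ennreal b \<Longrightarrow> 0 < a \<Longrightarrow> a \<le> b"
  by (cases "0 \<le> b") (auto simp: ennreal_neg)

lemma AE_lborel_pair:
  assumes "AE x in lborel. P (x::'a::euclidean_space)"
  shows "AE z in lborel \<Otimes>\<^sub>M lborel. P (fst z) \<and> P (snd z)"
proof -
  obtain N where N: "N \<in> null_sets lborel" "{x. \<not> P x} \<subseteq> N"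
    using assms by (auto simp: eventually_ae_filter)
  have "N \<times> UNIV \<in> null_sets (lborel \<Otimes>\<^sub>M (lborel :: 'a measure))" "UNIV \<times> N \<in> null_sets ((lborel :: 'a measure) \<Otimes>\<^sub>M lborel)"
    using N(1) by (auto simp: null_sets_def lborel.emeasure_pair_measure_Times)
  then have "N \<times> UNIV \<union> UNIV \<times> N \<in> null_sets ((lborel :: 'a measure) \<Otimes>\<^sub>M lborel)" by (rule null_sets.Un)
  then show ?thesis by (rule AE_I') (use N(2) in auto)
qed

text \<open>A lower bound for the infimum need only be checked on bounded nonnegative functions
  vanishing at every point off \<open>U\<close>, the class for which the Picone quotient is
  admissible. Truncation does not increase the Gagliardo energy, and Fatou's lemma recovers the norm
  of \<open>v\<close>. The hypothesis \<open>ne\<close> keeps the infimum from being taken over the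
  empty set.\<close>

lemma lambda1_ge:
  fixes U :: "'a::euclidean_space set"
  assumes U: "U \<in> sets lborel" and p: "1 < p" and c: "0 \<le> c"
    and ne: "\<exists>v\<in>W0 s p U. Lp_norm_pow p v \<noteq> 0"
    and le: "\<And>w N. \<lbrakk>w \<in> W0 s p U; \<And>x. 0 \<le> w x; \<And>x. w x \<le> N; \<And>x. x \<notin> U \<Longrightarrow> w x = 0\<rbrakk>
        \<Longrightarrow> ennreal c * Lp_norm_pow p w \<le> gagliardo s p w"
  shows "c \<le> lambda1 s p U"
proof -
  have "c \<le> enn2real (gagliardo s p v) / enn2real (Lp_norm_pow p v)"
    if v: "v \<in> W0 s p U" "Lp_norm_pow p v \<noteq> 0" for v :: "'a \<Rightarrow> real"
  proof -
    note [measurable] = W0_D(1)[OF v(1)] U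
    \<comment> \<open>Truncation at height \<open>n\<close>; the indicator also corrects
      \<open>v\<close> on the null set where it may be nonzero off \<open>U\<close>.\<close>
    define w where "w n x = indicator U x * min \<bar>v x\<bar> (real n)" for n x
    have w_meas [measurable]: "w n \<in> borel_measurable lborel" for n unfolding w_def by measurable
    have w0: "0 \<le> w n x" and wv: "\<bar>w n x\<bar> \<le> \<bar>v x\<bar>" for n x by (auto simp: w_def indicator_def)
    have Lp_w: "Lp_norm_pow p (w n) \<le> Lp_norm_pow p v" for n
      unfolding Lp_norm_pow_def using wv p by (intro nn_integral_mono ennreal_leI powr_mono2) auto
    have gag_w: "gagliardo s p (w n) \<le> gagliardo s p v" for n
      unfolding gagliardo_eq
    proof (rule nn_integral_mono_AE)
      show "AE z in lborel \<Otimes>\<^sub>M lborel. ennreal (\<bar>w n (fst z) - w n (snd z)\<bar> powr p * gk s p z)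
          \<le> ennreal (\<bar>v (fst z) - v (snd z)\<bar> powr p * gk s p z)"
        using AE_lborel_pair[OF W0_D(4)[OF v(1)]]
      proof eventually_elim
        fix z assume z: "(fst z \<notin> U \<longrightarrow> v (fst z) = 0) \<and> (snd z \<notin> U \<longrightarrow> v (snd z) = 0)"
        have *: "w n x = min \<bar>v x\<bar> (real n)" if "x \<notin> U \<longrightarrow> v x = 0" for x
          using that by (auto simp: w_def indicator_def)
        have "\<bar>w n (fst z) - w n (snd z)\<bar> \<le> \<bar>v (fst z) - v (snd z)\<bar>"
          unfolding *[OF conjunct1[OF z]] *[OF conjunct2[OF z]] by linarith
        then show "ennreal (\<bar>w n (fst z) - w n (snd z)\<bar> powr p * gk s p z)
          \<le> ennreal (\<bar>v (fst z) - v (snd z)\<bar> powr p * gk s p z)"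
          using p by (intro ennreal_leI mult_right_mono powr_mono2) auto
      qed
    qed
    have w_W0: "w n \<in> W0 s p U" for n
      unfolding W0_def using Lp_w[of n] gag_w[of n] W0_D(2,3)[OF v(1)] by (auto simp: w_def)
    have cw: "ennreal c * Lp_norm_pow p (w n) \<le> gagliardo s p v" for n
    proof (rule order_trans[OF le[OF w_W0 w0, of n "real n"] gag_w])
      show "w n x \<le> real n" for x by (simp add: w_def indicator_def)
      show "w n x = 0" if "x \<notin> U" for x using that by (simp add: w_def)
    qed
    have "ennreal c * Lp_norm_pow p v = (\<integral>\<^sup>+x. ennreal (c * \<bar>v x\<bar> powr p) \<partial>lborel)"
      unfolding Lp_norm_pow_def using c by (simp add: ennreal_mult nn_integral_cmult)
    also have "\<dots> \<le> (\<integral>\<^sup>+x. liminf (\<lambda>n. ennreal (c * \<bar>w n x\<bar> powr p)) \<partial>lborel)"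
    proof (rule nn_integral_mono_AE)
      show "AE x in lborel. ennreal (c * \<bar>v x\<bar> powr p) \<le> liminf (\<lambda>n. ennreal (c * \<bar>w n x\<bar> powr p))"
        using W0_D(4)[OF v(1)]
      proof eventually_elim
        fix x assume x: "x \<notin> U \<longrightarrow> v x = 0"
        have "\<forall>\<^sub>F n in sequentially. \<bar>v x\<bar> \<le> real n"
          using eventually_ge_at_top[of "nat \<lceil>\<bar>v x\<bar>\<rceil>"] by eventually_elim linarith
        \<comment> \<open>Once \<open>n\<close> exceeds the value of \<open>v\<close> at
          \<open>x\<close>, the truncation no longer acts there.\<close>
        then have "\<forall>\<^sub>F n in sequentially. ennreal (c * \<bar>v x\<bar> powr p) \<le> ennreal (c * \<bar>w n x\<bar> powr p)"
          by eventually_elim (use x in \<open>auto simp: w_def indicator_def\<close>)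
        then show "ennreal (c * \<bar>v x\<bar> powr p) \<le> liminf (\<lambda>n. ennreal (c * \<bar>w n x\<bar> powr p))"
          by (rule Liminf_bounded)
      qed
    qed
    also have "\<dots> \<le> liminf (\<lambda>n. \<integral>\<^sup>+x. ennreal (c * \<bar>w n x\<bar> powr p) \<partial>lborel)"
      by (rule nn_integral_liminf) measurable
    also have "\<dots> = liminf (\<lambda>n. ennreal c * Lp_norm_pow p (w n))"
      unfolding Lp_norm_pow_def using c by (simp add: ennreal_mult nn_integral_cmult)
    also have "\<dots> \<le> gagliardo s p v"
      by (rule Liminf_le) (simp_all add: cw)
    finally have le_v: "ennreal c * Lp_norm_pow p v \<le> gagliardo s p v" .
    obtain G where G: "gagliardo s p v = ennreal G" "0 \<le> G" using W0_D(3)[OF v(1)] by (cases "gagliardo s p v") auto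
    obtain L where L: "Lp_norm_pow p v = ennreal L" "0 \<le> L" using W0_D(2)[OF v(1)] by (cases "Lp_norm_pow p v") auto
    have "0 < L" using L v(2) by (cases "L = 0") auto
    moreover have "c * L \<le> G" using le_v c G L by (simp flip: ennreal_mult)
    ultimately show ?thesis using G L by (simp add: field_simps)
  qed
  then show ?thesis
    unfolding lambda1_def using ne by (intro cInf_greatest) auto
qed

section \<open>Estimates for weak solutions\<close>

locale logistic_problem =
  fixes \<Omega> :: "'a::euclidean_space set" and s p q r :: real and b :: "'a \<Rightarrow> real" and B :: real
  assumes open_\<Omega>: "open \<Omega>" and bounded_\<Omega>: "bounded \<Omega>" and nonempty_\<Omega>: "\<Omega> \<noteq> {}"
    and s_pos: "0 < s" and p_gt_1: "1 < p" and q_pos: "0 < q" and q_le: "q \<le> p - 1" and r_gt: "p - 1 < r"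
    and b_measurable [measurable]: "b \<in> borel_measurable lborel"
    and b_nonneg: "\<And>x. x \<in> \<Omega> \<Longrightarrow> 0 \<le> b x"
    and b_le: "AE x in lborel. x \<in> \<Omega> \<longrightarrow> b x \<le> B"
    and B_nonneg: "0 \<le> B"
begin

text \<open>Continuity is the known regularity of solutions. It makes the maximum attained and turns
  almost everywhere sign information into pointwise information.\<close>

definition sol :: "real \<Rightarrow> ('a \<Rightarrow> real) \<Rightarrow> bool" where
  "sol lam u \<longleftrightarrow> weak_solution s p q r b \<Omega> lam u \<and> continuous_on UNIV u"

text \<open>The added 1 makes positivity immediate, as the number is used in denominators.\<close>

definition diam :: real where
  "diam = diameter (closure \<Omega>) + 1"

lemma r_pos: "0 < r" and sp_pos: "0 < s * p"
  using p_gt_1 r_gt s_pos by auto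

lemma measurable_\<Omega> [measurable]: "\<Omega> \<in> sets lborel" "\<Omega> \<in> sets borel"
  using open_\<Omega> by auto

lemma compact_closure_\<Omega>: "compact (closure \<Omega>)"
  using bounded_\<Omega> by simp

lemma diam_pos: "0 < diam"
  using diameter_ge_0[of "closure \<Omega>"] bounded_\<Omega> by (simp add: diam_def bounded_closure)

lemma norm_diff_le_diam: "x \<in> closure \<Omega> \<Longrightarrow> y \<in> closure \<Omega> \<Longrightarrow> norm (x - y) \<le> diam"
  using diameter_bounded_bound[of "closure \<Omega>" x y] bounded_\<Omega> by (simp add: diam_def bounded_closure dist_norm)

section \<open>Pointwise properties of solutions\<close>

lemma sol_continuous: "sol lam u \<Longrightarrow> continuous_on UNIV u"
  and sol_W0: "sol lam u \<Longrightarrow> u \<in> W0 s p \<Omega>"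
  and sol_AE_pos: "sol lam u \<Longrightarrow> AE x in lborel. x \<in> \<Omega> \<longrightarrow> 0 < u x"
  by (auto simp: sol_def weak_solution_def)

lemma sol_measurable: "sol lam u \<Longrightarrow> u \<in> borel_measurable borel"
  using sol_continuous borel_measurable_continuous_onI by blast

lemma sol_test:
  assumes "sol lam u" "\<phi> \<in> W0 s p \<Omega>"
  shows "integrable (lborel \<Otimes>\<^sub>M lborel) (frac_pLap_integrand s p u \<phi>)"
    and "integrable lborel (\<lambda>x. indicator \<Omega> x * ((lam * u x powr q - b x * u x powr r) * \<phi> x))"
    and "frac_pLap_pair s p u \<phi> = (\<integral>x. indicator \<Omega> x * ((lam * u x powr q - b x * u x powr r) * \<phi> x) \<partial>lborel)"
  using assms by (auto simp: sol_def weak_solution_def set_integrable_def set_lebesgue_integral_def)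

text \<open>Continuity upgrades the almost everywhere statement only on the open complement of the
  closure, so the frontier is left out.\<close>

lemma sol_eq_0:
  assumes "sol lam u" "x \<notin> closure \<Omega>" shows "u x = 0"
proof -
  have "AE x in lborel. x \<notin> \<Omega> \<longrightarrow> u x = 0" using W0_D(4)[OF sol_W0[OF assms(1)]] .
  then have "AE x in lborel. x \<in> - closure \<Omega> \<longrightarrow> u x = 0"
    by eventually_elim (use closure_subset in auto)
  then have "\<forall>x\<in>- closure \<Omega>. u x = 0"
    using sol_continuous[OF assms(1)]
    by (intro AE_open_imp_closed) (auto intro!: closed_Collect_eq continuous_on_const)
  then show ?thesis using assms by auto
qed

lemma sol_nonneg:
  assumes "sol lam u" shows "0 \<le> u x"
proof -
  have "AE x in lborel. x \<notin> \<Omega> \<longrightarrow> u x = 0" using W0_D(4)[OF sol_W0[OF assms(1)]] .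
  with sol_AE_pos[OF assms] have "AE x in lborel. x \<in> UNIV \<longrightarrow> 0 \<le> u x"
    by eventually_elim force
  then have "\<forall>x\<in>UNIV. 0 \<le> u x"
    using sol_continuous[OF assms(1)]
    by (intro AE_open_imp_closed) (auto intro!: closed_Collect_le continuous_on_const)
  then show ?thesis by auto
qed

lemma sol_attains_max:
  assumes "sol lam u"
  obtains x1 where "x1 \<in> closure \<Omega>" "0 < u x1" "\<And>y. u y \<le> u x1"
proof -
  obtain x1 where x1: "x1 \<in> closure \<Omega>" "\<forall>y\<in>closure \<Omega>. u y \<le> u x1"
    using continuous_attains_sup[OF compact_closure_\<Omega>] nonempty_\<Omega> sol_continuous[OF assms] continuous_on_subset
    by (metis closure_eq_empty subset_UNIV)
  have "0 < u x1"
  proof (rule ccontr)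
    assume "\<not> 0 < u x1"
    then have "u x \<le> 0" if "x \<in> \<Omega>" for x using x1 that closure_subset[of \<Omega>] by force
    with sol_AE_pos[OF assms] have "AE x in lborel. x \<in> \<Omega> \<longrightarrow> False" by (auto elim!: eventually_mono simp: not_less[symmetric])
    then have "\<forall>x\<in>\<Omega>. False" using open_\<Omega> by (intro AE_open_imp_closed) auto
    then show False using nonempty_\<Omega> by auto
  qed
  moreover have "u y \<le> u x1" for y
    using x1 sol_eq_0[OF assms, of y] \<open>0 < u x1\<close> by (cases "y \<in> closure \<Omega>") auto
  ultimately show ?thesis using that x1 by blast
qed

section \<open>One-sided bounds for the energy pairing\<close>

text \<open>The absorption term has a favourable sign and is dropped.\<close>

lemma sol_pair_le:
  assumes u: "sol lam u" "0 \<le> lam" and \<phi>: "\<phi> \<in> W0 s p \<Omega>" "integrable lborel \<phi>" "\<And>x. 0 \<le> \<phi> x"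
    and N: "\<And>x. u x \<le> N"
  shows "frac_pLap_pair s p u \<phi> \<le> lam * N powr q * (\<integral>x. \<phi> x \<partial>lborel)"
proof -
  have "(\<integral>x. indicator \<Omega> x * ((lam * u x powr q - b x * u x powr r) * \<phi> x) \<partial>lborel)
      \<le> (\<integral>x. lam * N powr q * \<phi> x \<partial>lborel)"
  proof (rule integral_mono[OF sol_test(2)[OF u(1) \<phi>(1)]])
    fix x
    have "lam * u x powr q - b x * u x powr r \<le> lam * N powr q" if "x \<in> \<Omega>"
      using mult_left_mono[OF powr_mono2[of q "u x" N]] u sol_nonneg[OF u(1)] N q_pos b_nonneg[OF that]
      by (smt (verit) mult_nonneg_nonneg powr_ge_zero)
    then have "(lam * u x powr q - b x * u x powr r) * \<phi> x \<le> lam * N powr q * \<phi> x" if "x \<in> \<Omega>"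
      using that \<phi>(3) by (intro mult_right_mono) auto
    then show "indicator \<Omega> x * ((lam * u x powr q - b x * u x powr r) * \<phi> x) \<le> lam * N powr q * \<phi> x"
      using u \<phi>(3)[of x] by (auto simp: indicator_def)
  qed (use \<phi> in simp)
  then show ?thesis using \<phi> unfolding sol_test(3)[OF u(1) \<phi>(1)] by simp
qed

text \<open>Counterpart of the upper bound: the source term is dropped, and the absorption has to be
  controlled only where \<open>\<phi>\<close> is positive.\<close>

lemma sol_pair_ge:
  assumes u: "sol lam u" "0 \<le> lam" and \<phi>: "\<phi> \<in> W0 s p \<Omega>" "integrable lborel \<phi>" "\<And>x. 0 \<le> \<phi> x"
    and N: "\<And>x. 0 < \<phi> x \<Longrightarrow> u x \<le> N"
  shows "- (B * N powr r) * (\<integral>x. \<phi> x \<partial>lborel) \<le> frac_pLap_pair s p u \<phi>"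
proof -
  have "(\<integral>x. - (B * N powr r) * \<phi> x \<partial>lborel)
      \<le> (\<integral>x. indicator \<Omega> x * ((lam * u x powr q - b x * u x powr r) * \<phi> x) \<partial>lborel)"
  proof (rule integral_mono_AE[OF _ sol_test(2)[OF u(1) \<phi>(1)]])
    show "AE x in lborel. - (B * N powr r) * \<phi> x \<le> indicator \<Omega> x * ((lam * u x powr q - b x * u x powr r) * \<phi> x)"
      using b_le
    proof eventually_elim
      fix x assume bx: "x \<in> \<Omega> \<longrightarrow> b x \<le> B"
      show "- (B * N powr r) * \<phi> x \<le> indicator \<Omega> x * ((lam * u x powr q - b x * u x powr r) * \<phi> x)"
      proof (cases "x \<in> \<Omega> \<and> 0 < \<phi> x")
        case True
        then have "b x * u x powr r \<le> B * N powr r"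
          using bx b_nonneg[of x] N[of x] sol_nonneg[OF u(1)] r_pos by (intro mult_mono powr_mono2) auto
        moreover have "0 \<le> lam * u x powr q" using u by simp
        ultimately have "- (B * N powr r) * \<phi> x \<le> (lam * u x powr q - b x * u x powr r) * \<phi> x"
          using True by (intro mult_right_mono) auto
        then show ?thesis using True by simp
      next
        case False
        then have "x \<notin> \<Omega> \<or> \<phi> x = 0" using \<phi>(3)[of x] by auto
        then show ?thesis using \<phi>(3)[of x] B_nonneg by auto
      qed
    qed
  qed (use \<phi> in simp)
  then show ?thesis using \<phi> unfolding sol_test(3)[OF u(1) \<phi>(1)] by simp
qed

section \<open>The sup estimate\<close>

text \<open>With \<open>M\<close> the maximum, a point \<open>x\<close> where
  \<open>u x > 3 * M / 4\<close> and a point \<open>y\<close> within distance \<open>\<rho>\<close>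
  where \<open>u y \<le> M / 2\<close> differ in value by more than \<open>M / 4\<close>, and the
  kernel is at least \<open>1 / \<rho> powr (DIM('a) + s * p)\<close>. Such \<open>y\<close> fill at
  least half of the ball about \<open>x\<close>. The resulting lower bound for the pairing is set
  against its upper bound, and the integral of the test function cancels.\<close>

lemma sup_estimate:
  assumes u: "sol lam u" "0 \<le> lam" and M: "0 < u x1" "\<And>y. u y \<le> u x1" and \<rho>: "0 < \<rho>"
    and small: "emeasure lborel {y. u x1 / 2 < u y} \<le> ennreal (measure lborel (ball (0::'a) \<rho>) / 2)"
  shows "(u x1 / 4) powr (p - 1) / \<rho> powr (real DIM('a) + s * p) * (measure lborel (ball (0::'a) \<rho>) / 2)
           \<le> lam * u x1 powr q"
proof -
  define M where "M = u x1"
  have M0: "0 < M" and uM: "\<And>y. u y \<le> M" using M by (auto simp: M_def)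
  note [measurable] = sol_measurable[OF u(1)]
  define \<phi> where "\<phi> x = max 0 (u x - 3 * M / 4)" for x
  have \<phi>_meas [measurable]: "\<phi> \<in> borel_measurable borel" unfolding \<phi>_def by measurable
  have \<phi>0: "0 \<le> \<phi> x" for x by (simp add: \<phi>_def)
  have \<phi>_cont: "continuous_on UNIV \<phi>" unfolding \<phi>_def using sol_continuous[OF u(1)] by (intro continuous_intros)
  have \<phi>_W0: "\<phi> \<in> W0 s p \<Omega>"
  proof (rule W0_dominated[OF sol_W0[OF u(1)] sol_W0[OF u(1)] p_gt_1, of 1])
    show "AE x in lborel. x \<notin> \<Omega> \<longrightarrow> \<phi> x = 0"
      using W0_D(4)[OF sol_W0[OF u(1)]] by eventually_elim (use M0 in \<open>auto simp: \<phi>_def\<close>)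
    show "\<bar>\<phi> x\<bar> \<le> 1 * (\<bar>u x\<bar> + \<bar>u x\<bar>)" for x
      using sol_nonneg[OF u(1), of x] M0 by (auto simp: \<phi>_def)
    show "\<bar>\<phi> x - \<phi> y\<bar> \<le> 1 * (\<bar>u x - u y\<bar> + \<bar>u x - u y\<bar>)" for x y
      unfolding \<phi>_def max_def by (simp split: if_splits) linarith?
  qed auto
  have \<phi>_int: "integrable lborel \<phi>"
  proof (rule integrable_bounded_support)
    show "\<bar>\<phi> x\<bar> \<le> M" for x using uM[of x] M0 by (auto simp: \<phi>_def)
    show "\<phi> x = 0" if "x \<notin> closure \<Omega>" for x using sol_eq_0[OF u(1) that] M0 by (auto simp: \<phi>_def)
  qed (use bounded_\<Omega> in \<open>auto simp: bounded_closure\<close>)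
  have \<phi>_pos: "0 < (\<integral>x. \<phi> x \<partial>lborel)"
    by (rule integral_pos_continuous[OF \<phi>_cont \<phi>0 \<phi>_int, of x1]) (use M0 in \<open>auto simp: \<phi>_def M_def\<close>)
  let ?c = "(M / 4) powr (p - 1) / \<rho> powr (real DIM('a) + s * p)"
  let ?m = "measure lborel (ball (0::'a) \<rho>) / 2"
  let ?A = "{z. norm (fst z - snd z) < \<rho> \<and> u (snd z) \<le> M / 2}"
  have "?m * (\<integral>x. ?c * \<phi> x \<partial>lborel) \<le> (\<integral>z. frac_pLap_integrand s p u \<phi> z \<partial>(lborel \<Otimes>\<^sub>M lborel))"
  proof (rule integral_ge_sectional[OF sol_test(1)[OF u(1) \<phi>_W0]])
    have "{z \<in> space (lborel \<Otimes>\<^sub>M lborel). norm (fst z - snd z) < \<rho> \<and> u (snd z) \<le> M / 2} \<in> sets (lborel \<Otimes>\<^sub>M lborel)"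
      by measurable
    then show "?A \<in> sets (lborel \<Otimes>\<^sub>M lborel)" by (simp add: space_pair_measure)
    show "?c * \<phi> (fst z) * indicator ?A z \<le> frac_pLap_integrand s p u \<phi> z" for z
    proof -
      obtain x y where z: "z = (x, y)" by force
      \<comment> \<open>Off the chosen set the integrand is still nonnegative, because
        \<open>\<phi>\<close> is a nondecreasing function of \<open>u\<close>.\<close>
      have nonneg: "0 \<le> jp p (u x - u y) * (\<phi> x - \<phi> y)"
      proof (cases "u y \<le> u x")
        case True then show ?thesis using jp_mono[OF p_gt_1, of 0 "u x - u y"] by (auto simp: \<phi>_def jp_def intro!: mult_nonneg_nonneg)
      next
        case False then show ?thesis using jp_mono[OF p_gt_1, of "u x - u y" 0] by (auto simp: \<phi>_def jp_def intro!: mult_nonpos_nonpos)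
      qed
      show ?thesis
      proof (cases "z \<in> ?A \<and> 0 < \<phi> x")
        case True
        then have xy: "norm (x - y) \<le> \<rho>" "u y \<le> M / 2" "3 * M / 4 < u x" by (auto simp: z \<phi>_def)
        then have "\<phi> y = 0" "x \<noteq> y" using M0 by (auto simp: \<phi>_def)
        have "jp p (M / 4) \<le> jp p (u x - u y)" using xy by (intro jp_mono p_gt_1) auto
        then have "(M / 4) powr (p - 1) \<le> jp p (u x - u y)" using M0 by (simp add: jp_nonneg_eq)
        then have "(M / 4) powr (p - 1) * \<phi> x * (1 / \<rho> powr (real DIM('a) + s * p)) \<le> jp p (u x - u y) * \<phi> x * gk s p (x, y)"
          using gk_lower[OF xy(1) _ \<open>x \<noteq> y\<close>] sp_pos \<phi>0[of x] order_trans[OF powr_ge_zero \<open>(M / 4) powr (p - 1) \<le> _\<close>]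
          by (intro mult_mono) auto
        then show ?thesis using True \<open>\<phi> y = 0\<close> by (simp add: frac_pLap_integrand_eq z)
      next
        case False
        then have "?c * \<phi> (fst z) * indicator ?A z = 0" using \<phi>0[of x] by (auto simp: z)
        moreover have "0 \<le> frac_pLap_integrand s p u \<phi> z" using nonneg by (simp add: frac_pLap_integrand_eq z)
        ultimately show ?thesis by (rule ord_eq_le_trans)
      qed
    qed
    show "ennreal ?m \<le> emeasure lborel {y. (x, y) \<in> ?A}" for x
    proof -
      let ?U = "{y. M / 2 < u y}"
      have U: "?U \<in> sets lborel" by measurable
      have fin: "emeasure lborel (ball x \<rho>) = ennreal (measure lborel (ball (0::'a) \<rho>))"
        using \<rho> by (simp add: emeasure_ball content_ball)
      \<comment> \<open>At most half of the ball is lost to \<open>?U\<close>, so the slice keeps at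
        least the other half.\<close>
      have "ennreal ?m + ennreal ?m = emeasure lborel (ball x \<rho>)"
        unfolding fin by (simp flip: ennreal_plus)
      also have "\<dots> \<le> emeasure lborel ({y. (x, y) \<in> ?A} \<union> ?U)"
        by (intro emeasure_mono) (auto simp: dist_norm)
      also have "\<dots> \<le> emeasure lborel {y. (x, y) \<in> ?A} + emeasure lborel ?U"
        by (intro emeasure_subadditive) auto
      also have "\<dots> \<le> emeasure lborel {y. (x, y) \<in> ?A} + ennreal ?m"
        using small by (intro add_left_mono) (simp add: M_def)
      finally show ?thesis using ennreal_add_left_cancel_le[of "ennreal ?m"] by (simp add: add.commute)
    qed
  qed (use \<phi>_int \<phi>0 in auto)
  also have "\<dots> = frac_pLap_pair s p u \<phi>" by (simp add: frac_pLap_pair_def)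
  also have "\<dots> \<le> lam * M powr q * (\<integral>x. \<phi> x \<partial>lborel)"
    by (rule sol_pair_le[OF u \<phi>_W0 \<phi>_int \<phi>0 uM])
  finally have "(?c * ?m) * (\<integral>x. \<phi> x \<partial>lborel) \<le> lam * M powr q * (\<integral>x. \<phi> x \<partial>lborel)"
    by (simp add: mult_ac)
  then show ?thesis using \<phi>_pos unfolding M_def by (simp only: mult_le_cancel_right_pos)
qed

section \<open>Rescaled barriers and expansion of positivity\<close>

text \<open>A rescaled copy of a solution serves as a lower barrier: its fractional p-Laplacian is bounded
  above, and its support can be placed in any small ball. This replaces an explicit smooth barrier,
  whose fractional p-Laplacian need not be bounded for small p.\<close>

lemma rescaled_pair_le:
  assumes v: "sol lam v" "0 \<le> lam" and N: "\<And>x. v x \<le> N" and c: "0 < c"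
    and \<phi>: "\<phi> \<in> W0 s p \<omega>" "integrable lborel \<phi>" "\<And>x. 0 \<le> \<phi> x" "\<And>x. \<phi> x \<le> k * v (t + c *\<^sub>R x)"
  shows "integrable (lborel \<Otimes>\<^sub>M lborel) (frac_pLap_integrand s p (\<lambda>x. v (t + c *\<^sub>R x)) \<phi>)"
    and "frac_pLap_pair s p (\<lambda>x. v (t + c *\<^sub>R x)) \<phi> \<le> lam * N powr q * c powr (s * p) * (\<integral>x. \<phi> x \<partial>lborel)"
proof -
  \<comment> \<open>The function \<open>\<phi>\<close> in the coordinates of \<open>v\<close>. Lying
    between 0 and \<open>k * v\<close>, it vanishes almost everywhere off \<open>\<Omega>\<close>
    and is admissible in the equation of \<open>v\<close>.\<close>
  define \<psi> where "\<psi> y = \<phi> (- ((1 / c) *\<^sub>R t) + (1 / c) *\<^sub>R y)" for y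
  have \<psi>_T: "\<psi> (t + c *\<^sub>R x) = \<phi> x" for x
    using c by (simp add: \<psi>_def scaleR_add_right)
  have \<psi>0: "0 \<le> \<psi> y" for y using \<phi> by (simp add: \<psi>_def)
  have \<psi>_le: "\<psi> y \<le> k * v y" for y
  proof -
    have "t + c *\<^sub>R (- ((1 / c) *\<^sub>R t) + (1 / c) *\<^sub>R y) = y" using c by (simp add: scaleR_add_right scaleR_diff_right)
    then show ?thesis using \<phi>(4)[of "- ((1 / c) *\<^sub>R t) + (1 / c) *\<^sub>R y"] by (simp add: \<psi>_def)
  qed
  have "\<psi> \<in> W0 s p \<Omega>" unfolding \<psi>_def
  proof (rule W0_affine[OF \<phi>(1)])
    show "AE y in lborel. y \<notin> \<Omega> \<longrightarrow> \<phi> (- ((1 / c) *\<^sub>R t) + (1 / c) *\<^sub>R y) = 0"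
      using W0_D(4)[OF sol_W0[OF v(1)]]
    proof eventually_elim
      fix y assume "y \<notin> \<Omega> \<longrightarrow> v y = 0"
      then show "y \<notin> \<Omega> \<longrightarrow> \<phi> (- ((1 / c) *\<^sub>R t) + (1 / c) *\<^sub>R y) = 0"
        using \<psi>_le[of y] \<psi>0[of y] by (auto simp: \<psi>_def)
    qed
  qed (use c in simp)
  moreover have \<psi>_int: "integrable lborel \<psi>"
    unfolding \<psi>_def using c \<phi>(2) by (intro integral_affine) auto
  ultimately have P: "frac_pLap_pair s p v \<psi> \<le> lam * N powr q * (\<integral>x. \<psi> x \<partial>lborel)"
    and I: "integrable (lborel \<Otimes>\<^sub>M lborel) (frac_pLap_integrand s p v \<psi>)"
    using sol_pair_le[OF v _ _ \<psi>0 N] sol_test(1)[OF v(1)] by auto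
  show "integrable (lborel \<Otimes>\<^sub>M lborel) (frac_pLap_integrand s p (\<lambda>x. v (t + c *\<^sub>R x)) \<phi>)"
    using frac_pLap_pair_affine(1)[OF I c, of t] by (simp add: \<psi>_T)
  have "frac_pLap_pair s p (\<lambda>x. v (t + c *\<^sub>R x)) \<phi> = c powr (s * p - real DIM('a)) * frac_pLap_pair s p v \<psi>"
    using frac_pLap_pair_affine(2)[OF I c, of t] by (simp add: \<psi>_T)
  also have "\<dots> \<le> c powr (s * p - real DIM('a)) * (lam * N powr q * (c ^ DIM('a) * (\<integral>x. \<phi> x \<partial>lborel)))"
    using P integral_affine(2)[OF c \<psi>_int, of t] by (intro mult_left_mono) (simp_all add: \<psi>_T)
  \<comment> \<open>The Jacobian cancels \<open>- DIM('a)\<close> in the exponent: shrinking the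
    copy by the factor \<open>c\<close> costs \<open>c powr (s * p)\<close>.\<close>
  also have "\<dots> = lam * N powr q * c powr (s * p) * (\<integral>x. \<phi> x \<partial>lborel)"
    using c by (simp add: powr_diff powr_realpow)
  finally show "frac_pLap_pair s p (\<lambda>x. v (t + c *\<^sub>R x)) \<phi> \<le> lam * N powr q * c powr (s * p) * (\<integral>x. \<phi> x \<partial>lborel)" .
qed

text \<open>Barrier argument by contradiction. The rescaled copy \<open>k * w\<close> of
  \<open>v\<close> is supported in \<open>\<Omega>\<close> and has its peak \<open>\<kappa>\<close>
  at \<open>x0\<close>. If \<open>u x0 < \<kappa>\<close>, the positive part of
  \<open>k * w - u\<close> is tested in both equations. Interaction with the set where
  \<open>u > L\<close> produces the right side of \<open>num\<close>, while the barrier's own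
  p-Laplacian and the absorption allow at most the left side.\<close>

lemma positivity_expansion:
  assumes v: "sol lam' v" "0 \<le> lam'" "0 < v x1" "\<And>y. v y \<le> v x1"
    and u: "sol lam u" "0 \<le> lam"
    and c: "0 < c" "\<And>x. t + c *\<^sub>R x \<in> closure \<Omega> \<Longrightarrow> x \<in> \<Omega>" "t + c *\<^sub>R x0 = x1"
    and \<kappa>: "0 < \<kappa>" "\<kappa> \<le> L / 4"
    and \<delta>: "0 \<le> \<delta>" "ennreal \<delta> \<le> emeasure lborel {y. L < u y}"
    and num: "(\<kappa> / v x1) powr (p - 1) * (lam' * v x1 powr q * c powr (s * p)) + B * \<kappa> powr r
        < \<delta> * (((L - \<kappa>) powr (p - 1) - \<kappa> powr (p - 1)) / diam powr (real DIM('a) + s * p))"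
  shows "\<kappa> \<le> u x0"
proof (rule ccontr)
  assume less: "\<not> \<kappa> \<le> u x0"
  note [measurable] = sol_measurable[OF u(1)] sol_measurable[OF v(1)]
  define w where "w x = v (t + c *\<^sub>R x)" for x
  \<comment> \<open>Normalises the peak of the barrier to \<open>\<kappa>\<close>.\<close>
  define k where "k = \<kappa> / v x1"
  have k: "0 \<le> k" "k * v x1 = \<kappa>" using \<kappa> v(3) by (auto simp: k_def)
  have w0: "0 \<le> w x" for x using sol_nonneg[OF v(1)] by (simp add: w_def)
  have kw: "k * w x \<le> \<kappa>" for x using mult_left_mono[OF v(4) k(1)] k(2) by (simp add: w_def)
  have w_out: "w x = 0" if "x \<notin> \<Omega>" for x using sol_eq_0[OF v(1)] c(2) that by (auto simp: w_def)
  have w_W0: "w \<in> W0 s p \<Omega>"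
    unfolding w_def by (rule W0_affine[OF sol_W0[OF v(1)] c(1)]) (use w_out in \<open>auto simp: w_def\<close>)
  have w_cont: "continuous_on UNIV w"
    unfolding w_def by (intro continuous_on_compose2[OF sol_continuous[OF v(1)]] continuous_intros) auto
  have [measurable]: "w \<in> borel_measurable borel" using w_cont by (rule borel_measurable_continuous_onI)
  define \<phi> where "\<phi> x = max 0 (k * w x - u x)" for x
  have [measurable]: "\<phi> \<in> borel_measurable borel" unfolding \<phi>_def by measurable
  have \<phi>0: "0 \<le> \<phi> x" for x by (simp add: \<phi>_def)
  have u0: "0 \<le> u x" for x by (rule sol_nonneg[OF u(1)])
  have \<phi>_le: "\<phi> x \<le> k * w x" for x using u0[of x] w0[of x] k by (simp add: \<phi>_def)
  have \<phi>_cont: "continuous_on UNIV \<phi>"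
    unfolding \<phi>_def by (intro continuous_intros w_cont sol_continuous[OF u(1)])
  have \<phi>_out: "\<phi> x = 0" if "x \<notin> \<Omega>" for x using \<phi>_le[of x] \<phi>0[of x] w_out[OF that] by simp
  have \<phi>_W0: "\<phi> \<in> W0 s p \<Omega>"
  proof (rule W0_dominated[OF sol_W0[OF u(1)] w_W0 p_gt_1, of "1 + k"])
    show "\<bar>\<phi> x\<bar> \<le> (1 + k) * (\<bar>u x\<bar> + \<bar>w x\<bar>)" for x
    proof -
      have "\<phi> x \<le> k * w x + k * u x + u x + w x" 
        using \<phi>_le[of x] u0[of x] w0[of x] mult_nonneg_nonneg[OF k(1) u0[of x]] by linarith
      then show ?thesis using \<phi>0[of x] u0[of x] w0[of x] by (simp add: algebra_simps)
    qed
    show "\<bar>\<phi> x - \<phi> y\<bar> \<le> (1 + k) * (\<bar>u x - u y\<bar> + \<bar>w x - w y\<bar>)" for x y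
    proof -
      have "\<bar>\<phi> x - \<phi> y\<bar> \<le> \<bar>(k * w x - k * w y) - (u x - u y)\<bar>" by (auto simp: \<phi>_def)
      also have "\<dots> \<le> \<bar>k * (w x - w y)\<bar> + \<bar>u x - u y\<bar>" by (simp add: algebra_simps)
      also have "\<dots> = k * \<bar>w x - w y\<bar> + \<bar>u x - u y\<bar>" using k by (simp add: abs_mult)
      also have "\<dots> \<le> (1 + k) * (\<bar>u x - u y\<bar> + \<bar>w x - w y\<bar>)" using k by (simp add: distrib_left distrib_right)
      finally show ?thesis .
    qed
  qed (use k \<phi>_out in auto)
  have \<phi>_int: "integrable lborel \<phi>"
  proof (rule integrable_bounded_support)
    show "\<bar>\<phi> x\<bar> \<le> \<kappa>" for x using \<phi>_le[of x] \<phi>0[of x] kw[of x] by simp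
  qed (use bounded_\<Omega> \<phi>_out in auto)
  have "\<phi> x0 > 0" using less k c(3) by (simp add: \<phi>_def w_def)
  then have \<phi>_pos: "0 < (\<integral>x. \<phi> x \<partial>lborel)" by (rule integral_pos_continuous[OF \<phi>_cont \<phi>0 \<phi>_int])
  let ?g = "((L - \<kappa>) powr (p - 1) - \<kappa> powr (p - 1))"
  let ?c = "?g / diam powr (real DIM('a) + s * p)"
  have g0: "0 \<le> ?g" using \<kappa> p_gt_1 by (simp add: powr_mono2)
  let ?A = "{z. L < u (snd z)}"
  let ?H = "\<lambda>z. k powr (p - 1) * frac_pLap_integrand s p w \<phi> z - frac_pLap_integrand s p u \<phi> z"
  note R = rescaled_pair_le[OF v(1,2,4) c(1) \<phi>_W0 \<phi>_int \<phi>0 \<phi>_le[unfolded w_def], folded w_def]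
  have "\<delta> * (\<integral>x. ?c * \<phi> x \<partial>lborel) \<le> (\<integral>z. ?H z \<partial>(lborel \<Otimes>\<^sub>M lborel))"
  proof (rule integral_ge_sectional)
    show "integrable (lborel \<Otimes>\<^sub>M lborel) ?H"
      using R(1) sol_test(1)[OF u(1) \<phi>_W0] by simp
    have "{z \<in> space (lborel \<Otimes>\<^sub>M lborel). L < u (snd z)} \<in> sets (lborel \<Otimes>\<^sub>M lborel)" by measurable
    then show "?A \<in> sets (lborel \<Otimes>\<^sub>M lborel)" by (simp add: space_pair_measure)
    show "?c * \<phi> (fst z) * indicator ?A z \<le> ?H z" for z
    proof -
      obtain x y where z: "z = (x, y)" by force
      have H: "?H z = (jp p (k * w x - k * w y) * (\<phi> x - \<phi> y) - jp p (u x - u y) * (\<phi> x - \<phi> y)) * gk s p z"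
      proof -
        have "jp p (k * w x - k * w y) = k powr (p - 1) * jp p (w x - w y)"
          using jp_scale[OF k(1), of p "w x - w y"] by (simp only: right_diff_distrib)
        then show ?thesis by (simp add: z frac_pLap_integrand_eq left_diff_distrib mult.assoc)
      qed
      show ?thesis
      proof (cases "L < u y \<and> 0 < \<phi> x")
        case True
        have ux: "u x < k * w x" using True by (auto simp: \<phi>_def)
        have x: "x \<in> closure \<Omega>" using True \<phi>_out[of x] closure_subset by (metis less_irrefl subset_iff)
        have y: "y \<in> closure \<Omega>" using True sol_eq_0[OF u(1), of y] \<kappa> by force
        have "x \<noteq> y" using True ux kw[of x] \<kappa> by auto
        \<comment> \<open>Both barrier values are at most \<open>\<kappa>\<close>, well below
          \<open>L < u y\<close>, so the gain estimate applies with the levels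
          \<open>\<kappa>\<close> and \<open>L\<close>.\<close>
        have J: "?g * \<phi> x \<le> jp p (k * w x - k * w y) * (\<phi> x - \<phi> y) - jp p (u x - u y) * (\<phi> x - \<phi> y)"
          using jp_diff_pos_part_gain[OF p_gt_1 u0 ux _ kw kw, of y L "u y"] True \<kappa> k w0[of y] by (simp add: \<phi>_def)
        have "0 \<le> jp p (k * w x - k * w y) * (\<phi> x - \<phi> y) - jp p (u x - u y) * (\<phi> x - \<phi> y)"
          by (rule order_trans[OF mult_nonneg_nonneg[OF g0 \<phi>0] J])
        then have "(?g * \<phi> x) * (1 / diam powr (real DIM('a) + s * p)) \<le> ?H z"
          unfolding H unfolding z using J gk_lower[OF norm_diff_le_diam[OF x y] _ \<open>x \<noteq> y\<close>] sp_pos g0 \<phi>0[of x]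
          by (intro mult_mono) auto
        then show ?thesis using True by (simp add: z)
      next
        case False
        then have "?c * \<phi> (fst z) * indicator ?A z = 0" using \<phi>0[of x] by (auto simp: z)
        moreover have "0 \<le> ?H z" using jp_diff_pos_part_nonneg[OF p_gt_1, of "u x" "u y" "k * w x" "k * w y"]
          unfolding H by (simp add: \<phi>_def)
        ultimately show ?thesis by (rule ord_eq_le_trans)
      qed
    qed
    show "ennreal \<delta> \<le> emeasure lborel {y. (x, y) \<in> ?A}" for x using \<delta> by simp
    show "0 \<le> ?c * \<phi> x" for x using g0 \<phi>0 by simp
  qed (use \<phi>_int \<delta> in auto)
  also have "\<dots> = k powr (p - 1) * frac_pLap_pair s p w \<phi> - frac_pLap_pair s p u \<phi>"
    using R(1) sol_test(1)[OF u(1) \<phi>_W0] by (simp add: frac_pLap_pair_def)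
  also have "\<dots> \<le> k powr (p - 1) * (lam' * v x1 powr q * c powr (s * p) * (\<integral>x. \<phi> x \<partial>lborel)) + B * \<kappa> powr r * (\<integral>x. \<phi> x \<partial>lborel)"
  proof -
    \<comment> \<open>Where the test function is positive, \<open>u\<close> lies below the barrier,
      so the absorption is at most \<open>B * \<kappa> powr r\<close> there.\<close>
    have "u x \<le> \<kappa>" if "0 < \<phi> x" for x using that kw[of x] by (auto simp: \<phi>_def)
    then have "- (B * \<kappa> powr r) * (\<integral>x. \<phi> x \<partial>lborel) \<le> frac_pLap_pair s p u \<phi>"
      by (intro sol_pair_ge[OF u \<phi>_W0 \<phi>_int \<phi>0])
    moreover have "k powr (p - 1) * frac_pLap_pair s p w \<phi> \<le> k powr (p - 1) * (lam' * v x1 powr q * c powr (s * p) * (\<integral>x. \<phi> x \<partial>lborel))"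
      using R(2) by (intro mult_left_mono) auto
    ultimately show ?thesis by simp
  qed
  finally have "(\<delta> * ?c) * (\<integral>x. \<phi> x \<partial>lborel)
      \<le> (k powr (p - 1) * (lam' * v x1 powr q * c powr (s * p)) + B * \<kappa> powr r) * (\<integral>x. \<phi> x \<partial>lborel)"
    by (simp only: integral_mult_right_zero distrib_right mult.assoc)
  then have "\<delta> * ?c \<le> k powr (p - 1) * (lam' * v x1 powr q * c powr (s * p)) + B * \<kappa> powr r"
    using \<phi>_pos by (simp only: mult_le_cancel_right_pos)
  then show False using num by (simp add: k_def)
qed

text \<open>One \<open>\<theta>\<close> serves all solutions, levels and points of \<open>K\<close>.
  The barrier term scales like \<open>\<kappa> powr (p - 1)\<close> and the absorption like
  \<open>\<kappa> powr r\<close>, both against \<open>L powr (p - 1)\<close>; this is why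
  \<open>\<kappa>\<close> is subject to two conditions.\<close>

lemma positivity_expansion_compact:
  assumes v: "sol lam' v" "0 \<le> lam'" and K: "compact K" "K \<subseteq> \<Omega>" and \<delta>: "0 < \<delta>"
  obtains \<theta> where "0 < \<theta>"
    "\<And>lam u L \<kappa> x. \<lbrakk>sol lam u; 0 \<le> lam; ennreal \<delta> \<le> emeasure lborel {y. L < u y}; 0 < L; 0 < \<kappa>;
        \<kappa> \<le> \<theta> * L; \<kappa> powr r \<le> \<theta> * L powr (p - 1); x \<in> K\<rbrakk> \<Longrightarrow> \<kappa> \<le> u x"
proof -
  obtain x1 where x1: "x1 \<in> closure \<Omega>" "0 < v x1" "\<And>y. v y \<le> v x1" using sol_attains_max[OF v(1)] by blast
  \<comment> \<open>A uniform safety distance from \<open>K\<close> to the complement of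
    \<open>\<Omega>\<close>. The cases with an empty set are separate, since \<open>setdist\<close>
    is then 0.\<close>
  obtain e where e: "0 < e" "\<And>x y. x \<in> K \<Longrightarrow> dist x y < e \<Longrightarrow> y \<in> \<Omega>"
  proof (cases "K = {} \<or> - \<Omega> = {}")
    case True then show ?thesis using that[of 1] by auto
  next
    case False
    then have "0 < setdist K (- \<Omega>)"
      using setdist_gt_0_compact_closed[OF K(1), of "- \<Omega>"] open_\<Omega> K(2) by auto
    then show ?thesis using that[of "setdist K (- \<Omega>)"] setdist_le_dist[of _ K _ "- \<Omega>"]
      by (metis ComplI not_less)
  qed
  \<comment> \<open>The preimage of \<open>closure \<Omega>\<close> under the rescaling lies within
    \<open>diam / c = e / 2\<close> of \<open>x\<close>, so every copy centred at a point of
    \<open>K\<close> stays inside \<open>\<Omega>\<close>.\<close>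
  define c where "c = 2 * diam / e"
  have c: "0 < c" using diam_pos e by (simp add: c_def)
  \<comment> \<open>The right side of the numerical condition at \<open>L = 1\<close>, with
    \<open>\<kappa>\<close> at its largest admissible value 1/4.\<close>
  define g where "g = \<delta> * (((3/4) powr (p - 1) - (1/4) powr (p - 1)) / diam powr (real DIM('a) + s * p))"
  have "(1/4::real) powr (p - 1) < (3/4) powr (p - 1)" using p_gt_1 by (intro powr_less_mono2) auto
  then have g: "0 < g" using \<delta> diam_pos by (simp add: g_def)
  define A where "A = (1 / v x1) powr (p - 1) * (lam' * v x1 powr q * c powr (s * p))"
  have A: "0 \<le> A" using v by (simp add: A_def)
  \<comment> \<open>The entries give in turn \<open>\<kappa> \<le> L / 4\<close>, a barrier term of
    at most \<open>g / 3\<close> and an absorption term of at most \<open>g / 3\<close>, in units of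
    \<open>L powr (p - 1)\<close>. Adding 1 to \<open>A\<close> and \<open>B\<close> avoids division
    by zero.\<close>
  define \<theta> where "\<theta> = min (1/4) (min ((g / (3 * (A + 1))) powr (1 / (p - 1))) (g / (3 * (B + 1))))"
  have \<theta>: "0 < \<theta>" using g A B_nonneg by (simp add: \<theta>_def)
  have \<theta>1: "\<theta> \<le> 1/4" and \<theta>2: "\<theta> \<le> (g / (3 * (A + 1))) powr (1 / (p - 1))" and \<theta>3: "\<theta> \<le> g / (3 * (B + 1))"
    unfolding \<theta>_def by linarith+
  have "\<theta> powr (p - 1) \<le> ((g / (3 * (A + 1))) powr (1 / (p - 1))) powr (p - 1)"
    using \<theta>2 \<theta> p_gt_1 by (intro powr_mono2) auto
  also have "\<dots> = g / (3 * (A + 1))" using p_gt_1 g A by (simp add: powr_powr)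
  finally have \<theta>2': "(A + 1) * \<theta> powr (p - 1) \<le> g / 3" using A by (simp add: field_simps)
  have \<theta>3': "(B + 1) * \<theta> \<le> g / 3" using \<theta>3 B_nonneg by (simp add: field_simps)
  show ?thesis
  proof (rule that[OF \<theta>])
    fix lam u L \<kappa> x
    assume u: "sol lam u" "0 \<le> lam" and L: "ennreal \<delta> \<le> emeasure lborel {y. L < u y}" "0 < L"
      and \<kappa>: "0 < \<kappa>" "\<kappa> \<le> \<theta> * L" "\<kappa> powr r \<le> \<theta> * L powr (p - 1)" and x: "x \<in> K"
    have \<kappa>4: "\<kappa> \<le> L / 4" using \<kappa>(2) mult_right_mono[OF \<theta>1, of L] L(2) by linarith
    show "\<kappa> \<le> u x"
    proof (rule positivity_expansion[OF v x1(2,3) u c, where t = "x1 - c *\<^sub>R x" and \<delta> = \<delta> and L = L])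
      fix y assume "x1 - c *\<^sub>R x + c *\<^sub>R y \<in> closure \<Omega>"
      then have "norm (x1 - (x1 - c *\<^sub>R x + c *\<^sub>R y)) \<le> diam" using x1(1) by (intro norm_diff_le_diam)
      also have "x1 - (x1 - c *\<^sub>R x + c *\<^sub>R y) = c *\<^sub>R (x - y)" by (simp add: algebra_simps)
      finally have "c * dist x y \<le> diam" using c by (simp add: dist_norm)
      moreover have "diam < c * e" using diam_pos e by (simp add: c_def)
      ultimately have "c * dist x y < c * e" by simp
      then have "dist x y < e" using c by simp
      then show "y \<in> \<Omega>" using e x by blast
    next
      have "(\<kappa> / v x1) powr (p - 1) * (lam' * v x1 powr q * c powr (s * p)) = A * \<kappa> powr (p - 1)"
        using \<kappa>(1) x1(2) by (simp add: A_def powr_divide)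
      also have "\<dots> \<le> A * (\<theta> powr (p - 1) * L powr (p - 1))"
        using \<kappa> \<theta> L p_gt_1 A powr_mono2[of "p - 1" \<kappa> "\<theta> * L"] by (intro mult_left_mono) (auto simp: powr_mult)
      also have "\<dots> \<le> ((A + 1) * \<theta> powr (p - 1)) * L powr (p - 1)" by (simp add: algebra_simps)
      also have "\<dots> \<le> g / 3 * L powr (p - 1)" using \<theta>2' by (intro mult_right_mono) auto
      finally have 1: "(\<kappa> / v x1) powr (p - 1) * (lam' * v x1 powr q * c powr (s * p)) \<le> g / 3 * L powr (p - 1)" .
      have "B * \<kappa> powr r \<le> B * (\<theta> * L powr (p - 1))" using \<kappa> B_nonneg by (intro mult_left_mono) auto
      also have "\<dots> \<le> ((B + 1) * \<theta>) * L powr (p - 1)" using \<theta> by (simp add: algebra_simps)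
      also have "\<dots> \<le> g / 3 * L powr (p - 1)" using \<theta>3' by (intro mult_right_mono) auto
      finally have 2: "B * \<kappa> powr r \<le> g / 3 * L powr (p - 1)" .
      have "(3/4 * L) powr (p - 1) \<le> (L - \<kappa>) powr (p - 1)" using \<kappa>4 L p_gt_1 by (intro powr_mono2) auto
      moreover have "\<kappa> powr (p - 1) \<le> (1/4 * L) powr (p - 1)" using \<kappa>4 \<kappa> p_gt_1 by (intro powr_mono2) auto
      ultimately have "((3/4) powr (p - 1) - (1/4) powr (p - 1)) * L powr (p - 1) \<le> (L - \<kappa>) powr (p - 1) - \<kappa> powr (p - 1)"
        using L powr_mult[of "3/4" L "p - 1"] powr_mult[of "1/4" L "p - 1"] unfolding left_diff_distrib by linarith
      then have "\<delta> * ((((3/4) powr (p - 1) - (1/4) powr (p - 1)) * L powr (p - 1)) / diam powr (real DIM('a) + s * p))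
          \<le> \<delta> * (((L - \<kappa>) powr (p - 1) - \<kappa> powr (p - 1)) / diam powr (real DIM('a) + s * p))"
        using \<delta> by (intro mult_left_mono divide_right_mono) auto
      then have 3: "g * L powr (p - 1) \<le> \<delta> * (((L - \<kappa>) powr (p - 1) - \<kappa> powr (p - 1)) / diam powr (real DIM('a) + s * p))"
        by (simp add: g_def)
      \<comment> \<open>Two thirds of a positive quantity are strictly less than the whole, which
        gives the strict inequality.\<close>
      have "0 < g * L powr (p - 1)" using g L by simp
      then show "(\<kappa> / v x1) powr (p - 1) * (lam' * v x1 powr q * c powr (s * p)) + B * \<kappa> powr r
        < \<delta> * (((L - \<kappa>) powr (p - 1) - \<kappa> powr (p - 1)) / diam powr (real DIM('a) + s * p))"
        using 1 2 3 by simp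
    qed (use \<kappa> \<kappa>4 \<delta> L in auto)
  qed
qed

section \<open>The Picone inequality for solutions\<close>

lemma integrable_cutoff:
  fixes f :: "'a \<Rightarrow> real"
  assumes [measurable]: "f \<in> borel_measurable lborel" and "AE x in lborel. x \<in> \<Omega> \<longrightarrow> \<bar>f x\<bar> \<le> C"
  shows "integrable lborel (\<lambda>x. indicator \<Omega> x * f x)"
proof (rule Bochner_Integration.integrable_bound)
  have "emeasure lborel \<Omega> < \<infinity>" using bounded_\<Omega> emeasure_bounded_finite by auto
  then show "integrable lborel (\<lambda>x. C * indicator \<Omega> x :: real)"
    by (intro integrable_mult_right integrable_real_indicator) auto
  show "AE x in lborel. norm (indicator \<Omega> x * f x) \<le> norm (C * indicator \<Omega> x)"
    using assms(2) by eventually_elim (auto simp: indicator_def)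
qed measurable

text \<open>Boundedness of \<open>w\<close> makes \<open>w powr p\<close> Lipschitz in
  \<open>w\<close>, and the shift by \<open>\<epsilon>\<close> makes the negative power of
  \<open>u + \<epsilon>\<close> bounded and Lipschitz in \<open>u\<close>; so the increments of the
  quotient are controlled by those of \<open>w\<close> and \<open>u\<close>.\<close>

lemma picone_test_W0:
  fixes w u :: "'a \<Rightarrow> real"
  assumes u: "u \<in> W0 s p \<Omega>" "\<And>x. 0 \<le> u x" and w: "w \<in> W0 s p \<Omega>" "\<And>x. 0 \<le> w x" "\<And>x. w x \<le> N"
    and \<epsilon>: "0 < \<epsilon>"
  shows "(\<lambda>x. w x powr p / (u x + \<epsilon>) powr (p - 1)) \<in> W0 s p \<Omega>"
proof -
  note [measurable] = W0_D(1)[OF u(1)] W0_D(1)[OF w(1)]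
  define \<alpha> where "\<alpha> = p - 1"
  have \<alpha>: "0 < \<alpha>" using p_gt_1 by (simp add: \<alpha>_def)
  have N: "0 \<le> N" using w(2,3) order_trans by blast
  let ?\<psi> = "\<lambda>x. w x powr p * (u x + \<epsilon>) powr - \<alpha>"
  have eq: "w x powr p / (u x + \<epsilon>) powr (p - 1) = ?\<psi> x" for x
    unfolding \<alpha>_def powr_minus by (simp add: divide_inverse)
  have up: "(u x + \<epsilon>) powr - \<alpha> \<le> \<epsilon> powr - \<alpha>" for x using u(2)[of x] \<epsilon> \<alpha> by (intro powr_mono2') auto
  define C1 where "C1 = p * N powr (p - 1) * \<epsilon> powr - \<alpha>"
  define C2 where "C2 = N powr p * (\<alpha> * \<epsilon> powr (- \<alpha> - 1))"
  have C: "0 \<le> C1" "0 \<le> C2" using p_gt_1 \<alpha> by (simp_all add: C1_def C2_def)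
  have "(\<lambda>x. w x powr p / (u x + \<epsilon>) powr (p - 1)) \<in> W0 s p \<Omega>"
    unfolding eq
  proof (rule W0_dominated[OF w(1) u(1) p_gt_1, of "C1 + C2"])
    show "\<bar>?\<psi> x - ?\<psi> y\<bar> \<le> (C1 + C2) * (\<bar>w x - w y\<bar> + \<bar>u x - u y\<bar>)" for x y
    proof -
      have 1: "\<bar>(w x powr p - w y powr p) * (u x + \<epsilon>) powr - \<alpha>\<bar> \<le> (p * N powr (p - 1) * \<bar>w x - w y\<bar>) * \<epsilon> powr - \<alpha>"
        unfolding abs_mult using powr_lipschitz[OF p_gt_1 w(2) w(3) w(2) w(3), of x y] up[of x] by (intro mult_mono) auto
      have "\<bar>(u x + \<epsilon>) powr - \<alpha> - (u y + \<epsilon>) powr - \<alpha>\<bar> \<le> \<alpha> * \<epsilon> powr (- \<alpha> - 1) * \<bar>u x - u y\<bar>"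
        using powr_minus_lipschitz[OF \<alpha> \<epsilon>, of "u x + \<epsilon>" "u y + \<epsilon>"] u(2)[of x] u(2)[of y] by simp
      moreover have "w y powr p \<le> N powr p" using w(2,3) p_gt_1 by (intro powr_mono2) auto
      ultimately have 2: "\<bar>w y powr p * ((u x + \<epsilon>) powr - \<alpha> - (u y + \<epsilon>) powr - \<alpha>)\<bar>
          \<le> N powr p * (\<alpha> * \<epsilon> powr (- \<alpha> - 1) * \<bar>u x - u y\<bar>)"
        unfolding abs_mult by (intro mult_mono) auto
      \<comment> \<open>Discrete product rule.\<close>
      have "?\<psi> x - ?\<psi> y = (w x powr p - w y powr p) * (u x + \<epsilon>) powr - \<alpha>
          + w y powr p * ((u x + \<epsilon>) powr - \<alpha> - (u y + \<epsilon>) powr - \<alpha>)"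
        by (simp add: algebra_simps)
      then have "\<bar>?\<psi> x - ?\<psi> y\<bar> \<le> C1 * \<bar>w x - w y\<bar> + C2 * \<bar>u x - u y\<bar>"
        using 1 2 unfolding C1_def C2_def
        by (smt (verit) mult.assoc mult.commute)
      also have "\<dots> \<le> (C1 + C2) * \<bar>w x - w y\<bar> + (C1 + C2) * \<bar>u x - u y\<bar>"
        using C by (intro add_mono mult_right_mono) auto
      finally show ?thesis by (simp add: algebra_simps)
    qed
    show "\<bar>?\<psi> x\<bar> \<le> (C1 + C2) * (\<bar>w x\<bar> + \<bar>u x\<bar>)" for x
    proof -
      have "\<bar>w x powr p - 0 powr p\<bar> \<le> p * N powr (p - 1) * \<bar>w x - 0\<bar>"
        using w N by (intro powr_lipschitz p_gt_1) auto
      then have "w x powr p \<le> p * N powr (p - 1) * w x" using w(2)[of x] by simp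
      then have "w x powr p * (u x + \<epsilon>) powr - \<alpha> \<le> (p * N powr (p - 1) * w x) * \<epsilon> powr - \<alpha>"
        using up[of x] w(2)[of x] p_gt_1 by (intro mult_mono) auto
      also have "\<dots> = C1 * w x" by (simp add: C1_def)
      also have "\<dots> \<le> (C1 + C2) * (\<bar>w x\<bar> + \<bar>u x\<bar>)" using C w(2)[of x] by (intro mult_mono) auto
      finally show ?thesis by simp
    qed
    show "AE x in lborel. x \<notin> \<Omega> \<longrightarrow> ?\<psi> x = 0"
      using W0_D(4)[OF w(1)] by eventually_elim auto
  qed (use C in auto)
  then show ?thesis .
qed

text \<open>The shifted function \<open>u + \<epsilon>\<close> enters the Picone inequality, since a
  shift leaves differences unchanged. Pairs with \<open>y\<close> in \<open>E\<close> contribute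
  more: \<open>w\<close> vanishes there and \<open>u y\<close> is at least the fraction
  \<open>\<kappa> / M\<close> of the bound \<open>M\<close>. Taking \<open>E = {}\<close> and
  \<open>m = 0\<close> gives the plain inequality.\<close>

lemma sol_picone_eps:
  assumes u: "sol lam u" and M: "0 < M" "\<And>y. u y \<le> M"
    and w: "w \<in> W0 s p \<Omega>" "\<And>x. 0 \<le> w x" "\<And>x. w x \<le> N" "\<And>x. x \<notin> closure \<Omega> \<Longrightarrow> w x = 0"
    and E: "E \<in> sets lborel" "E \<subseteq> \<Omega>" "\<And>y. y \<in> E \<Longrightarrow> w y = 0" "\<And>y. y \<in> E \<Longrightarrow> \<kappa> \<le> u y"
      "0 \<le> \<kappa>" "\<kappa> \<le> M" "0 \<le> m" "ennreal m \<le> emeasure lborel E"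
    and \<epsilon>: "0 < \<epsilon>"
  shows "(1 - (1 - \<kappa> / M) powr (p - 1)) / diam powr (real DIM('a) + s * p) * m * (\<integral>x. w x powr p \<partial>lborel)
     + (\<integral>x. indicator \<Omega> x * ((lam * u x powr q - b x * u x powr r) * (w x powr p / (u x + \<epsilon>) powr (p - 1))) \<partial>lborel)
     \<le> enn2real (gagliardo s p w)"
proof -
  note [measurable] = sol_measurable[OF u(1)] W0_D(1)[OF w(1)]
  define \<psi> where "\<psi> x = w x powr p / (u x + \<epsilon>) powr (p - 1)" for x
  have \<psi>_W0: "\<psi> \<in> W0 s p \<Omega>"
    unfolding \<psi>_def using picone_test_W0[OF sol_W0[OF u] sol_nonneg[OF u] w(1-3) \<epsilon>] .
  have u0: "0 \<le> u x" for x by (rule sol_nonneg[OF u])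
  let ?W = "\<lambda>z. \<bar>w (fst z) - w (snd z)\<bar> powr p * gk s p z"
  have W_int: "integrable (lborel \<Otimes>\<^sub>M lborel) ?W"
    by (rule integrableI_bounded) (use W0_D(3)[OF w(1)] in \<open>simp_all add: gagliardo_eq\<close>)
  have W_eq: "(\<integral>z. ?W z \<partial>(lborel \<Otimes>\<^sub>M lborel)) = enn2real (gagliardo s p w)"
    unfolding gagliardo_eq by (rule integral_eq_nn_integral) auto
  let ?g = "1 - (1 - \<kappa> / M) powr (p - 1)"
  let ?c = "?g / diam powr (real DIM('a) + s * p)"
  have \<tau>: "0 \<le> \<kappa> / M" "\<kappa> / M \<le> 1" using E M by auto
  have "(1 - \<kappa> / M) powr (p - 1) \<le> 1 powr (p - 1)" using \<tau> p_gt_1 by (intro powr_mono2) auto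
  then have g0: "0 \<le> ?g" by simp
  have "w x powr p \<le> N powr p" for x using w(2,3) p_gt_1 by (intro powr_mono2) auto
  then have w_int: "integrable lborel (\<lambda>x. w x powr p)"
    using w(4) bounded_\<Omega> by (intro integrable_bounded_support[of _ "N powr p" "closure \<Omega>"]) (auto simp: bounded_closure)
  have "m * (\<integral>x. ?c * w x powr p \<partial>lborel)
      \<le> (\<integral>z. ?W z - frac_pLap_integrand s p u \<psi> z \<partial>(lborel \<Otimes>\<^sub>M lborel))"
  proof (rule integral_ge_sectional[where A = "{z. snd z \<in> E}"])
    show "integrable (lborel \<Otimes>\<^sub>M lborel) (\<lambda>z. ?W z - frac_pLap_integrand s p u \<psi> z)"
      using W_int sol_test(1)[OF u \<psi>_W0] by simp
    have "{z \<in> space (lborel \<Otimes>\<^sub>M lborel). snd z \<in> E} \<in> sets (lborel \<Otimes>\<^sub>M lborel)" using E(1) by measurable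
    then show "{z. snd z \<in> E} \<in> sets (lborel \<Otimes>\<^sub>M lborel)" by (simp add: space_pair_measure)
    show "?c * w (fst z) powr p * indicator {z. snd z \<in> E} z \<le> ?W z - frac_pLap_integrand s p u \<psi> z" for z
    proof -
      obtain x y where z: "z = (x, y)" by force
      have H: "?W z - frac_pLap_integrand s p u \<psi> z = (\<bar>w x - w y\<bar> powr p - jp p (u x - u y) * (\<psi> x - \<psi> y)) * gk s p z"
        by (simp add: z frac_pLap_integrand_eq left_diff_distrib)
      have H0: "0 \<le> ?W z - frac_pLap_integrand s p u \<psi> z"
        unfolding H using picone[OF p_gt_1 _ _ w(2) w(2), of "u y + \<epsilon>" "u x + \<epsilon>" x y] u0[of x] u0[of y] \<epsilon>
        by (intro mult_nonneg_nonneg) (auto simp: \<psi>_def)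
      show ?thesis
      proof (cases "y \<in> E \<and> w x \<noteq> 0")
        case True
        then have wy: "w y = 0" "\<kappa> \<le> u y" "x \<noteq> y" using E(3,4) by auto
        have x: "x \<in> closure \<Omega>" using True w(4)[of x] by blast
        have y: "y \<in> closure \<Omega>" using True E(2) closure_subset by blast
        \<comment> \<open>The ratio condition of the gap inequality survives the shift because
          \<open>\<kappa> / M \<le> 1\<close>.\<close>
        have "\<kappa> / M * (u x + \<epsilon>) \<le> \<kappa> / M * M + 1 * \<epsilon>"
          unfolding distrib_left using \<tau> M(2)[of x] \<epsilon> by (intro add_mono mult_left_mono mult_right_mono) auto
        also have "\<dots> \<le> u y + \<epsilon>" using M wy by simp
        finally have "jp p (u x - u y) * \<psi> x + ?g * w x powr p \<le> w x powr p"
          using picone_gap[OF p_gt_1 _ \<tau>, of "u x + \<epsilon>" "u y + \<epsilon>" "w x"] u0[of x] \<epsilon> by (simp add: \<psi>_def)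
        then have J: "?g * w x powr p \<le> \<bar>w x - w y\<bar> powr p - jp p (u x - u y) * (\<psi> x - \<psi> y)"
          using wy w(2)[of x] by (simp add: \<psi>_def)
        have "0 \<le> \<bar>w x - w y\<bar> powr p - jp p (u x - u y) * (\<psi> x - \<psi> y)"
          by (rule order_trans[OF mult_nonneg_nonneg[OF g0] J]) simp
        then have "(?g * w x powr p) * (1 / diam powr (real DIM('a) + s * p)) \<le> ?W z - frac_pLap_integrand s p u \<psi> z"
          unfolding H unfolding z using J gk_lower[OF norm_diff_le_diam[OF x y] _ wy(3)] sp_pos g0
          by (intro mult_mono) auto
        then show ?thesis using True by (simp add: z)
      next
        case False
        then have "?c * w (fst z) powr p * indicator {z. snd z \<in> E} z = 0" by (auto simp: z)
        then show ?thesis using H0 by (rule ord_eq_le_trans)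
      qed
    qed
    show "ennreal m \<le> emeasure lborel {y. (x, y) \<in> {z. snd z \<in> E}}" for x using E by simp
    show "0 \<le> ?c * w x powr p" for x using g0 by simp
  qed (use w_int E in auto)
  also have "\<dots> = enn2real (gagliardo s p w) - frac_pLap_pair s p u \<psi>"
    unfolding frac_pLap_pair_def W_eq[symmetric] by (rule Bochner_Integration.integral_diff[OF W_int sol_test(1)[OF u \<psi>_W0]])
  finally show ?thesis
    unfolding sol_test(3)[OF u \<psi>_W0] unfolding \<psi>_def unfolding integral_mult_right_zero
    by (simp add: mult_ac le_diff_eq)
qed

text \<open>Passage to \<open>\<epsilon> = 0\<close>. The source term is handled by Fatou's lemma,
  so the left side is a nonnegative integral: for \<open>q < p - 1\<close> it contains a negative
  power of \<open>u\<close>, and its finiteness is part of the conclusion. The absorption term is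
  bounded uniformly in \<open>\<epsilon>\<close> beforehand.\<close>

lemma sol_picone:
  assumes u: "sol lam u" "0 \<le> lam" and M: "0 < M" "\<And>y. u y \<le> M"
    and w: "w \<in> W0 s p \<Omega>" "\<And>x. 0 \<le> w x" "\<And>x. w x \<le> N" "\<And>x. x \<notin> closure \<Omega> \<Longrightarrow> w x = 0"
    and E: "E \<in> sets lborel" "E \<subseteq> \<Omega>" "\<And>y. y \<in> E \<Longrightarrow> w y = 0" "\<And>y. y \<in> E \<Longrightarrow> \<kappa> \<le> u y"
      "0 \<le> \<kappa>" "\<kappa> \<le> M" "0 \<le> m" "ennreal m \<le> emeasure lborel E"
  shows "(\<integral>\<^sup>+x. ennreal (indicator \<Omega> x * (lam * u x powr (q - (p - 1)) * w x powr p)) \<partial>lborel)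
     \<le> ennreal (enn2real (gagliardo s p w)
         + (\<integral>x. indicator \<Omega> x * (b x * u x powr (r - (p - 1)) * w x powr p) \<partial>lborel)
         - (1 - (1 - \<kappa> / M) powr (p - 1)) / diam powr (real DIM('a) + s * p) * m * (\<integral>x. w x powr p \<partial>lborel))"
    (is "_ \<le> ennreal ?R")
proof -
  note [measurable] = sol_measurable[OF u(1)] W0_D(1)[OF w(1)]
  have u0: "0 \<le> u x" for x by (rule sol_nonneg[OF u(1)])
  have wN: "w x powr p \<le> N powr p" for x using w(2,3) p_gt_1 by (intro powr_mono2) auto
  define F where "F \<epsilon> x = indicator \<Omega> x * (lam * u x powr q * (w x powr p / (u x + \<epsilon>) powr (p - 1)))" for \<epsilon> x
  have F_meas [measurable]: "F \<epsilon> \<in> borel_measurable lborel" for \<epsilon> unfolding F_def by measurable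
  have F0: "0 \<le> F \<epsilon> x" for \<epsilon> x using u(2) by (simp add: F_def)
  let ?b = "\<lambda>x. indicator \<Omega> x * (b x * u x powr (r - (p - 1)) * w x powr p)"
  have b_int: "integrable lborel ?b"
  proof (rule integrable_cutoff)
    show "AE x in lborel. x \<in> \<Omega> \<longrightarrow> \<bar>b x * u x powr (r - (p - 1)) * w x powr p\<bar> \<le> B * M powr (r - (p - 1)) * N powr p"
      using b_le
    proof eventually_elim
      fix x assume bx: "x \<in> \<Omega> \<longrightarrow> b x \<le> B"
      have "u x powr (r - (p - 1)) \<le> M powr (r - (p - 1))" using u0 M r_gt by (intro powr_mono2) auto
      then show "x \<in> \<Omega> \<longrightarrow> \<bar>b x * u x powr (r - (p - 1)) * w x powr p\<bar> \<le> B * M powr (r - (p - 1)) * N powr p"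
        using bx b_nonneg[of x] wN[of x] B_nonneg by (auto simp: abs_mult intro!: mult_mono)
    qed
  qed measurable
  have F_le: "integrable lborel (F \<epsilon>)" "(\<integral>x. F \<epsilon> x \<partial>lborel) \<le> ?R" if \<epsilon>: "0 < \<epsilon>" for \<epsilon>
  proof -
    show F_int: "integrable lborel (F \<epsilon>)"
      unfolding F_def
    proof (rule integrable_cutoff)
      show "AE x in lborel. x \<in> \<Omega> \<longrightarrow> \<bar>lam * u x powr q * (w x powr p / (u x + \<epsilon>) powr (p - 1))\<bar>
          \<le> lam * M powr q * (N powr p / \<epsilon> powr (p - 1))"
      proof (intro AE_I2 impI)
        fix x
        have "u x powr q \<le> M powr q" using u0 M q_pos by (intro powr_mono2) auto
        moreover have "w x powr p / (u x + \<epsilon>) powr (p - 1) \<le> N powr p / \<epsilon> powr (p - 1)"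
          using \<epsilon> p_gt_1 u0[of x] by (intro frac_le wN powr_mono2[of "p - 1" \<epsilon> "u x + \<epsilon>"]) auto
        ultimately show "\<bar>lam * u x powr q * (w x powr p / (u x + \<epsilon>) powr (p - 1))\<bar> \<le> lam * M powr q * (N powr p / \<epsilon> powr (p - 1))"
          using u(2) by (subst abs_of_nonneg) (auto simp del: times_divide_eq_right intro!: mult_mono mult_nonneg_nonneg)
      qed
    qed measurable
    let ?\<psi> = "\<lambda>x. w x powr p / (u x + \<epsilon>) powr (p - 1)"
    let ?T = "\<lambda>x. indicator \<Omega> x * ((lam * u x powr q - b x * u x powr r) * ?\<psi> x)"
    have T_int: "integrable lborel ?T"
      using sol_test(2)[OF u(1) picone_test_W0[OF sol_W0[OF u(1)] u0 w(1-3) \<epsilon>]] by simp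
    have "(\<integral>x. F \<epsilon> x - ?b x \<partial>lborel) \<le> (\<integral>x. ?T x \<partial>lborel)"
    proof (rule integral_mono)
      fix x
      \<comment> \<open>The absorption part grows as \<open>\<epsilon>\<close> decreases and is
        bounded by its value at \<open>\<epsilon> = 0\<close>.\<close>
      have "u x powr r * ?\<psi> x \<le> u x powr (r - (p - 1)) * w x powr p"
      proof (cases "u x = 0")
        case False
        then have "0 < u x" using u0[of x] by simp
        then have "u x powr (p - 1) / (u x + \<epsilon>) powr (p - 1) \<le> 1"
          using \<epsilon> p_gt_1 by (auto intro!: powr_mono2)
        then have "(u x powr (r - (p - 1)) * w x powr p) * (u x powr (p - 1) / (u x + \<epsilon>) powr (p - 1)) \<le> (u x powr (r - (p - 1)) * w x powr p) * 1"
          by (intro mult_left_mono) auto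
        moreover have "u x powr r = u x powr (r - (p - 1)) * u x powr (p - 1)" using \<open>0 < u x\<close> by (simp add: powr_add[symmetric])
        ultimately show ?thesis by (simp add: mult_ac)
      qed simp
      then have "b x * (u x powr r * ?\<psi> x) \<le> b x * (u x powr (r - (p - 1)) * w x powr p)" if "x \<in> \<Omega>"
        using b_nonneg[OF that] by (intro mult_left_mono)
      then show "F \<epsilon> x - ?b x \<le> ?T x"
        by (auto simp: F_def indicator_def left_diff_distrib mult.assoc simp del: times_divide_eq_right)
    qed (use F_int b_int T_int in auto)
    moreover have "(\<integral>x. F \<epsilon> x - ?b x \<partial>lborel) = (\<integral>x. F \<epsilon> x \<partial>lborel) - (\<integral>x. ?b x \<partial>lborel)"
      by (rule Bochner_Integration.integral_diff[OF F_int b_int])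
    ultimately show "(\<integral>x. F \<epsilon> x \<partial>lborel) \<le> ?R"
      using sol_picone_eps[OF u(1) M w E \<epsilon>] by linarith
  qed
  define e where "e n = 1 / real (Suc n)" for n
  have e: "0 < e n" for n by (simp add: e_def)
  have "(\<integral>\<^sup>+x. ennreal (indicator \<Omega> x * (lam * u x powr (q - (p - 1)) * w x powr p)) \<partial>lborel)
      \<le> (\<integral>\<^sup>+x. liminf (\<lambda>n. ennreal (F (e n) x)) \<partial>lborel)"
  proof (rule nn_integral_mono_AE)
    show "AE x in lborel. ennreal (indicator \<Omega> x * (lam * u x powr (q - (p - 1)) * w x powr p)) \<le> liminf (\<lambda>n. ennreal (F (e n) x))"
      using sol_AE_pos[OF u(1)]
    proof eventually_elim
      fix x assume pos: "x \<in> \<Omega> \<longrightarrow> 0 < u x"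
      show "ennreal (indicator \<Omega> x * (lam * u x powr (q - (p - 1)) * w x powr p)) \<le> liminf (\<lambda>n. ennreal (F (e n) x))"
      proof (cases "x \<in> \<Omega>")
        case True
        then have ux: "0 < u x" using pos by simp
        have "e \<longlonglongrightarrow> 0" unfolding e_def using LIMSEQ_inverse_real_of_nat by (simp add: inverse_eq_divide)
        \<comment> \<open>Convergence uses \<open>0 < u x\<close>, so that the denominator does not
          tend to 0.\<close>
        then have "(\<lambda>n. F (e n) x) \<longlonglongrightarrow> indicator \<Omega> x * (lam * u x powr q * (w x powr p / (u x + 0) powr (p - 1)))"
          unfolding F_def using ux by (intro tendsto_intros) auto
        then have "(\<lambda>n. ennreal (F (e n) x)) \<longlonglongrightarrow> ennreal (indicator \<Omega> x * (lam * u x powr q * (w x powr p / (u x + 0) powr (p - 1))))"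
          by (rule tendsto_ennrealI)
        also have "indicator \<Omega> x * (lam * u x powr q * (w x powr p / (u x + 0) powr (p - 1))) = indicator \<Omega> x * (lam * u x powr (q - (p - 1)) * w x powr p)"
          using ux by (simp add: powr_diff)
        finally show ?thesis using lim_imp_Liminf[OF trivial_limit_sequentially] by fastforce
      qed simp
    qed
  qed
  also have "\<dots> \<le> liminf (\<lambda>n. \<integral>\<^sup>+x. ennreal (F (e n) x) \<partial>lborel)"
    by (rule nn_integral_liminf) measurable
  also have "\<dots> \<le> ennreal ?R"
  proof (rule Liminf_le[OF trivial_limit_sequentially], rule always_eventually, rule allI)
    fix n
    have "(\<integral>\<^sup>+x. ennreal (F (e n) x) \<partial>lborel) = ennreal (\<integral>x. F (e n) x \<partial>lborel)"
      using F_le(1)[OF e] F0 by (intro nn_integral_eq_integral) auto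
    also have "\<dots> \<le> ennreal ?R" using F_le(2)[OF e] by (rule ennreal_leI)
    finally show "(\<integral>\<^sup>+x. ennreal (F (e n) x) \<partial>lborel) \<le> ennreal ?R" .
  qed
  finally show ?thesis .
qed

section \<open>Bounds on the maximum and on superlevel sets\<close>

text \<open>The smallness condition of the sup estimate holds automatically for a large radius: the
  superlevel set lies in \<open>ball 0 R\<close>, whose volume is at most half that of the ball of
  radius \<open>2 * R\<close>.\<close>

lemma max_le_const_power:
  obtains C where "0 < C" "\<And>lam u x1. \<lbrakk>sol lam u; 0 \<le> lam; 0 < u x1; \<And>y. u y \<le> u x1\<rbrakk>
    \<Longrightarrow> u x1 powr (p - 1) \<le> C * lam * u x1 powr q"
proof -
  obtain R where R: "0 < R" "closure \<Omega> \<subseteq> ball 0 R"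
    using bounded_subset_ballD[of "closure \<Omega>" 0] bounded_\<Omega> by (auto simp: bounded_closure)
  define \<rho> where "\<rho> = 2 * R"
  have \<rho>: "0 < \<rho>" using R by (simp add: \<rho>_def)
  have "(1::real) + 1 \<le> 2 ^ DIM('a)" using self_le_power[of "2::real" "DIM('a)"] by simp
  then have "2 * R ^ DIM('a) \<le> 2 ^ DIM('a) * R ^ DIM('a)" using R by (intro mult_right_mono) auto
  also have "\<dots> = \<rho> ^ DIM('a)" by (simp add: \<rho>_def power_mult_distrib)
  finally have "unit_ball_vol (real DIM('a)) * (2 * R ^ DIM('a)) \<le> unit_ball_vol (real DIM('a)) * \<rho> ^ DIM('a)"
    by (intro mult_left_mono) auto
  then have vol: "measure lborel (ball (0::'a) R) \<le> measure lborel (ball (0::'a) \<rho>) / 2"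
    using R \<rho> by (simp add: content_ball)
  define c where "c = (1/4) powr (p - 1) / \<rho> powr (real DIM('a) + s * p) * (measure lborel (ball (0::'a) \<rho>) / 2)"
  have c: "0 < c" using \<rho> by (simp add: c_def content_ball_pos)
  show ?thesis
  proof (rule that[of "1 / c"])
    fix lam u x1 assume u: "sol lam u" "0 \<le> lam" and M: "0 < u x1" "\<And>y. u y \<le> u x1"
    have "{y. u x1 / 2 < u y} \<subseteq> ball 0 R" using sol_eq_0[OF u(1)] M(1) R(2) by force
    then have "emeasure lborel {y. u x1 / 2 < u y} \<le> emeasure lborel (ball (0::'a) R)" by (intro emeasure_mono) auto
    also have "\<dots> = ennreal (measure lborel (ball (0::'a) R))" using R by (simp add: emeasure_ball content_ball)
    also have "\<dots> \<le> ennreal (measure lborel (ball (0::'a) \<rho>) / 2)" using vol by (rule ennreal_leI)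
    finally have "(u x1 / 4) powr (p - 1) / \<rho> powr (real DIM('a) + s * p) * (measure lborel (ball (0::'a) \<rho>) / 2) \<le> lam * u x1 powr q"
      by (rule sup_estimate[OF u M \<rho>])
    moreover have "(u x1 / 4) powr (p - 1) = u x1 powr (p - 1) * (1/4) powr (p - 1)"
      using M powr_mult[of "u x1" "1/4" "p - 1"] by simp
    ultimately have "u x1 powr (p - 1) * c \<le> lam * u x1 powr q" by (simp add: c_def mult_ac)
    then show "u x1 powr (p - 1) \<le> 1 / c * lam * u x1 powr q" using c by (simp add: field_simps)
  qed (use c in simp)
qed

text \<open>For \<open>q = p - 1\<close> the powers of the maximum cancel in the sup estimate,
  leaving a constant over \<open>\<rho> powr (s * p)\<close> bounded by \<open>lam\<close>. A radius
  determined by \<open>\<Lambda>\<close> violates this, so the superlevel set cannot be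
  small.\<close>

lemma superlevel_large:
  assumes q: "q = p - 1" and \<Lambda>: "0 \<le> \<Lambda>"
  obtains \<delta> where "0 < \<delta>" "\<And>lam u x1. \<lbrakk>sol lam u; 0 \<le> lam; lam \<le> \<Lambda>; 0 < u x1; \<And>y. u y \<le> u x1\<rbrakk>
    \<Longrightarrow> ennreal \<delta> \<le> emeasure lborel {y. u x1 / 2 < u y}"
proof -
  define c where "c = (1/4) powr (p - 1) * (unit_ball_vol (real DIM('a)) / 2)"
  have c: "0 < c" by (simp add: c_def)
  \<comment> \<open>Chosen so that the constant in the sup estimate equals
    \<open>\<Lambda> + 1\<close>, which exceeds every admissible \<open>lam\<close>.\<close>
  define \<rho> where "\<rho> = (c / (\<Lambda> + 1)) powr (1 / (s * p))"
  have \<rho>: "0 < \<rho>" using c \<Lambda> by (simp add: \<rho>_def)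
  have \<rho>_sp: "\<rho> powr (s * p) = c / (\<Lambda> + 1)" using s_pos p_gt_1 c \<Lambda> by (simp add: \<rho>_def powr_powr)
  let ?v = "measure lborel (ball (0::'a) \<rho>) / 2"
  have v: "?v = unit_ball_vol (real DIM('a)) / 2 * \<rho> powr real DIM('a)"
    using \<rho> by (simp add: content_ball powr_realpow)
  have big: "(1/4) powr (p - 1) / \<rho> powr (real DIM('a) + s * p) * ?v = \<Lambda> + 1"
  proof -
    have "(1/4) powr (p - 1) / \<rho> powr (real DIM('a) + s * p) * ?v = c / \<rho> powr (s * p)"
      unfolding v powr_add c_def using \<rho> by simp
    also have "\<dots> = \<Lambda> + 1" unfolding \<rho>_sp using c \<Lambda> by simp
    finally show ?thesis .
  qed
  show ?thesis
  proof (rule that[of ?v])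
    show "0 < ?v" using \<rho> by (simp add: content_ball_pos)
    fix lam u x1 assume u: "sol lam u" "0 \<le> lam" and lam: "lam \<le> \<Lambda>" and M: "0 < u x1" "\<And>y. u y \<le> u x1"
    show "ennreal ?v \<le> emeasure lborel {y. u x1 / 2 < u y}"
    proof (rule ccontr)
      assume "\<not> ?thesis"
      then have "emeasure lborel {y. u x1 / 2 < u y} \<le> ennreal ?v" by simp
      then have "(u x1 / 4) powr (p - 1) / \<rho> powr (real DIM('a) + s * p) * ?v \<le> lam * u x1 powr q"
        by (rule sup_estimate[OF u M \<rho>])
      moreover have "(u x1 / 4) powr (p - 1) = u x1 powr (p - 1) * (1/4) powr (p - 1)"
        using M powr_mult[of "u x1" "1/4" "p - 1"] by simp
      ultimately have "u x1 powr (p - 1) * ((1/4) powr (p - 1) / \<rho> powr (real DIM('a) + s * p) * ?v) \<le> lam * u x1 powr q"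
        by (simp add: mult_ac)
      then have "u x1 powr (p - 1) * (\<Lambda> + 1) \<le> u x1 powr (p - 1) * lam" unfolding big q by (simp add: mult_ac)
      moreover have "0 < u x1 powr (p - 1)" using M by simp
      ultimately show False using lam by simp
    qed
  qed
qed

section \<open>Growth where the absorption vanishes\<close>

text \<open>A solution shrunk into a ball inside \<open>U\<close> takes the place of a smooth
  cut-off function.\<close>

lemma bump_exists:
  assumes v: "sol lam v" and U: "open U" "U \<subseteq> \<Omega>" "U \<noteq> {}"
  obtains w x0 N where "w \<in> W0 s p U" "continuous_on UNIV w" "\<And>x. 0 \<le> w x" "\<And>x. w x \<le> N"
    "\<And>x. x \<notin> U \<Longrightarrow> w x = 0" "0 < w x0"
proof -
  obtain x1 where x1: "x1 \<in> closure \<Omega>" "0 < v x1" "\<And>y. v y \<le> v x1" using sol_attains_max[OF v] by blast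
  obtain x0 e where e: "0 < e" "ball x0 e \<subseteq> U" using U openE by (metis ex_in_conv)
  define c where "c = 2 * diam / e"
  have c: "0 < c" using diam_pos e by (simp add: c_def)
  define w where "w x = v (x1 - c *\<^sub>R x0 + c *\<^sub>R x)" for x
  have out: "w x = 0" if "x \<notin> U" for x
  proof (rule ccontr)
    assume "w x \<noteq> 0"
    then have "x1 - c *\<^sub>R x0 + c *\<^sub>R x \<in> closure \<Omega>" using sol_eq_0[OF v] by (auto simp: w_def)
    then have "norm (x1 - (x1 - c *\<^sub>R x0 + c *\<^sub>R x)) \<le> diam" using x1(1) by (intro norm_diff_le_diam)
    also have "x1 - (x1 - c *\<^sub>R x0 + c *\<^sub>R x) = c *\<^sub>R (x0 - x)" by (simp add: algebra_simps)
    finally have "c * dist x0 x \<le> diam" using c by (simp add: dist_norm)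
    moreover have "diam < c * e" using diam_pos e by (simp add: c_def)
    ultimately have "c * dist x0 x < c * e" by simp
    then have "x \<in> ball x0 e" using c by simp
    then show False using e that by blast
  qed
  show ?thesis
  proof (rule that[of w "v x1" x0])
    show "w \<in> W0 s p U" unfolding w_def
      by (rule W0_affine[OF sol_W0[OF v] c]) (use out in \<open>auto simp: w_def\<close>)
    show "continuous_on UNIV w"
      unfolding w_def by (intro continuous_on_compose2[OF sol_continuous[OF v]] continuous_intros) auto
  qed (use x1 sol_nonneg[OF v] out in \<open>auto simp: w_def\<close>)
qed

lemma Lp_norm_pow_eq_integral:
  assumes "w \<in> W0 s p U" "\<And>x. 0 \<le> w x"
  shows "Lp_norm_pow p w = ennreal (\<integral>x. w x powr p \<partial>lborel)" "integrable lborel (\<lambda>x. w x powr p)"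
proof -
  note [measurable] = W0_D(1)[OF assms(1)]
  have eq: "Lp_norm_pow p w = (\<integral>\<^sup>+x. ennreal (w x powr p) \<partial>lborel)"
    unfolding Lp_norm_pow_def using assms(2) by simp
  show *: "integrable lborel (\<lambda>x. w x powr p)"
    by (rule integrableI_bounded) (use W0_D(2)[OF assms(1)] in \<open>simp_all add: eq\<close>)
  show "Lp_norm_pow p w = ennreal (\<integral>x. w x powr p \<partial>lborel)"
    unfolding eq using * by (intro nn_integral_eq_integral) auto
qed

lemma W0_mono:
  assumes "w \<in> W0 s p U" "U \<subseteq> V" shows "w \<in> W0 s p V"
  using assms by (auto simp: W0_def elim!: eventually_mono)

text \<open>Since \<open>b = 0\<close> on the support of the bump, Picone bounds \<open>lam\<close>
  times the integral of \<open>u powr (q - (p - 1)) * w powr p\<close> by the energy of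
  \<open>w\<close>. The exponent of \<open>u\<close> is negative, so small values of
  \<open>u\<close> are expensive: for large \<open>lam\<close> they occupy at most half of
  \<open>W\<close>.\<close>

lemma sol_blowup_sublinear:
  assumes q: "q < p - 1" and v: "sol lam' v"
    and U: "open U" "U \<subseteq> \<Omega>" "U \<noteq> {}" "\<And>x. x \<in> U \<Longrightarrow> b x = 0"
  obtains \<delta> where "0 < \<delta>" "\<And>N. 0 < N \<Longrightarrow> \<exists>\<Lambda>>0. \<forall>lam u. \<Lambda> \<le> lam \<longrightarrow> sol lam u \<longrightarrow> ennreal \<delta> \<le> emeasure lborel {y. N < u y}"
proof -
  obtain w x0 Nw where w: "w \<in> W0 s p U" "continuous_on UNIV w" "\<And>x. 0 \<le> w x" "\<And>x. w x \<le> Nw"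
    "\<And>x. x \<notin> U \<Longrightarrow> w x = 0" "0 < w x0" using bump_exists[OF v U(1-3)] by metis
  define h where "h = w x0 / 2"
  have h: "0 < h" using w by (simp add: h_def)
  define W where "W = {x. h < w x}"
  have W_open: "open W" unfolding W_def using w(2) by (intro open_Collect_less continuous_on_const) auto
  have "x0 \<in> W" using w(6) by (simp add: W_def h_def)
  then have "\<not> negligible W" using W_open by (intro open_not_negligible) auto
  then have "emeasure lborel W \<noteq> 0"
    using W_open null_sets_completionI[of W lborel] by (auto simp: negligible_iff_null_sets null_sets_def)
  have W_sub: "W \<subseteq> U" using w(5) h by (force simp: W_def)
  have W_fin: "emeasure lborel W < \<infinity>"
    using emeasure_bounded_finite[of W] bounded_subset[OF bounded_\<Omega>] W_sub U(2) by blast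
  \<comment> \<open>One half of \<open>W\<close> may be lost to small values of
    \<open>u\<close>.\<close>
  define \<delta> where "\<delta> = measure lborel W / 2"
  have W_eq: "emeasure lborel W = ennreal (2 * \<delta>)"
    using W_fin by (simp add: \<delta>_def emeasure_eq_ennreal_measure)
  have \<delta>: "0 < \<delta>" using W_eq \<open>emeasure lborel W \<noteq> 0\<close> by (cases "0 < \<delta>") (auto simp: ennreal_neg)
  define G where "G = enn2real (gagliardo s p w)"
  have G: "0 \<le> G" by (simp add: G_def)
  show ?thesis
  proof (rule that[OF \<delta>])
    fix N :: real assume N: "0 < N"
    \<comment> \<open>Lower bound of the Picone integrand, up to the factor \<open>lam\<close>,
      where \<open>u \<le> N\<close> and \<open>w > h\<close>.\<close>
    define c where "c = N powr (q - (p - 1)) * h powr p"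
    have c: "0 < c" using N h by (simp add: c_def)
    \<comment> \<open>Makes \<open>\<Lambda> * c * \<delta> = G + 1\<close>, strictly above the
      energy of the bump.\<close>
    define \<Lambda> where "\<Lambda> = (G + 1) / (c * \<delta>)"
    have \<Lambda>: "0 < \<Lambda>" using G c \<delta> by (simp add: \<Lambda>_def)
    show "\<exists>\<Lambda>>0. \<forall>lam u. \<Lambda> \<le> lam \<longrightarrow> sol lam u \<longrightarrow> ennreal \<delta> \<le> emeasure lborel {y. N < u y}"
    proof (intro exI[of _ \<Lambda>] conjI \<Lambda> allI impI)
      fix lam u assume lam: "\<Lambda> \<le> lam" and u: "sol lam u"
      note [measurable] = sol_measurable[OF u]
      have W_sets [measurable]: "W \<in> sets lborel" using borel_open[OF W_open] by simp
      obtain x1 where x1: "0 < u x1" "\<And>y. u y \<le> u x1" using sol_attains_max[OF u] by blast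
      let ?S = "W \<inter> {y. u y \<le> N}"
      have S: "?S \<in> sets lborel" by measurable
      have b0: "indicator \<Omega> x * (b x * u x powr (r - (p - 1)) * w x powr p) = 0" for x
        using U(4)[of x] w(5)[of x] by (cases "x \<in> U") auto
      have "ennreal (lam * c) * emeasure lborel ?S = (\<integral>\<^sup>+x. ennreal (lam * c) * indicator ?S x \<partial>lborel)"
        using S by (simp add: nn_integral_cmult_indicator)
      also have "\<dots> \<le> (\<integral>\<^sup>+x. ennreal (indicator \<Omega> x * (lam * u x powr (q - (p - 1)) * w x powr p)) \<partial>lborel)"
      proof (rule nn_integral_mono_AE)
        show "AE x in lborel. ennreal (lam * c) * indicator ?S x \<le> ennreal (indicator \<Omega> x * (lam * u x powr (q - (p - 1)) * w x powr p))"
          using sol_AE_pos[OF u]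
        proof eventually_elim
          fix x assume pos: "x \<in> \<Omega> \<longrightarrow> 0 < u x"
          show "ennreal (lam * c) * indicator ?S x \<le> ennreal (indicator \<Omega> x * (lam * u x powr (q - (p - 1)) * w x powr p))"
          proof (cases "x \<in> ?S")
            case True
            then have x: "x \<in> \<Omega>" "h < w x" "u x \<le> N" using W_sub U(2) by (auto simp: W_def)
            then have "N powr (q - (p - 1)) \<le> u x powr (q - (p - 1))" using pos q by (intro powr_mono2') auto
            moreover have "h powr p \<le> w x powr p" using x h p_gt_1 by (intro powr_mono2) auto
            ultimately have "lam * c \<le> lam * (u x powr (q - (p - 1)) * w x powr p)"
              unfolding c_def using lam \<Lambda> by (intro mult_left_mono mult_mono) auto
            then show ?thesis using True x by (simp add: ennreal_leI mult.assoc)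
          qed simp
        qed
      qed
      \<comment> \<open>With \<open>E = {}\<close> and \<open>m = 0\<close> the gain term drops
        out.\<close>
      also have "\<dots> \<le> ennreal (G + (\<integral>x. indicator \<Omega> x * (b x * u x powr (r - (p - 1)) * w x powr p) \<partial>lborel)
         - (1 - (1 - 0 / u x1) powr (p - 1)) / diam powr (real DIM('a) + s * p) * 0 * (\<integral>x. w x powr p \<partial>lborel))"
        unfolding G_def
        by (rule sol_picone[OF u _ x1 W0_mono[OF w(1) U(2)] w(3,4), of "{}"])
           (use lam \<Lambda> x1 w(5) U(2) closure_subset[of \<Omega>] in auto)
      also have "\<dots> = ennreal G" unfolding b0 by simp
      finally have 1: "ennreal (lam * c) * emeasure lborel ?S \<le> ennreal G" .
      have "emeasure lborel ?S \<le> emeasure lborel W" by (intro emeasure_mono W_sets) auto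
      then obtain m where m: "emeasure lborel ?S = ennreal m" "0 \<le> m"
        using W_fin by (cases "emeasure lborel ?S") (auto simp: top_unique)
      have "lam * c * m \<le> G" using 1 lam \<Lambda> c G m by (simp flip: ennreal_mult)
      moreover have "G < \<Lambda> * c * \<delta>" using c \<delta> by (simp add: \<Lambda>_def)
      moreover have "\<Lambda> * c * \<delta> \<le> lam * c * \<delta>" using lam c \<delta> by (intro mult_right_mono) auto
      ultimately have "lam * c * m < lam * c * \<delta>" by linarith
      then have "m \<le> \<delta>" using lam \<Lambda> c by (simp add: mult_less_cancel_left)
      have "ennreal \<delta> + ennreal \<delta> = emeasure lborel W" using \<delta> by (simp add: W_eq flip: ennreal_plus)
      also have "\<dots> \<le> emeasure lborel (?S \<union> {y. N < u y})" by (intro emeasure_mono) auto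
      also have "\<dots> \<le> emeasure lborel ?S + emeasure lborel {y. N < u y}" by (intro emeasure_subadditive) auto
      also have "\<dots> \<le> ennreal \<delta> + emeasure lborel {y. N < u y}"
        unfolding m(1) using \<open>m \<le> \<delta>\<close> by (intro add_right_mono ennreal_leI)
      finally show "ennreal \<delta> \<le> emeasure lborel {y. N < u y}"
        using ennreal_add_left_cancel_le[of "ennreal \<delta>"] by simp
    qed
  qed
qed

section \<open>Energy relations in the homogeneous case \<open>q = p - 1\<close>\<close>

text \<open>Here the source integrand is \<open>lam * w powr p\<close>, so the gain can be moved to
  the left, where it acts as an increase of \<open>lam\<close>.\<close>

lemma sol_picone_linear:
  assumes q: "q = p - 1" and u: "sol lam u" "0 < lam" and M: "0 < M" "\<And>y. u y \<le> M"
    and w: "w \<in> W0 s p \<Omega>" "\<And>x. 0 \<le> w x" "\<And>x. w x \<le> N" "\<And>x. x \<notin> closure \<Omega> \<Longrightarrow> w x = 0"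
      "0 < (\<integral>x. w x powr p \<partial>lborel)"
    and E: "E \<in> sets lborel" "E \<subseteq> \<Omega>" "\<And>y. y \<in> E \<Longrightarrow> w y = 0" "\<And>y. y \<in> E \<Longrightarrow> \<kappa> \<le> u y"
      "0 \<le> \<kappa>" "\<kappa> \<le> M" "0 \<le> m" "ennreal m \<le> emeasure lborel E"
  shows "(lam + (1 - (1 - \<kappa> / M) powr (p - 1)) / diam powr (real DIM('a) + s * p) * m) * (\<integral>x. w x powr p \<partial>lborel)
     \<le> enn2real (gagliardo s p w) + (\<integral>x. indicator \<Omega> x * (b x * u x powr (r - (p - 1)) * w x powr p) \<partial>lborel)"
    (is "(lam + ?g) * ?I \<le> ?R")
proof -
  note [measurable] = W0_D(1)[OF w(1)]
  have "ennreal (lam * ?I) = ennreal lam * (\<integral>\<^sup>+x. ennreal (w x powr p) \<partial>lborel)"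
    using Lp_norm_pow_eq_integral(2)[OF w(1,2)] u(2) by (simp add: nn_integral_eq_integral ennreal_mult)
  also have "\<dots> = (\<integral>\<^sup>+x. ennreal (lam * w x powr p) \<partial>lborel)"
    using u(2) by (simp add: nn_integral_cmult ennreal_mult)
  \<comment> \<open>As \<open>0 powr 0 = 0\<close>, the factor \<open>u x powr 0\<close> equals 1
    only where \<open>u\<close> is positive, hence the almost everywhere argument.\<close>
  also have "\<dots> = (\<integral>\<^sup>+x. ennreal (indicator \<Omega> x * (lam * u x powr (q - (p - 1)) * w x powr p)) \<partial>lborel)"
  proof (rule nn_integral_cong_AE)
    show "AE x in lborel. ennreal (lam * w x powr p) = ennreal (indicator \<Omega> x * (lam * u x powr (q - (p - 1)) * w x powr p))"
      using sol_AE_pos[OF u(1)] W0_D(4)[OF w(1)] by eventually_elim (auto simp: q indicator_def)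
  qed
  also have "\<dots> \<le> ennreal (?R - ?g * ?I)"
    by (rule sol_picone[OF u(1) _ M w(1-4) E]) (use u in auto)
  finally have "ennreal (lam * ?I) \<le> ennreal (?R - ?g * ?I)" .
  moreover have "0 < lam * ?I" using u w(5) by simp
  ultimately have "lam * ?I \<le> ?R - ?g * ?I" by (rule le_of_ennreal_le)
  then show ?thesis by (simp only: distrib_right) 
qed

lemma sol_energy:
  assumes u: "sol lam u"
  shows "enn2real (gagliardo s p u) + (\<integral>x. indicator \<Omega> x * (b x * u x powr (r + 1)) \<partial>lborel)
    = lam * (\<integral>x. indicator \<Omega> x * u x powr (q + 1) \<partial>lborel)"
    and "integrable lborel (\<lambda>x. indicator \<Omega> x * (b x * u x powr (r + 1)))"
proof -
  note [measurable] = sol_measurable[OF u]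
  have u0: "0 \<le> u x" for x by (rule sol_nonneg[OF u])
  obtain x1 where x1: "0 < u x1" "\<And>y. u y \<le> u x1" using sol_attains_max[OF u] by blast
  have b_int: "integrable lborel (\<lambda>x. indicator \<Omega> x * (b x * u x powr (r + 1)))"
  proof (rule integrable_cutoff)
    show "AE x in lborel. x \<in> \<Omega> \<longrightarrow> \<bar>b x * u x powr (r + 1)\<bar> \<le> B * u x1 powr (r + 1)"
      using b_le
    proof eventually_elim
      fix x assume bx: "x \<in> \<Omega> \<longrightarrow> b x \<le> B"
      have "u x powr (r + 1) \<le> u x1 powr (r + 1)" using u0 x1 r_pos by (intro powr_mono2) auto
      then show "x \<in> \<Omega> \<longrightarrow> \<bar>b x * u x powr (r + 1)\<bar> \<le> B * u x1 powr (r + 1)"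
        using bx b_nonneg[of x] B_nonneg by (auto simp: abs_mult intro!: mult_mono)
    qed
  qed measurable
  then show "integrable lborel (\<lambda>x. indicator \<Omega> x * (b x * u x powr (r + 1)))" .
  have q_int: "integrable lborel (\<lambda>x. indicator \<Omega> x * u x powr (q + 1))"
    by (rule integrable_cutoff[of _ "u x1 powr (q + 1)"]) (use u0 x1 q_pos in \<open>auto intro!: powr_mono2\<close>)
  have "frac_pLap_integrand s p u u = (\<lambda>z. \<bar>u (fst z) - u (snd z)\<bar> powr p * gk s p z)"
    by (intro ext) (simp only: frac_pLap_integrand_eq jp_mult_self)
  then have "frac_pLap_pair s p u u = enn2real (gagliardo s p u)"
    unfolding frac_pLap_pair_def gagliardo_eq by (simp add: integral_eq_nn_integral)
  moreover have "frac_pLap_pair s p u u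
      = (\<integral>x. lam * (indicator \<Omega> x * u x powr (q + 1)) - indicator \<Omega> x * (b x * u x powr (r + 1)) \<partial>lborel)"
    unfolding sol_test(3)[OF u sol_W0[OF u]]
  proof (rule Bochner_Integration.integral_cong[OF refl])
    fix x
    have "u x powr q * u x = u x powr (q + 1)" "u x powr r * u x = u x powr (r + 1)"
      using u0[of x] by (cases "u x = 0"; simp add: powr_add)+
    then show "indicator \<Omega> x * ((lam * u x powr q - b x * u x powr r) * u x)
       = lam * (indicator \<Omega> x * u x powr (q + 1)) - indicator \<Omega> x * (b x * u x powr (r + 1))"
      by (simp add: algebra_simps)
  qed
  ultimately show "enn2real (gagliardo s p u) + (\<integral>x. indicator \<Omega> x * (b x * u x powr (r + 1)) \<partial>lborel)
    = lam * (\<integral>x. indicator \<Omega> x * u x powr (q + 1) \<partial>lborel)"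
    using q_int b_int by (simp add: Bochner_Integration.integral_diff)
qed

lemma sol_Lp_integral:
  assumes q: "q = p - 1" and u: "sol lam u"
  shows "(\<integral>x. indicator \<Omega> x * u x powr (q + 1) \<partial>lborel) = (\<integral>x. u x powr p \<partial>lborel)"
    and "0 < (\<integral>x. u x powr p \<partial>lborel)" "enn2real (Lp_norm_pow p u) = (\<integral>x. u x powr p \<partial>lborel)"
proof -
  note [measurable] = sol_measurable[OF u]
  have u0: "0 \<le> u x" for x by (rule sol_nonneg[OF u])
  show "(\<integral>x. indicator \<Omega> x * u x powr (q + 1) \<partial>lborel) = (\<integral>x. u x powr p \<partial>lborel)"
    by (rule integral_cong_AE) (use W0_D(4)[OF sol_W0[OF u]] in \<open>auto simp: q indicator_def elim!: eventually_mono\<close>)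
  obtain x1 where x1: "0 < u x1" using sol_attains_max[OF u] by blast
  have "continuous_on UNIV (\<lambda>x. u x powr p)"
    using u0 p_gt_1 by (intro continuous_on_powr' sol_continuous[OF u] continuous_on_const) auto
  then show "0 < (\<integral>x. u x powr p \<partial>lborel)"
    using Lp_norm_pow_eq_integral(2)[OF sol_W0[OF u] u0] x1 by (intro integral_pos_continuous[of _ x1]) auto
  show "enn2real (Lp_norm_pow p u) = (\<integral>x. u x powr p \<partial>lborel)"
    unfolding Lp_norm_pow_eq_integral(1)[OF sol_W0[OF u] u0] by (simp add: integral_nonneg_AE)
qed

lemma sol_lambda1_nonneg:
  assumes "q = p - 1" "sol lam u" shows "0 \<le> lambda1 s p \<Omega>"
proof (rule lambda1_nonneg[OF sol_W0[OF assms(2)]])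
  show "Lp_norm_pow p u \<noteq> 0" using sol_Lp_integral(2,3)[OF assms] by auto
qed

text \<open>Testing the equation of a second solution with the Picone quotient bounds the mass of
  \<open>u\<close>; testing the equation of \<open>u\<close> with \<open>u\<close> then makes the absorption term small.\<close>

lemma sol_absorption_le:
  assumes q: "q = p - 1" and v: "sol lam' v" and u: "sol lam u" and lam: "lambda1 s p \<Omega> < lam" "lam < lam'"
    and V: "\<And>y. v y \<le> V"
  shows "(lam' - lam) * (\<integral>x. indicator \<Omega> x * (b x * u x powr (r + 1)) \<partial>lborel)
    \<le> (lam - lambda1 s p \<Omega>) * (B * V powr (r + 1) * measure lborel \<Omega>)"
proof -
  note [measurable] = sol_measurable[OF u] sol_measurable[OF v]
  have u0: "0 \<le> u x" for x by (rule sol_nonneg[OF u])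
  have v0: "0 \<le> v x" for x by (rule sol_nonneg[OF v])
  have lam0: "0 < lam" "0 < lam'" using sol_lambda1_nonneg[OF q u] lam by auto
  obtain x1 where x1: "0 < u x1" "\<And>y. u y \<le> u x1" using sol_attains_max[OF u] by blast
  obtain x2 where x2: "0 < v x2" "\<And>y. v y \<le> v x2" using sol_attains_max[OF v] by blast
  have V0: "0 < V" using x2(1) V[of x2] by linarith
  let ?I = "\<integral>x. u x powr p \<partial>lborel"
  let ?b = "\<integral>x. indicator \<Omega> x * (b x * u x powr (r + 1)) \<partial>lborel"
  let ?G = "enn2real (gagliardo s p u)"
  let ?h = "\<lambda>x. indicator \<Omega> x * (b x * v x powr (r - (p - 1)) * u x powr p)"
  have I: "0 < ?I" by (rule sol_Lp_integral(2)[OF q u])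
  have e: "?G + ?b = lam * ?I" using sol_energy(1)[OF u] sol_Lp_integral(1)[OF q u] by simp
  have "lambda1 s p \<Omega> * ?I \<le> ?G"
    using lambda1_mult_le[OF sol_W0[OF u]] sol_Lp_integral(2,3)[OF q u] by simp
  \<comment> \<open>Energy identity and Rayleigh quotient together: the absorption is at most the
    mass times the excess of \<open>lam\<close> over the eigenvalue.\<close>
  then have 1: "?b \<le> (lam - lambda1 s p \<Omega>) * ?I" using e by (simp add: left_diff_distrib)
  \<comment> \<open>The equation is that of \<open>v\<close>, and \<open>u\<close> plays the part of
    the Picone test function; \<open>E = {}\<close> removes the gain.\<close>
  have "(lam' + (1 - (1 - 0 / V) powr (p - 1)) / diam powr (real DIM('a) + s * p) * 0) * ?I \<le> ?G + (\<integral>x. ?h x \<partial>lborel)"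
    by (rule sol_picone_linear[OF q v lam0(2) V0 V sol_W0[OF u] u0 x1(2) sol_eq_0[OF u] I, of "{}"])
       (use V0 in auto)
  then have 2: "lam' * ?I \<le> ?G + (\<integral>x. ?h x \<partial>lborel)" by simp
  have \<Omega>_fin: "emeasure lborel \<Omega> < \<infinity>" using bounded_\<Omega> emeasure_bounded_finite by auto
  have "(\<integral>x. ?h x \<partial>lborel) \<le> (\<integral>x. indicator \<Omega> x * (b x * u x powr (r + 1)) + B * V powr (r + 1) * indicator \<Omega> x \<partial>lborel)"
  proof (rule integral_mono_AE)
    \<comment> \<open>Where \<open>u\<close> is at least \<open>V\<close> it dominates
      \<open>v\<close>; elsewhere both are at most \<open>V\<close>.\<close>
    have R: "AE x in lborel. x \<in> \<Omega> \<longrightarrow> b x * v x powr (r - (p - 1)) * u x powr p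
        \<le> b x * u x powr (r + 1) + B * V powr (r + 1)"
      using b_le
    proof eventually_elim
      fix x assume bx: "x \<in> \<Omega> \<longrightarrow> b x \<le> B"
      show "x \<in> \<Omega> \<longrightarrow> b x * v x powr (r - (p - 1)) * u x powr p \<le> b x * u x powr (r + 1) + B * V powr (r + 1)"
      proof
        assume x: "x \<in> \<Omega>"
        have add: "t powr (r - (p - 1)) * t powr p = t powr (r + 1)" if "0 < t" for t :: real
          using that by (simp add: powr_add[symmetric])
        show "b x * v x powr (r - (p - 1)) * u x powr p \<le> b x * u x powr (r + 1) + B * V powr (r + 1)"
        proof (cases "V \<le> u x")
          case True
          have "v x powr (r - (p - 1)) * u x powr p \<le> u x powr (r - (p - 1)) * u x powr p"
            using True V[of x] v0 r_gt by (intro mult_right_mono powr_mono2) auto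
          also have "\<dots> = u x powr (r + 1)" using True V0 by (intro add) simp
          finally have "b x * (v x powr (r - (p - 1)) * u x powr p) \<le> b x * u x powr (r + 1)"
            using b_nonneg[OF x] by (intro mult_left_mono)
          moreover have "0 \<le> B * V powr (r + 1)" using B_nonneg by simp
          ultimately show ?thesis by (simp add: mult.assoc)
        next
          case False
          have "v x powr (r - (p - 1)) * u x powr p \<le> V powr (r - (p - 1)) * V powr p"
            using False V[of x] v0 u0 r_gt p_gt_1 by (intro mult_mono powr_mono2) auto
          also have "\<dots> = V powr (r + 1)" by (rule add[OF V0])
          finally have "b x * (v x powr (r - (p - 1)) * u x powr p) \<le> B * V powr (r + 1)"
            using b_nonneg[OF x] bx x B_nonneg by (intro mult_mono) auto
          moreover have "0 \<le> b x * u x powr (r + 1)" using b_nonneg[OF x] by simp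
          ultimately show ?thesis by (simp add: mult.assoc)
        qed
      qed
    qed
    then show "AE x in lborel. ?h x \<le> indicator \<Omega> x * (b x * u x powr (r + 1)) + B * V powr (r + 1) * indicator \<Omega> x"
      by eventually_elim (auto simp: indicator_def)
    show "integrable lborel ?h"
    proof (rule integrable_cutoff)
      show "AE x in lborel. x \<in> \<Omega> \<longrightarrow> \<bar>b x * v x powr (r - (p - 1)) * u x powr p\<bar> \<le> B * u x1 powr (r + 1) + B * V powr (r + 1)"
        using R b_le
      proof eventually_elim
        fix x assume R: "x \<in> \<Omega> \<longrightarrow> b x * v x powr (r - (p - 1)) * u x powr p \<le> b x * u x powr (r + 1) + B * V powr (r + 1)"
          and bx: "x \<in> \<Omega> \<longrightarrow> b x \<le> B"
        show "x \<in> \<Omega> \<longrightarrow> \<bar>b x * v x powr (r - (p - 1)) * u x powr p\<bar> \<le> B * u x1 powr (r + 1) + B * V powr (r + 1)"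
        proof
          assume x: "x \<in> \<Omega>"
          have "b x * u x powr (r + 1) \<le> B * u x1 powr (r + 1)"
            using x bx b_nonneg[OF x] B_nonneg u0 x1 r_pos by (intro mult_mono powr_mono2) auto
          moreover have "0 \<le> b x * v x powr (r - (p - 1)) * u x powr p" using b_nonneg[OF x] by simp
          ultimately show "\<bar>b x * v x powr (r - (p - 1)) * u x powr p\<bar> \<le> B * u x1 powr (r + 1) + B * V powr (r + 1)"
            using R x by linarith
        qed
      qed
    qed measurable
    show "integrable lborel (\<lambda>x. indicator \<Omega> x * (b x * u x powr (r + 1)) + B * V powr (r + 1) * indicator \<Omega> x)"
      using sol_energy(2)[OF u] \<Omega>_fin by (intro Bochner_Integration.integrable_add integrable_mult_right integrable_real_indicator) auto
  qed
  also have "\<dots> = ?b + B * V powr (r + 1) * measure lborel \<Omega>"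
    using sol_energy(2)[OF u] \<Omega>_fin
    by (subst Bochner_Integration.integral_add) (auto intro!: integrable_mult_right integrable_real_indicator)
  \<comment> \<open>The energy identity turns \<open>?G + ?b\<close> into \<open>lam * ?I\<close>,
    which moves to the left; the mass \<open>?I\<close> stays bounded as long as \<open>lam\<close>
    keeps away from \<open>lam'\<close>.\<close>
  finally have 3: "(lam' - lam) * ?I \<le> B * V powr (r + 1) * measure lborel \<Omega>" using 2 e by (simp add: left_diff_distrib)
  have "(lam' - lam) * ?b \<le> (lam' - lam) * ((lam - lambda1 s p \<Omega>) * ?I)"
    using 1 lam by (intro mult_left_mono) auto
  also have "\<dots> = (lam - lambda1 s p \<Omega>) * ((lam' - lam) * ?I)" by simp
  also have "\<dots> \<le> (lam - lambda1 s p \<Omega>) * (B * V powr (r + 1) * measure lborel \<Omega>)"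
    using 3 lam by (intro mult_left_mono) auto
  finally show ?thesis .
qed

section \<open>Lower bounds on compact sets\<close>

text \<open>Expansion of positivity from a fixed level: \<open>\<kappa>\<close> is the largest value
  allowed by its two conditions.\<close>

lemma sol_uniform_lower_bound:
  assumes v: "sol lam' v" "0 \<le> lam'" and K: "compact K" "K \<subseteq> \<Omega>" and \<delta>: "0 < \<delta>" and L: "0 < L"
  obtains \<kappa> where "0 < \<kappa>" "\<And>lam u x. \<lbrakk>sol lam u; 0 \<le> lam; ennreal \<delta> \<le> emeasure lborel {y. L < u y}; x \<in> K\<rbrakk> \<Longrightarrow> \<kappa> \<le> u x"
proof -
  obtain \<theta> where \<theta>: "0 < \<theta>" "\<And>lam u L \<kappa> x. \<lbrakk>sol lam u; 0 \<le> lam; ennreal \<delta> \<le> emeasure lborel {y. L < u y}; 0 < L; 0 < \<kappa>;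
        \<kappa> \<le> \<theta> * L; \<kappa> powr r \<le> \<theta> * L powr (p - 1); x \<in> K\<rbrakk> \<Longrightarrow> \<kappa> \<le> u x"
    using positivity_expansion_compact[OF v K \<delta>] by blast
  define \<kappa> where "\<kappa> = min (\<theta> * L) ((\<theta> * L powr (p - 1)) powr (1 / r))"
  have "\<kappa> powr r \<le> ((\<theta> * L powr (p - 1)) powr (1 / r)) powr r"
    using \<theta> L r_pos by (intro powr_mono2) (auto simp: \<kappa>_def)
  also have "\<dots> = \<theta> * L powr (p - 1)" using \<theta> L r_pos by (simp add: powr_powr)
  finally have \<kappa>: "0 < \<kappa>" "\<kappa> \<le> \<theta> * L" "\<kappa> powr r \<le> \<theta> * L powr (p - 1)"
    using \<theta> L by (auto simp: \<kappa>_def)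
  show ?thesis by (rule that[OF \<kappa>(1)]) (use \<theta>(2) L \<kappa> in blast)
qed

text \<open>The same estimate read backwards: the target \<open>N\<close> is prescribed, and from
  \<open>L0\<close> on the level satisfies both conditions with \<open>\<kappa> = N\<close>.\<close>

lemma sol_large_lower_bound:
  assumes v: "sol lam' v" "0 \<le> lam'" and K: "compact K" "K \<subseteq> \<Omega>" and \<delta>: "0 < \<delta>" and N: "0 < N"
  obtains L0 where "0 < L0"
    "\<And>lam u x L. \<lbrakk>sol lam u; 0 \<le> lam; L0 \<le> L; ennreal \<delta> \<le> emeasure lborel {y. L < u y}; x \<in> K\<rbrakk> \<Longrightarrow> N \<le> u x"
proof -
  obtain \<theta> where \<theta>: "0 < \<theta>" "\<And>lam u L \<kappa> x. \<lbrakk>sol lam u; 0 \<le> lam; ennreal \<delta> \<le> emeasure lborel {y. L < u y}; 0 < L; 0 < \<kappa>;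
        \<kappa> \<le> \<theta> * L; \<kappa> powr r \<le> \<theta> * L powr (p - 1); x \<in> K\<rbrakk> \<Longrightarrow> \<kappa> \<le> u x"
    using positivity_expansion_compact[OF v K \<delta>] by blast
  define L0 where "L0 = max (N / \<theta>) ((N powr r / \<theta>) powr (1 / (p - 1)))"
  have L0: "0 < L0" using \<theta> N by (simp add: L0_def less_max_iff_disj)
  show ?thesis
  proof (rule that[OF L0])
    fix lam u x L assume *: "sol lam u" "0 \<le> lam" "L0 \<le> L" "ennreal \<delta> \<le> emeasure lborel {y. L < u y}" "x \<in> K"
    have "N / \<theta> \<le> L" using *(3) by (simp add: L0_def)
    then have 1: "N \<le> \<theta> * L" using \<theta> by (simp add: field_simps)
    have "N powr r / \<theta> = ((N powr r / \<theta>) powr (1 / (p - 1))) powr (p - 1)"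
      using \<theta> N p_gt_1 by (simp add: powr_powr)
    also have "\<dots> \<le> L powr (p - 1)" using *(3) p_gt_1 by (intro powr_mono2) (auto simp: L0_def)
    finally have 2: "N powr r \<le> \<theta> * L powr (p - 1)" using \<theta> by (simp add: field_simps)
    show "N \<le> u x" by (rule \<theta>(2)[OF *(1,2,4) _ N 1 2 *(5)]) (use L0 * in simp)
  qed
qed

text \<open>Argument by contradiction. If the maximum were below \<open>T\<close>, the ratio of
  \<open>u\<close> to its maximum would be at least \<open>\<xi> / 2\<close> on \<open>K\<close>,
  with \<open>\<xi>\<close> independent of \<open>lam\<close>. Functions supported in
  \<open>U\<close> vanish on \<open>K\<close> and do not see \<open>b\<close>, so Picone with the
  gain would give \<open>lambda1 s p U \<ge> lam + d\<close>.\<close>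

lemma sol_max_blowup_linear:
  assumes q: "q = p - 1" and v: "sol lam' v" "0 \<le> lam'"
    and U: "open U" "U \<subseteq> \<Omega>" "U \<noteq> {}" "\<And>x. x \<in> U \<Longrightarrow> b x = 0"
    and K: "compact K" "K \<subseteq> \<Omega>" "K \<inter> U = {}" "0 < measure lborel K" and T: "0 < T"
  obtains d where "0 < d" "\<And>lam u x1. \<lbrakk>sol lam u; 0 < lam; lambda1 s p U - d < lam; lam \<le> lambda1 s p U;
    0 < u x1; \<And>y. u y \<le> u x1\<rbrakk> \<Longrightarrow> T \<le> u x1"
proof -
  obtain w x0 Nw where w: "w \<in> W0 s p U" "continuous_on UNIV w" "\<And>x. 0 \<le> w x" "\<And>x. w x \<le> Nw"
    "\<And>x. x \<notin> U \<Longrightarrow> w x = 0" "0 < w x0" using bump_exists[OF v(1) U(1-3)] by metis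
  have Lp_ne: "Lp_norm_pow p w \<noteq> 0"
  proof -
    have "0 < (\<integral>x. w x powr p \<partial>lborel)"
      using Lp_norm_pow_eq_integral(2)[OF w(1,3)] w p_gt_1
      by (intro integral_pos_continuous[of _ x0] continuous_on_powr' continuous_on_const) auto
    then show ?thesis using Lp_norm_pow_eq_integral(1)[OF w(1,3)] by auto
  qed
  define \<Lambda> where "\<Lambda> = lambda1 s p U"
  have \<Lambda>: "0 \<le> \<Lambda>" unfolding \<Lambda>_def by (rule lambda1_nonneg[OF w(1) Lp_ne])
  obtain \<delta> where \<delta>: "0 < \<delta>" "\<And>lam u x1. \<lbrakk>sol lam u; 0 \<le> lam; lam \<le> \<Lambda>; 0 < u x1; \<And>y. u y \<le> u x1\<rbrakk>
      \<Longrightarrow> ennreal \<delta> \<le> emeasure lborel {y. u x1 / 2 < u y}" using superlevel_large[OF q \<Lambda>] by blast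
  obtain \<theta> where \<theta>: "0 < \<theta>" "\<And>lam u L \<kappa> x. \<lbrakk>sol lam u; 0 \<le> lam; ennreal \<delta> \<le> emeasure lborel {y. L < u y}; 0 < L; 0 < \<kappa>;
        \<kappa> \<le> \<theta> * L; \<kappa> powr r \<le> \<theta> * L powr (p - 1); x \<in> K\<rbrakk> \<Longrightarrow> \<kappa> \<le> u x"
    using positivity_expansion_compact[OF v K(1,2) \<delta>(1)] by blast
  \<comment> \<open>The last entry ensures
    \<open>(\<xi> * L) powr r \<le> \<theta> * L powr (p - 1)\<close> for all levels
    \<open>L \<le> T\<close>; as \<open>p - 1 < r\<close>, the worst level is
    \<open>L = T\<close>.\<close>
  define \<xi> where "\<xi> = min 1 (min \<theta> ((\<theta> / T powr (r - (p - 1))) powr (1 / r)))"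
  have \<xi>: "0 < \<xi>" "\<xi> \<le> 1" "\<xi> \<le> \<theta>" using \<theta> T by (auto simp: \<xi>_def)
  have "\<xi> powr r \<le> ((\<theta> / T powr (r - (p - 1))) powr (1 / r)) powr r"
    using \<xi> r_pos by (intro powr_mono2) (auto simp: \<xi>_def)
  also have "\<dots> = \<theta> / T powr (r - (p - 1))" using \<theta> T r_pos by (simp add: powr_powr)
  finally have \<xi>_r: "\<xi> powr r * T powr (r - (p - 1)) \<le> \<theta>" using T by (simp add: field_simps)
  define m where "m = measure lborel K"
  \<comment> \<open>The Picone gain for the ratio \<open>\<xi> / 2\<close>, which arises from the
    lower bound \<open>\<xi> * L\<close> at the level \<open>L = u x1 / 2\<close>.\<close>
  define d where "d = (1 - (1 - \<xi> / 2) powr (p - 1)) / diam powr (real DIM('a) + s * p) * m"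
  have "(1 - \<xi> / 2) powr (p - 1) < 1 powr (p - 1)" using \<xi> p_gt_1 by (intro powr_less_mono2) auto
  then have d: "0 < d" using diam_pos K(4) by (simp add: d_def m_def)
  show ?thesis
  proof (rule that[OF d])
    fix lam u x1 assume u: "sol lam u" and lam: "0 < lam" "lambda1 s p U - d < lam" "lam \<le> lambda1 s p U"
      and x1: "0 < u x1" "\<And>y. u y \<le> u x1"
    show "T \<le> u x1"
    proof (rule ccontr)
      assume "\<not> T \<le> u x1"
      then have M: "u x1 < T" by simp
      define L where "L = u x1 / 2"
      have L: "0 < L" "L \<le> T" using x1 M by (auto simp: L_def)
      have "ennreal \<delta> \<le> emeasure lborel {y. L < u y}"
        unfolding L_def using \<delta>(2)[OF u _ _ x1] lam by (simp add: \<Lambda>_def)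
      moreover have "(\<xi> * L) powr r \<le> \<theta> * L powr (p - 1)"
      proof -
        have "(\<xi> * L) powr r = \<xi> powr r * L powr (r - (p - 1)) * L powr (p - 1)"
          using \<xi> L by (simp add: powr_mult mult.assoc powr_add[symmetric])
        also have "\<dots> \<le> \<xi> powr r * T powr (r - (p - 1)) * L powr (p - 1)"
          using L r_gt by (intro mult_right_mono mult_left_mono powr_mono2) auto
        also have "\<dots> \<le> \<theta> * L powr (p - 1)" using \<xi>_r by (intro mult_right_mono) auto
        finally show ?thesis .
      qed
      ultimately have low: "\<xi> * L \<le> u x" if "x \<in> K" for x
        using \<theta>(2)[OF u _ _ L(1), of "\<xi> * L" x] lam \<xi> L that by (simp add: mult_right_mono)
      \<comment> \<open>By \<open>lambda1_ge\<close>, only bounded nonnegative functions vanishing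
        off \<open>U\<close> have to be tested.\<close>
      have "lam + d \<le> lambda1 s p U"
      proof (rule lambda1_ge[OF _ p_gt_1])
        show "U \<in> sets lborel" using borel_open[OF U(1)] by simp
        show "\<exists>v\<in>W0 s p U. Lp_norm_pow p v \<noteq> 0" using w(1) Lp_ne by blast
        fix f N assume f: "f \<in> W0 s p U" "\<And>x. 0 \<le> f x" "\<And>x. f x \<le> N" "\<And>x. x \<notin> U \<Longrightarrow> f x = 0"
        show "ennreal (lam + d) * Lp_norm_pow p f \<le> gagliardo s p f"
        proof (cases "0 < (\<integral>x. f x powr p \<partial>lborel)")
          case True
          have b0: "indicator \<Omega> x * (b x * u x powr (r - (p - 1)) * f x powr p) = 0" for x
            using U(4)[of x] f(4)[of x] by (cases "x \<in> U") auto
          have "(lam + (1 - (1 - \<xi> * L / u x1) powr (p - 1)) / diam powr (real DIM('a) + s * p) * m) * (\<integral>x. f x powr p \<partial>lborel)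
             \<le> enn2real (gagliardo s p f) + (\<integral>x. indicator \<Omega> x * (b x * u x powr (r - (p - 1)) * f x powr p) \<partial>lborel)"
          proof (rule sol_picone_linear[OF q u lam(1) x1 W0_mono[OF f(1) U(2)] f(2,3) _ True, of K])
            show "f x = 0" if "x \<notin> closure \<Omega>" for x using f(4) U(2) closure_subset that by blast
            show "K \<in> sets lborel" using compact_imp_closed[OF K(1)] by (simp add: borel_closed)
            show "f y = 0" if "y \<in> K" for y using f(4) K(3) that by blast
            show "\<xi> * L \<le> u x1" using \<xi> L x1 mult_right_mono[of \<xi> 1 L] by (simp add: L_def)
            show "ennreal m \<le> emeasure lborel K"
              using emeasure_bounded_finite[OF compact_imp_bounded[OF K(1)]]
              by (simp add: m_def emeasure_eq_ennreal_measure)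
          qed (use K(2) low \<xi> L in \<open>auto simp: m_def\<close>)
          moreover have "\<xi> * L / u x1 = \<xi> / 2" using x1 by (simp add: L_def)
          ultimately have "(lam + d) * (\<integral>x. f x powr p \<partial>lborel) \<le> enn2real (gagliardo s p f)"
            unfolding b0 d_def by simp
          then have "ennreal ((lam + d) * (\<integral>x. f x powr p \<partial>lborel)) \<le> ennreal (enn2real (gagliardo s p f))"
            by (rule ennreal_leI)
          also have "\<dots> = gagliardo s p f" using W0_D(3)[OF f(1)] by simp
          finally show ?thesis
            unfolding Lp_norm_pow_eq_integral(1)[OF f(1,2)] using lam d True by (simp add: ennreal_mult)
        next
          case False
          then show ?thesis unfolding Lp_norm_pow_eq_integral(1)[OF f(1,2)] by (simp add: ennreal_neg)
        qed
      qed (use lam d in simp)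
      then show False using lam by simp
    qed
  qed
qed

section \<open>Limits at the ends of the existence range\<close>

lemma le_Inf_image:
  fixes f :: "'a \<Rightarrow> real"
  assumes "K \<noteq> {}" "\<And>x. x \<in> K \<Longrightarrow> Z \<le> f x" shows "Z \<le> Inf (f ` K)"
  using assms by (intro cInf_greatest) auto

section \<open>Blow-up at the upper end of the range\<close>

lemma min_blowup_sublinear:
  assumes q: "q < p - 1" and u: "\<And>lam. 0 < lam \<Longrightarrow> sol lam (u lam)"
    and U: "open U" "U \<subseteq> \<Omega>" "U \<noteq> {}" "\<And>x. x \<in> U \<Longrightarrow> b x = 0"
    and K: "compact K" "K \<noteq> {}" "K \<subseteq> \<Omega>"
  shows "filterlim (\<lambda>lam. Inf (u lam ` K)) at_top at_top"
  unfolding filterlim_at_top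
proof
  fix Z :: real
  have v: "sol 1 (u 1)" "0 \<le> (1::real)" using u by auto
  obtain \<delta> where \<delta>: "0 < \<delta>" "\<And>N. 0 < N \<Longrightarrow> \<exists>\<Lambda>>0. \<forall>lam u. \<Lambda> \<le> lam \<longrightarrow> sol lam u \<longrightarrow> ennreal \<delta> \<le> emeasure lborel {y. N < u y}"
    using sol_blowup_sublinear[OF q v(1) U] by blast
  \<comment> \<open>The lower bound lemma needs a positive target, while \<open>Z\<close> may be any
    real number.\<close>
  have "0 < max 1 Z" by simp
  then obtain L0 where L0: "0 < L0" "\<And>lam u x L. \<lbrakk>sol lam u; 0 \<le> lam; L0 \<le> L; ennreal \<delta> \<le> emeasure lborel {y. L < u y}; x \<in> K\<rbrakk> \<Longrightarrow> max 1 Z \<le> u x"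
    using sol_large_lower_bound[OF v K(1,3) \<delta>(1)] by blast
  obtain \<Lambda> where \<Lambda>: "0 < \<Lambda>" "\<And>lam u. \<Lambda> \<le> lam \<Longrightarrow> sol lam u \<Longrightarrow> ennreal \<delta> \<le> emeasure lborel {y. L0 < u y}"
    using \<delta>(2)[OF L0(1)] by blast
  show "\<forall>\<^sub>F lam in at_top. Z \<le> Inf (u lam ` K)"
    using eventually_ge_at_top[of \<Lambda>]
  proof eventually_elim
    fix lam assume lam: "\<Lambda> \<le> lam"
    then have "0 < lam" using \<Lambda>(1) by linarith
    then show "Z \<le> Inf (u lam ` K)"
      using L0(2)[OF u _ order_refl \<Lambda>(2)[OF lam u]] by (intro le_Inf_image K(2)) force
  qed
qed

text \<open>Near \<open>lambda1 s p U\<close> the maximum is at least \<open>2 * L0\<close>. The set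
  where the solution exceeds half its maximum, a level of at least \<open>L0\<close>, has measure at
  least \<open>\<delta>\<close>, and expansion of positivity carries this to
  \<open>K\<close>.\<close>

lemma min_blowup_linear:
  assumes q: "q = p - 1" and u: "\<And>lam. lam \<in> {lambda1 s p \<Omega> <..< lambda1 s p U} \<Longrightarrow> sol lam (u lam)"
    and U: "open U" "U \<subseteq> \<Omega>" "U \<noteq> {}" "\<And>x. x \<in> U \<Longrightarrow> b x = 0"
    and K': "compact K'" "K' \<subseteq> \<Omega>" "K' \<inter> U = {}" "0 < measure lborel K'"
    and K: "compact K" "K \<noteq> {}" "K \<subseteq> \<Omega>"
  shows "filterlim (\<lambda>lam. Inf (u lam ` K)) at_top (at (lambda1 s p U) within {lambda1 s p \<Omega> <..< lambda1 s p U})"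
    (is "filterlim _ _ (at ?\<Lambda> within ?S)")
proof (cases "?S = {}")
  \<comment> \<open>On an empty interval the filter is trivial and the limit holds vacuously.
    Otherwise any one solution supplies the barrier profile.\<close>
  case False
  then obtain lam' where lam': "lam' \<in> ?S" by blast
  have v: "sol lam' (u lam')" by (rule u[OF lam'])
  have l1_nonneg: "0 \<le> lambda1 s p \<Omega>" by (rule sol_lambda1_nonneg[OF q v])
  have v0: "0 \<le> lam'" and \<Lambda>: "0 \<le> ?\<Lambda>" using l1_nonneg lam' by auto
  obtain \<delta> where \<delta>: "0 < \<delta>" "\<And>lam u x1. \<lbrakk>sol lam u; 0 \<le> lam; lam \<le> ?\<Lambda>; 0 < u x1; \<And>y. u y \<le> u x1\<rbrakk>
      \<Longrightarrow> ennreal \<delta> \<le> emeasure lborel {y. u x1 / 2 < u y}" using superlevel_large[OF q \<Lambda>] by blast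
  show ?thesis
    unfolding filterlim_at_top
  proof
    fix Z :: real
    have "0 < max 1 Z" by simp
    then obtain L0 where L0: "0 < L0" "\<And>lam u x L. \<lbrakk>sol lam u; 0 \<le> lam; L0 \<le> L; ennreal \<delta> \<le> emeasure lborel {y. L < u y}; x \<in> K\<rbrakk> \<Longrightarrow> max 1 Z \<le> u x"
      using sol_large_lower_bound[OF v v0 K(1,3) \<delta>(1)] by blast
    have "0 < 2 * L0" using L0 by simp
    then obtain d where d: "0 < d" "\<And>lam u x1. \<lbrakk>sol lam u; 0 < lam; ?\<Lambda> - d < lam; lam \<le> ?\<Lambda>;
        0 < u x1; \<And>y. u y \<le> u x1\<rbrakk> \<Longrightarrow> 2 * L0 \<le> u x1"
      using sol_max_blowup_linear[OF q v v0 U K'] by blast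
    show "\<forall>\<^sub>F lam in at ?\<Lambda> within ?S. Z \<le> Inf (u lam ` K)"
      unfolding eventually_at
    proof (intro exI[of _ d] conjI d(1) ballI impI)
      fix lam assume lam: "lam \<in> ?S" "lam \<noteq> ?\<Lambda> \<and> dist lam ?\<Lambda> < d"
      then have l: "0 < lam" "?\<Lambda> - d < lam" "lam \<le> ?\<Lambda>" using l1_nonneg by (auto simp: dist_real_def)
      obtain x1 where x1: "0 < u lam x1" "\<And>y. u lam y \<le> u lam x1" using sol_attains_max[OF u[OF lam(1)]] by blast
      have "L0 \<le> u lam x1 / 2" using d(2)[OF u[OF lam(1)] l x1] by simp
      moreover have "ennreal \<delta> \<le> emeasure lborel {y. u lam x1 / 2 < u lam y}"
        using \<delta>(2)[OF u[OF lam(1)] _ l(3) x1] l by simp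
      ultimately have "max 1 Z \<le> u lam x" if "x \<in> K" for x
        using L0(2)[OF u[OF lam(1)] less_imp_le[OF l(1)] _ _ that] by blast
      then show "Z \<le> Inf (u lam ` K)" by (intro le_Inf_image K(2)) force
    qed
  qed
qed (simp add: filterlim_at_top)

section \<open>Vanishing at the lower end of the range\<close>

text \<open>Solutions are nonnegative and attain their maximum, so it suffices to exclude a maximum
  of size at least \<open>e\<close>.\<close>

lemma sol_uniform_small:
  assumes "sol lam u" "\<And>x1. \<lbrakk>0 < u x1; \<And>y. u y \<le> u x1; e \<le> u x1\<rbrakk> \<Longrightarrow> False"
  shows "\<forall>x\<in>\<Omega>. dist (u x) 0 < e"
proof
  fix x assume "x \<in> \<Omega>"
  obtain x1 where x1: "0 < u x1" "\<And>y. u y \<le> u x1" using sol_attains_max[OF assms(1)] by blast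
  then have "u x1 < e" using assms(2) by force
  then show "dist (u x) 0 < e" using x1(2)[of x] sol_nonneg[OF assms(1), of x] by (simp add: dist_real_def)
qed

text \<open>The sup estimate bounds the maximum raised to the positive power
  \<open>p - 1 - q\<close> by \<open>C * lam\<close>.\<close>

lemma vanishing_sublinear:
  assumes q: "q < p - 1" and u: "\<And>lam. 0 < lam \<Longrightarrow> sol lam (u lam)"
  shows "uniform_limit \<Omega> u (\<lambda>x. 0) (at 0 within {0<..})"
  unfolding uniform_limit_iff
proof (intro allI impI)
  fix e :: real assume e: "0 < e"
  obtain C where C: "0 < C" "\<And>lam u x1. \<lbrakk>sol lam u; 0 \<le> lam; 0 < u x1; \<And>y. u y \<le> u x1\<rbrakk>
    \<Longrightarrow> u x1 powr (p - 1) \<le> C * lam * u x1 powr q" using max_le_const_power by blast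
  \<comment> \<open>At \<open>lam = d\<close> the bound \<open>C * lam\<close> is exactly
    \<open>e powr (p - 1 - q)\<close>.\<close>
  define d where "d = e powr (p - 1 - q) / C"
  have d: "0 < d" using e C by (simp add: d_def)
  show "\<forall>\<^sub>F lam in at 0 within {0<..}. \<forall>x\<in>\<Omega>. dist (u lam x) 0 < e"
    unfolding eventually_at
  proof (intro exI[of _ d] conjI d(1) ballI[where A = "{0<..}"] impI sol_uniform_small)
    fix lam :: real and x1 assume lam: "lam \<in> {0<..}" "lam \<noteq> 0 \<and> dist lam 0 < d"
    show "sol lam (u lam)" using u lam by simp
    assume x1: "0 < u lam x1" "\<And>y. u lam y \<le> u lam x1" "e \<le> u lam x1"
    have "e powr (p - 1 - q) * u lam x1 powr q \<le> u lam x1 powr (p - 1 - q) * u lam x1 powr q"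
      using x1 e q by (intro mult_right_mono powr_mono2) auto
    also have "\<dots> = u lam x1 powr (p - 1)" using x1 by (simp add: powr_add[symmetric])
    also have "\<dots> \<le> C * lam * u lam x1 powr q" using C(2)[OF u _ x1(1,2)] lam by simp
    finally have "e powr (p - 1 - q) \<le> C * lam" using x1(1) by simp
    moreover have "C * lam < C * d" using lam C by (simp add: dist_real_def)
    ultimately show False using C by (simp add: d_def)
  qed
qed

text \<open>A maximum of size at least \<open>e\<close> would force a bound \<open>\<kappa>\<close>
  from below on \<open>K\<close>, where \<open>b > 0\<close>, and keep the absorption integral above
  a fixed \<open>c\<close>. Comparison with one fixed solution at \<open>lam'\<close> bounds the
  same integral by a multiple of \<open>lam - lambda1 s p \<Omega>\<close>.\<close>

lemma vanishing_linear:
  assumes q: "q = p - 1" and u: "\<And>lam. lam \<in> {lambda1 s p \<Omega> <..< \<Lambda>} \<Longrightarrow> sol lam (u lam)"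
    and K: "compact K" "K \<subseteq> \<Omega>" "\<And>x. x \<in> K \<Longrightarrow> 0 < b x" "0 < measure lborel K"
  shows "uniform_limit \<Omega> u (\<lambda>x. 0) (at (lambda1 s p \<Omega>) within {lambda1 s p \<Omega> <..< \<Lambda>})"
    (is "uniform_limit _ _ _ (at ?l within ?S)")
proof (cases "?S = {}")
  case True then show ?thesis by (simp add: uniform_limit_iff)
next
  case False
  then obtain lam' where lam': "lam' \<in> ?S" by blast
  have v: "sol lam' (u lam')" by (rule u[OF lam'])
  have l1_nonneg: "0 \<le> ?l" by (rule sol_lambda1_nonneg[OF q v])
  have v0: "0 \<le> lam'" "0 \<le> \<Lambda>" using l1_nonneg lam' by auto
  obtain x' where x': "0 < u lam' x'" "\<And>y. u lam' y \<le> u lam' x'" using sol_attains_max[OF v] by blast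
  obtain \<delta> where \<delta>: "0 < \<delta>" "\<And>lam u x1. \<lbrakk>sol lam u; 0 \<le> lam; lam \<le> \<Lambda>; 0 < u x1; \<And>y. u y \<le> u x1\<rbrakk>
      \<Longrightarrow> ennreal \<delta> \<le> emeasure lborel {y. u x1 / 2 < u y}" using superlevel_large[OF q v0(2)] by blast
  have K_sets [measurable]: "K \<in> sets borel" using borel_closed[OF compact_imp_closed[OF K(1)]] by simp
  let ?\<beta> = "\<integral>x. indicator K x * b x \<partial>lborel"
  have \<beta>_int: "integrable lborel (\<lambda>x. indicator K x * b x)"
  proof -
    have "integrable lborel (\<lambda>x. indicator \<Omega> x * (indicator K x * b x))"
    proof (rule integrable_cutoff[of _ B])
      show "AE x in lborel. x \<in> \<Omega> \<longrightarrow> \<bar>indicator K x * b x\<bar> \<le> B"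
        using b_le by eventually_elim (use b_nonneg B_nonneg in \<open>auto simp: indicator_def\<close>)
    qed measurable
    also have "(\<lambda>x. indicator \<Omega> x * (indicator K x * b x)) = (\<lambda>x. indicator K x * b x)"
      using K(2) by (intro ext) (auto simp: indicator_def)
    finally show ?thesis .
  qed
  \<comment> \<open>Only pointwise positivity of \<open>b\<close> on \<open>K\<close> is available,
    so the integral is shown to be positive through null sets.\<close>
  have \<beta>: "0 < ?\<beta>"
  proof -
    have nn: "0 \<le> indicator K x * b x" for x using K(3)[of x] by (auto simp: indicator_def)
    have "?\<beta> \<noteq> 0"
    proof
      assume "?\<beta> = 0"
      then have "AE x in lborel. indicator K x * b x = 0"
        using integral_nonneg_eq_0_iff_AE[OF \<beta>_int] nn by simp
      then have "AE x in lborel. x \<notin> K" by eventually_elim (use K(3) in \<open>force simp: indicator_def\<close>)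
      then have "K \<in> null_sets lborel" using AE_iff_null_sets[of K lborel] K_sets by simp
      then show False using K(4) by (simp add: null_sets_def measure_def)
    qed
    moreover have "0 \<le> ?\<beta>" using nn by (intro integral_nonneg_AE) auto
    ultimately show ?thesis by simp
  qed
  show ?thesis
    unfolding uniform_limit_iff
  proof (intro allI impI)
    fix e :: real assume e: "0 < e"
    have "0 < e / 2" using e by simp
    then obtain \<kappa> where \<kappa>: "0 < \<kappa>" "\<And>lam u x. \<lbrakk>sol lam u; 0 \<le> lam; ennreal \<delta> \<le> emeasure lborel {y. e / 2 < u y}; x \<in> K\<rbrakk> \<Longrightarrow> \<kappa> \<le> u x"
      using sol_uniform_lower_bound[OF v v0(1) K(1,2) \<delta>(1)] by blast
    define A where "A = B * u lam' x' powr (r + 1) * measure lborel \<Omega>"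
    have A: "0 \<le> A" using B_nonneg by (simp add: A_def)
    define c where "c = \<kappa> powr (r + 1) * ?\<beta>"
    have c: "0 < c" using \<kappa> \<beta> by (simp add: c_def)
    \<comment> \<open>Half the distance to \<open>lam'\<close>, so that
      \<open>lam' - lam \<ge> h\<close> for all \<open>lam\<close> considered.\<close>
    define h where "h = (lam' - ?l) / 2"
    have h: "0 < h" using lam' by (simp add: h_def)
    \<comment> \<open>The second entry makes \<open>(lam - ?l) * (A + 1) < h * c\<close>; adding 1
      covers \<open>A = 0\<close>.\<close>
    define d where "d = min h (h * c / (A + 1))"
    have d: "0 < d" using h c A by (simp add: d_def)
    show "\<forall>\<^sub>F lam in at ?l within ?S. \<forall>x\<in>\<Omega>. dist (u lam x) 0 < e"
      unfolding eventually_at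
    proof (intro exI[of _ d] conjI d(1) ballI[where A = ?S] impI sol_uniform_small)
      fix lam x1 assume lam: "lam \<in> ?S" "lam \<noteq> ?l \<and> dist lam ?l < d"
      show s: "sol lam (u lam)" by (rule u[OF lam(1)])
      assume x1: "0 < u lam x1" "\<And>y. u lam y \<le> u lam x1" "e \<le> u lam x1"
      note [measurable] = sol_measurable[OF s]
      have l: "?l < lam" "lam < ?l + h" "lam - ?l < h * c / (A + 1)" "0 < lam"
        using lam l1_nonneg by (auto simp: d_def dist_real_def)
      have l2: "lam < lam'" "h \<le> lam' - lam" using l(2) h by (auto simp: h_def field_simps)
      have "ennreal \<delta> \<le> emeasure lborel {y. u lam x1 / 2 < u lam y}"
        using \<delta>(2)[OF s _ _ x1(1,2)] lam l by simp
      also have "\<dots> \<le> emeasure lborel {y. e / 2 < u lam y}"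
        using x1(3) by (intro emeasure_mono) auto
      finally have low: "\<kappa> \<le> u lam x" if "x \<in> K" for x using \<kappa>(2)[OF s] l(4) that by simp
      have "c = (\<integral>x. \<kappa> powr (r + 1) * (indicator K x * b x) \<partial>lborel)" by (simp add: c_def)
      also have "\<dots> \<le> (\<integral>x. indicator \<Omega> x * (b x * u lam x powr (r + 1)) \<partial>lborel)"
      proof (rule integral_mono[OF _ sol_energy(2)[OF s]])
        show "integrable lborel (\<lambda>x. \<kappa> powr (r + 1) * (indicator K x * b x))" using \<beta>_int by simp
        fix x
        show "\<kappa> powr (r + 1) * (indicator K x * b x) \<le> indicator \<Omega> x * (b x * u lam x powr (r + 1))"
        proof (cases "x \<in> K")
          case True
          have "\<kappa> powr (r + 1) \<le> u lam x powr (r + 1)" using low[OF True] \<kappa> r_pos by (intro powr_mono2) auto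
          then have "b x * \<kappa> powr (r + 1) \<le> b x * u lam x powr (r + 1)" using K(3)[OF True] by (intro mult_left_mono) auto
          then show ?thesis using True K(2) by (auto simp: mult.commute)
        next
          case False
          then show ?thesis using b_nonneg[of x] by (simp add: indicator_def)
        qed
      qed
      finally have "h * c \<le> (lam' - lam) * (\<integral>x. indicator \<Omega> x * (b x * u lam x powr (r + 1)) \<partial>lborel)"
        using l2 c h by (intro mult_mono) auto
      also have "\<dots> \<le> (lam - ?l) * A"
        unfolding A_def by (rule sol_absorption_le[OF q v s l(1) l2(1) x'(2)])
      also have "\<dots> \<le> (lam - ?l) * (A + 1)" using l by (intro mult_left_mono) auto
      also have "\<dots> < h * c" using l(3) A by (simp add: field_simps)
      finally show False by simp
    qed
  qed
qed

end

theorem theorem1p3: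
  fixes \<Omega> \<Omega>0 :: "'a::euclidean_space set"
    and s p q r :: real
    and b :: "'a \<Rightarrow> real"
    and u :: "real \<Rightarrow> 'a \<Rightarrow> real"
  assumes dim: "DIM('a) \<ge> 2"
    and \<Omega>_domain: "open \<Omega>" "connected \<Omega>" "bounded \<Omega>" "\<Omega> \<noteq> {}"
    and \<Omega>_regular: "C11_open_set \<Omega>"
    and s: "0 < s" "s < 1"
    and p: "1 < p"
    and q: "0 < q" "q \<le> p - 1"
    and r: "r > p - 1"
    and b_meas: "b \<in> borel_measurable lborel"
    and b_bdd: "\<exists>M. AE x in lborel. x \<in> \<Omega> \<longrightarrow> \<bar>b x\<bar> \<le> M"
    and b_nonneg: "\<forall>x\<in>\<Omega>. b x \<ge> 0"
    and b_nonzero: "\<not> (AE x in lborel. x \<in> \<Omega> \<longrightarrow> b x = 0)"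
    and b_zeros: "{x\<in>\<Omega>. b x = 0} = closure \<Omega>0"
    and \<Omega>0: "\<Omega>0 \<subseteq> \<Omega>" "C11_open_set \<Omega>0" "emeasure lborel \<Omega>0 > 0"
    and sol: "\<forall>lam\<in>Lambda_q s p q \<Omega> \<Omega>0.
                weak_solution s p q r b \<Omega> lam (u lam) \<and> continuous_on UNIV (u lam)"
  shows
    "(\<forall>K. compact K \<and> K \<noteq> {} \<and> K \<subseteq> \<Omega>0 \<longrightarrow>
        filterlim (\<lambda>lam. Inf (u lam ` K)) at_top (to_sup_Lambda s p q \<Omega> \<Omega>0)) \<and>
     ((q = p - 1 \<or> (q < p - 1 \<and> p \<ge> 2)) \<longrightarrow>
        (\<forall>K. compact K \<and> K \<noteq> {} \<and> K \<subseteq> \<Omega> \<longrightarrow>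
           filterlim (\<lambda>lam. Inf (u lam ` K)) at_top (to_sup_Lambda s p q \<Omega> \<Omega>0))) \<and>
     uniform_limit \<Omega> u (\<lambda>x. 0) (to_inf_Lambda s p q \<Omega> \<Omega>0)"
proof -
  obtain M where M: "AE x in lborel. x \<in> \<Omega> \<longrightarrow> \<bar>b x\<bar> \<le> M" using b_bdd by blast
  \<comment> \<open>Replacing \<open>M\<close> by \<open>max 0 M\<close> makes the essential bound
    nonnegative.\<close>
  interpret P: logistic_problem \<Omega> s p q r b "max 0 M"
  proof
    show "AE x in lborel. x \<in> \<Omega> \<longrightarrow> b x \<le> max 0 M" using M by eventually_elim auto
  qed (use assms in auto)
  have U: "open \<Omega>0" "\<Omega>0 \<subseteq> \<Omega>" "\<Omega>0 \<noteq> {}" using \<Omega>0 by (auto simp: C11_open_set_def)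
  have b0: "b x = 0" if "x \<in> \<Omega>0" for x using b_zeros closure_subset[of \<Omega>0] that by blast
  have sol': "P.sol lam (u lam)" if "lam \<in> Lambda_q s p q \<Omega> \<Omega>0" for lam
    using sol that by (simp add: P.sol_def)
  \<comment> \<open>As \<open>b\<close> is not almost everywhere zero, its zero set
    \<open>closure \<Omega>0\<close> omits a point of \<open>\<Omega>\<close>. A closed ball about
    such a point is the set on which \<open>b > 0\<close> and functions supported in
    \<open>\<Omega>0\<close> vanish.\<close>
  have "\<Omega> - closure \<Omega>0 \<noteq> {}"
  proof
    assume "\<Omega> - closure \<Omega>0 = {}"
    then have "\<forall>x\<in>\<Omega>. b x = 0" using b_zeros by blast
    then show False using b_nonzero by simp
  qed
  then obtain z where z: "z \<in> \<Omega> - closure \<Omega>0" by blast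
  have "open (\<Omega> - closure \<Omega>0)" using \<Omega>_domain by (intro open_Diff) auto
  then obtain \<rho> where \<rho>: "0 < \<rho>" "cball z \<rho> \<subseteq> \<Omega> - closure \<Omega>0" using z open_contains_cball by blast
  let ?K = "cball z \<rho>"
  have K: "compact ?K" "?K \<subseteq> \<Omega>" "?K \<inter> \<Omega>0 = {}" "0 < measure lborel ?K"
    using \<rho> closure_subset[of \<Omega>0] by (auto simp: content_cball_pos)
  have Kb: "0 < b x" if "x \<in> ?K" for x
  proof -
    have x: "x \<in> \<Omega>" "x \<notin> closure \<Omega>0" using that \<rho>(2) by blast+
    then have "b x \<noteq> 0" using b_zeros by blast
    then show ?thesis using b_nonneg x(1) by (simp add: less_le)
  qed
  \<comment> \<open>Compact subsets of \<open>\<Omega>0\<close> are covered as well, since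
    \<open>\<Omega>0 \<subseteq> \<Omega>\<close>.\<close>
  have blowup: "filterlim (\<lambda>lam. Inf (u lam ` K)) at_top (to_sup_Lambda s p q \<Omega> \<Omega>0)"
    if "compact K" "K \<noteq> {}" "K \<subseteq> \<Omega>" for K
  proof (cases "q < p - 1")
    case True
    then show ?thesis
      using P.min_blowup_sublinear[OF True _ U b0 that, of u] sol' by (simp add: to_sup_Lambda_def Lambda_q_def)
  next
    case False
    then have "q = p - 1" using q by simp
    then show ?thesis
      using P.min_blowup_linear[OF _ _ U b0 K that, of u] sol' by (simp add: to_sup_Lambda_def Lambda_q_def)
  qed
  have "uniform_limit \<Omega> u (\<lambda>x. 0) (to_inf_Lambda s p q \<Omega> \<Omega>0)"
  proof (cases "q < p - 1")
    case True
    then show ?thesis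
      using P.vanishing_sublinear[OF True, of u] sol' by (simp add: to_inf_Lambda_def Lambda_q_def)
  next
    case False
    then have "q = p - 1" using q by simp
    then show ?thesis
      using P.vanishing_linear[OF _ _ K(1,2) Kb K(4), of "lambda1 s p \<Omega>0" u] sol' by (simp add: to_inf_Lambda_def Lambda_q_def)
  qed
  then show ?thesis using blowup U(2) by blast
qed

end
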